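(* Let $\mathrm{SCL}^{\mathrm{rp}} := \{ \mathrm{scl}_G(g) \mid G \text{ a recursively presented group},\ g \in G,\ \mathrm{scl}_G(g)<\infty \} \subset \mathbb{R}^{\geq 0}$ and let $\mathrm{RC}^{\geq 0} := \{ \alpha \in \mathbb{R} \mid \alpha \geq 0,\ \alpha \text{ right-computable} \}$. Then $$\mathrm{SCL}^{\mathrm{rp}} = \mathrm{RC}^{\geq 0}$$ as subsets of $\mathbb{R}^{\geq 0}$. Moreover, every non-negative computable real number and every non-negative algebraic real number lies in $\mathrm{SCL}^{\mathrm{rp}}$. The set $\mathrm{SCL}^{\mathrm{rp}}$ is closed under addition but not under subtraction, i.e.\ there are $\alpha, \beta \in \mathrm{SCL}^{\mathrm{rp}}$ with $\alpha - \beta > 0$ but $\alpha - \beta \notin \mathrm{SCL}^{\mathrm{rp}}$.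
   Context: For a group $G$ with commutator subgroup $G'=[G,G]$ and $g\in G'$, the commutator length $\mathrm{cl}_G(g)$ is the least $n$ such that $g=[x_1,y_1]\cdots[x_n,y_n]$ with $[x,y]=xyx^{-1}y^{-1}$, and the stable commutator length is $\mathrm{scl}_G(g)=\lim_{n\to\infty}\mathrm{cl}_G(g^n)/n$. For general $g\in G$: if $g^N\in G'$ for some $N\geq 1$ set $\mathrm{scl}_G(g)=\mathrm{scl}_G(g^N)/N$, otherwise $\mathrm{scl}_G(g)=\infty$. A presentation $\langle S\mid\mathcal{R}\rangle$ (with $S$ a finite alphabet) is recursive if $\mathcal{R}\subset F(S)$ is recursively enumerable; a group is recursively presented if it admits such a presentation. A real number $\alpha$ is computable if the set $\{q\in\mathbb{Q}\mid \alpha<q\}$ is computable (decidable by a Turing machine), and right-computable if this set is recursively enumerable. *)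

theory Defs
  imports Complex_Main "HOL-Library.Nat_Bijection" "HOL-Library.Extended_Real"
    "HOL-Computational_Algebra.Polynomial"
begin

datatype recf = Zero | Succ | Proj nat | Cn recf "recf list" | Pr recf recf | Mn recf

inductive eval :: "recf \<Rightarrow> nat list \<Rightarrow> nat \<Rightarrow> bool" where
  zero: "eval Zero xs 0"
| succ: "eval Succ (x # xs) (Suc x)"
| proj: "i < length xs \<Longrightarrow> eval (Proj i) xs (xs ! i)"
| comp: "list_all2 (\<lambda>g y. eval g xs y) gs ys \<Longrightarrow> eval f ys z \<Longrightarrow> eval (Cn f gs) xs z"
| pr0: "eval f xs y \<Longrightarrow> eval (Pr f g) (0 # xs) y"
| prS: "eval (Pr f g) (n # xs) y \<Longrightarrow> eval g (n # y # xs) z \<Longrightarrow> eval (Pr f g) (Suc n # xs) z"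
| mn: "eval f (n # xs) 0 \<Longrightarrow> (\<forall>m<n. \<exists>y. 0 < y \<and> eval f (m # xs) y) \<Longrightarrow> eval (Mn f) xs n"
monos list_all2_mono

definition re_set :: "nat set \<Rightarrow> bool" where
  "re_set A \<longleftrightarrow> (\<exists>f. \<forall>x. x \<in> A \<longleftrightarrow> (\<exists>y. eval f [x] y))"

definition dec_set :: "nat set \<Rightarrow> bool" where
  "dec_set A \<longleftrightarrow> (\<exists>f. \<forall>x. eval f [x] (if x \<in> A then 1 else 0))"

definition rat_code :: "rat \<Rightarrow> nat" where
  "rat_code q = prod_encode (int_encode (fst (quotient_of q)), nat (snd (quotient_of q)))"

fun list_code :: "nat list \<Rightarrow> nat" where
  "list_code [] = 0"
| "list_code (x # xs) = Suc (prod_encode (x, list_code xs))"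

definition right_computable :: "real \<Rightarrow> bool" where
  "right_computable \<alpha> \<longleftrightarrow> re_set (rat_code ` {q. \<alpha> < of_rat q})"

definition computable_real :: "real \<Rightarrow> bool" where
  "computable_real \<alpha> \<longleftrightarrow> dec_set (rat_code ` {q. \<alpha> < of_rat q})"

text \<open>Alphabet S = {s_0,...,s_(n-1)}; a word in F(S) is a list of letters, letter 2i stands
 for s_i and 2i+1 for s_i^-1.\<close>
definition words :: "nat \<Rightarrow> nat list set" where
  "words n = {w. \<forall>x \<in> set w. x < 2 * n}"

definition inv_letter :: "nat \<Rightarrow> nat" where
  "inv_letter x = (if even x then Suc x else x - 1)"

definition winv :: "nat list \<Rightarrow> nat list" where
  "winv w = rev (map inv_letter w)"

definition wpow :: "nat list \<Rightarrow> nat \<Rightarrow> nat list" where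
  "wpow w m = concat (replicate m w)"

inductive peq :: "nat list set \<Rightarrow> nat list \<Rightarrow> nat list \<Rightarrow> bool" for R where
  refl: "peq R u u"
| sym: "peq R u v \<Longrightarrow> peq R v u"
| trans: "peq R u v \<Longrightarrow> peq R v w \<Longrightarrow> peq R u w"
| cancel: "peq R (u @ [x, inv_letter x] @ v) (u @ v)"
| rel: "r \<in> R \<Longrightarrow> peq R (u @ r @ v) (u @ v)"

definition rec_pres :: "nat \<Rightarrow> nat list set \<Rightarrow> bool" where
  "rec_pres n R \<longleftrightarrow> R \<subseteq> words n \<and> re_set (list_code ` R)"

definition wcomm :: "nat list \<Rightarrow> nat list \<Rightarrow> nat list" where
  "wcomm x y = x @ y @ winv x @ winv y"

definition prod_comms :: "nat \<Rightarrow> nat list set \<Rightarrow> nat list \<Rightarrow> nat \<Rightarrow> bool" where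
  "prod_comms n R g k \<longleftrightarrow> (\<exists>xs ys. length xs = k \<and> length ys = k \<and>
      set xs \<subseteq> words n \<and> set ys \<subseteq> words n \<and>
      peq R g (concat (map2 wcomm xs ys)))"

definition in_comm_sub :: "nat \<Rightarrow> nat list set \<Rightarrow> nat list \<Rightarrow> bool" where
  "in_comm_sub n R g \<longleftrightarrow> (\<exists>k. prod_comms n R g k)"

definition cl :: "nat \<Rightarrow> nat list set \<Rightarrow> nat list \<Rightarrow> nat" where
  "cl n R g = (LEAST k. prod_comms n R g k)"

definition scl_comm :: "nat \<Rightarrow> nat list set \<Rightarrow> nat list \<Rightarrow> real" where
  "scl_comm n R g = lim (\<lambda>m. real (cl n R (wpow g m)) / real m)"

definition scl :: "nat \<Rightarrow> nat list set \<Rightarrow> nat list \<Rightarrow> ereal" where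
  "scl n R g = (if \<exists>N\<ge>1. in_comm_sub n R (wpow g N)
     then (let N = (LEAST N. N \<ge> 1 \<and> in_comm_sub n R (wpow g N))
           in ereal (scl_comm n R (wpow g N) / real N))
     else \<infinity>)"

definition SCL_rp :: "real set" where
  "SCL_rp = {a. \<exists>n R g. rec_pres n R \<and> g \<in> words n \<and> scl n R g = ereal a}"

end

theory Submission
  imports Defs
begin

text \<open>In the group of increasing bijections of the line that commute with \<open>t \<mapsto> t + 1\<close>, a commutator moves
  every point by less than 2. Hence if \<open>G\<close> acts through this group and \<open>g\<close> acts as the translation by
  \<open>2\<alpha>\<close>, then \<open>cl(g\<^sup>M) \<ge> \<alpha>M\<close>. On the other hand, \<open>(u v)\<^sup>m\<close> differs from \<open>u\<^sup>m v\<^sup>m\<close> by \<open>\<lfloor>m/2\<rfloor>\<close> commutators, so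
  \<open>scl(u v) \<le> 1/2\<close> if all powers of \<open>u\<close> and \<open>v\<close> are commutators. A relation \<open>(u v)\<^bsup>2a+1\<^esup> = g\<^sup>b\<close> then gives
  \<open>scl(g) \<le> (2a+1)/2b\<close>. Imposing one such relation for all \<open>a\<close>, \<open>b\<close> with \<open>\<alpha> < a/b\<close>, which are recursively
  enumerable if \<open>\<alpha>\<close> is right-computable, yields \<open>scl(g) = \<alpha>\<close>: all of them hold in a single action,
  because each translation by less than 1 is a product of two conjugates of a fixed \<open>f\<close>, and because
  the infinitely many conjugating maps can be coded into two of them.

  Conversely, \<open>scl(g)\<close> is an infimum of the values \<open>k/M\<close> for which \<open>g\<^sup>M\<close> is a product of \<open>k\<close> commutators, and
  these pairs are enumerated by searching for derivations. Right-computable numbers are not closed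
  under subtraction by the usual sum \<open>\<Sum>n\<in>K. 3\<^sup>-\<^sup>n\<close> over an undecidable enumerable set \<open>K\<close>.\<close>

section \<open>Computable functions, decidable and semidecidable predicates\<close>

text \<open>Two constants have to match. A commutator displaces points by less than 2, and a power
  of a product of two conjugates of f costs half a commutator per unit of the exponent. Both amount
  to half a translation length, so lower and upper bound can meet at \<alpha>. The surplus 1 in
  (2a+1)/2b vanishes because every pair (a,b) comes with all its multiples (Ma,Mb).

  Effectivity is needed for the relators only. The action merely certifies that they do not push
  scl(g) below \<alpha>; it is obtained by choice and may be non-computable, which is why enumerable
  upper bounds suffice.

  The obstacle is finite generation: every pair (a,b) asks for two conjugating maps of its own, all
  in one action. Coding them requires one common support with a fixed arc left over, into which the
  support can be pushed again and again. Hence the factors of every translation are first normalised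
  to a standard arc. Inside the group this normalisation is a power of one contraction, so its
  exponent must be computable from (a,b).\<close>

lemma eval_det: "eval f xs y \<Longrightarrow> eval f xs z \<Longrightarrow> y = z"
proof (induction arbitrary: z rule: eval.induct)
  case (zero xs)
  then show ?case by (auto elim: eval.cases)
next
  case (succ x xs)
  then show ?case by (auto elim: eval.cases)
next
  case (proj i xs)
  from proj(2) show ?case by (cases rule: eval.cases) auto
next
  case (comp xs gs ys f z')
  from comp.prems obtain ys' where 1: "list_all2 (\<lambda>g y. eval g xs y) gs ys'" "eval f ys' z"
    by (cases rule: eval.cases) auto
  have "ys = ys'" using comp.IH(1) 1(1)
    by (auto simp: list_all2_conv_all_nth intro!: nth_equalityI)
  then show ?case using comp.IH 1 by auto
next
  case (pr0 f xs y g)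
  from pr0.prems show ?case by (cases rule: eval.cases) (auto dest: pr0.IH)
next
  case (prS f g n xs y z')
  from prS.prems obtain y' where "eval (Pr f g) (n # xs) y'" "eval g (n # y' # xs) z"
    by (cases rule: eval.cases) auto
  then show ?case using prS.IH by metis
next
  case (mn f n xs)
  from mn.prems have 1: "eval f (z # xs) 0" "\<forall>m<z. \<exists>y>0. eval f (m # xs) y"
    by (cases rule: eval.cases; auto)+
  show ?case
  proof (rule linorder_cases[of n z])
    assume "n < z"
    then obtain y where "0 < y" "eval f (n # xs) y" using 1 by blast
    then show ?thesis using mn.IH by fastforce
  next
    assume "z < n"
    then obtain y where "0 < y" "\<And>w. eval f (z # xs) w \<Longrightarrow> y = w" using mn.IH by metis
    then show ?thesis using 1 by fastforce
  qed
qed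

text \<open>Fixing the length is what makes \<open>xs ! i\<close> computable: \<open>Proj i\<close>
  has no value on shorter lists.\<close>

definition computable_n :: "nat \<Rightarrow> (nat list \<Rightarrow> nat) \<Rightarrow> bool" where
  "computable_n k f \<longleftrightarrow> (\<exists>F. \<forall>xs. length xs = k \<longrightarrow> eval F xs (f xs))"

lemma computable_n_cong: "computable_n k f \<Longrightarrow> (\<And>xs. length xs = k \<Longrightarrow> f xs = g xs) \<Longrightarrow> computable_n k g"
  unfolding computable_n_def by metis

lemma computable_n_const: "computable_n k (\<lambda>_. c)"
proof (induction c)
  case 0
  show ?case unfolding computable_n_def using eval.zero by blast
next
  case (Suc c)
  then obtain F where "\<forall>xs. length xs = k \<longrightarrow> eval F xs c" unfolding computable_n_def by blast
  then have "\<forall>xs. length xs = k \<longrightarrow> eval (Cn Succ [F]) xs (Suc c)"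
    by (auto intro!: eval.comp[where ys="[c]"] eval.succ)
  then show ?case unfolding computable_n_def by blast
qed

lemma computable_n_proj: "i < k \<Longrightarrow> computable_n k (\<lambda>xs. xs ! i)"
  unfolding computable_n_def using eval.proj by blast

lemma computable_n_Suc0: "computable_n 1 (\<lambda>xs. Suc (xs ! 0))"
  unfolding computable_n_def by (rule exI[of _ Succ]) (auto simp: length_Suc_conv intro: eval.succ)

lemma computable_n_comp:
  assumes f: "computable_n m f" and gs: "\<And>g. g \<in> set gs \<Longrightarrow> computable_n k g" and m: "length gs = m"
  shows "computable_n k (\<lambda>xs. f (map (\<lambda>g. g xs) gs))"
proof -
  obtain F where F: "\<And>xs. length xs = m \<Longrightarrow> eval F xs (f xs)" using f unfolding computable_n_def by blast
  obtain G where G: "\<And>g xs. g \<in> set gs \<Longrightarrow> length xs = k \<Longrightarrow> eval (G g) xs (g xs)"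
    using gs unfolding computable_n_def by metis
  have "eval (Cn F (map G gs)) xs (f (map (\<lambda>g. g xs) gs))" if "length xs = k" for xs
    by (rule eval.comp[where ys="map (\<lambda>g. g xs) gs"])
       (use that m in \<open>auto simp: list_all2_conv_all_nth intro!: F G\<close>)
  then show ?thesis unfolding computable_n_def by blast
qed

lemma computable_n_comp1: "computable_n 1 (\<lambda>xs. f (xs ! 0)) \<Longrightarrow> computable_n k g \<Longrightarrow> computable_n k (\<lambda>xs. f (g xs))"
  using computable_n_comp[where f="\<lambda>xs. f (xs ! 0)" and m=1 and gs="[g]" and k=k] by simp

lemma computable_n_comp2: "computable_n 2 (\<lambda>xs. f (xs ! 0) (xs ! 1)) \<Longrightarrow> computable_n k g \<Longrightarrow> computable_n k h \<Longrightarrow> computable_n k (\<lambda>xs. f (g xs) (h xs))"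
  using computable_n_comp[where f="\<lambda>xs. f (xs ! 0) (xs ! 1)" and m=2 and gs="[g, h]" and k=k] by fastforce

lemma computable_n_Suc: "computable_n k f \<Longrightarrow> computable_n k (\<lambda>xs. Suc (f xs))"
  by (rule computable_n_comp1[OF computable_n_Suc0])

lemma computable_n_rec:
  assumes g: "computable_n k g" and h: "computable_n (Suc (Suc k)) h"
  shows "computable_n (Suc k) (\<lambda>xs. rec_nat (g (tl xs)) (\<lambda>n r. h (n # r # tl xs)) (hd xs))"
proof -
  obtain G H where G: "\<And>xs. length xs = k \<Longrightarrow> eval G xs (g xs)"
    and H: "\<And>xs. length xs = Suc (Suc k) \<Longrightarrow> eval H xs (h xs)" using g h unfolding computable_n_def by blast
  have "eval (Pr G H) (n # xs) (rec_nat (g xs) (\<lambda>n r. h (n # r # xs)) n)" if "length xs = k" for n xs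
    by (induction n) (use that in \<open>auto intro!: eval.pr0 eval.prS G H\<close>)
  then show ?thesis unfolding computable_n_def by (intro exI[of _ "Pr G H"]) (auto simp: length_Suc_conv)
qed

lemma computable_n_rec1:
  assumes "computable_n 2 (\<lambda>xs. h (xs ! 0) (xs ! 1))"
  shows "computable_n 1 (\<lambda>xs. rec_nat c h (xs ! 0))"
  using computable_n_rec[OF computable_n_const[of 0 c], of "\<lambda>xs. h (xs ! 0) (xs ! 1)"] assms
  by (auto simp: numeral_2_eq_2 elim!: computable_n_cong simp: length_Suc_conv)

lemma computable_n_rec2:
  assumes "computable_n 1 (\<lambda>xs. g (xs ! 0))" "computable_n 3 (\<lambda>xs. h (xs ! 2) (xs ! 0) (xs ! 1))"
  shows "computable_n 2 (\<lambda>xs. rec_nat (g (xs ! 1)) (h (xs ! 1)) (xs ! 0))"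
  using computable_n_rec[OF assms(1), of "\<lambda>xs. h (xs ! 2) (xs ! 0) (xs ! 1)"] assms(2)
  by (auto simp: numeral_2_eq_2 numeral_3_eq_3 elim!: computable_n_cong simp: length_Suc_conv)

lemma computable_n_add: "computable_n k f \<Longrightarrow> computable_n k g \<Longrightarrow> computable_n k (\<lambda>xs. f xs + g xs)"
proof (rule computable_n_comp2[where f="(+)"])
  have "rec_nat b (\<lambda>n. Suc) a = a + b" for a b :: nat by (induction a) auto
  then show "computable_n 2 (\<lambda>xs. xs ! 0 + xs ! 1)"
    using computable_n_rec2[of "\<lambda>x. x" "\<lambda>_ _ r. Suc r"] by (simp add: computable_n_proj computable_n_Suc)
qed

lemma computable_n_mult: "computable_n k f \<Longrightarrow> computable_n k g \<Longrightarrow> computable_n k (\<lambda>xs. f xs * g xs)"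
proof (rule computable_n_comp2[where f="(*)"])
  have "rec_nat 0 (\<lambda>n r. r + b) a = a * b" for a b :: nat by (induction a) auto
  then show "computable_n 2 (\<lambda>xs. xs ! 0 * xs ! 1)"
    using computable_n_rec2[of "\<lambda>x. 0" "\<lambda>x _ r. r + x"] by (simp add: computable_n_proj computable_n_add computable_n_const)
qed

lemma computable_n_pred: "computable_n k f \<Longrightarrow> computable_n k (\<lambda>xs. f xs - 1)"
proof (rule computable_n_comp1[where f="\<lambda>x. x - 1"])
  have "rec_nat 0 (\<lambda>n r. n) a = a - 1" for a :: nat by (induction a) auto
  then show "computable_n 1 (\<lambda>xs. xs ! 0 - 1)"
    using computable_n_rec1[of "\<lambda>n r. n" 0] by (simp add: computable_n_proj)
qed

lemma computable_n_diff: "computable_n k f \<Longrightarrow> computable_n k g \<Longrightarrow> computable_n k (\<lambda>xs. f xs - g xs)"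
proof -
  have "rec_nat b (\<lambda>n r. r - 1) a = b - a" for a b :: nat by (induction a) auto
  then have "computable_n 2 (\<lambda>xs. xs ! 1 - xs ! 0)"
    using computable_n_rec2[of "\<lambda>x. x" "\<lambda>x _ r. r - 1"] computable_n_pred[OF computable_n_proj[of 1 3]] by (simp add: computable_n_proj)
  then show "computable_n k f \<Longrightarrow> computable_n k g \<Longrightarrow> computable_n k (\<lambda>xs. f xs - g xs)" using computable_n_comp2[of "\<lambda>x y. y - x" k g f] by auto
qed

lemma computable_n_if:
  assumes "computable_n k p" "computable_n k f" "computable_n k g"
  shows "computable_n k (\<lambda>xs. if p xs = 0 then f xs else g xs)"
proof -
  have "(if p xs = 0 then f xs else g xs) = (1 - p xs) * f xs + (1 - (1 - p xs)) * g xs" for xs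
    by (cases "p xs") auto
  then show ?thesis using assms by (auto intro!: computable_n_add computable_n_mult computable_n_diff computable_n_const)
qed

lemma computable_n_triangle: "computable_n k f \<Longrightarrow> computable_n k (\<lambda>xs. triangle (f xs))"
proof (rule computable_n_comp1[where f=triangle])
  have "rec_nat 0 (\<lambda>n r. r + Suc n) a = triangle a" for a :: nat by (induction a) auto
  then show "computable_n 1 (\<lambda>xs. triangle (xs ! 0))"
    using computable_n_rec1[of "\<lambda>n r. r + Suc n" 0] computable_n_add[OF computable_n_proj[of 1 2] computable_n_Suc[OF computable_n_proj[of 0 2]]] by simp
qed

section \<open>The pairing function and its projections\<close>

abbreviation pr :: "nat \<Rightarrow> nat \<Rightarrow> nat" where "pr x y \<equiv> prod_encode (x, y)"
definition pf :: "nat \<Rightarrow> nat" where "pf z = fst (prod_decode z)"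
definition ps :: "nat \<Rightarrow> nat" where "ps z = snd (prod_decode z)"

lemma pf_pr [simp]: "pf (pr x y) = x" and ps_pr [simp]: "ps (pr x y) = y"
  and pr_pf_ps [simp]: "pr (pf z) (ps z) = z"
  by (auto simp: pf_def ps_def)

lemma computable_n_pr: "computable_n k f \<Longrightarrow> computable_n k g \<Longrightarrow> computable_n k (\<lambda>xs. pr (f xs) (g xs))"
  unfolding prod_encode_def by (auto intro!: computable_n_add computable_n_triangle)

text \<open>The diagonal on which \<open>z\<close> lies is found by recursion on \<open>z\<close>.\<close>
lemma pf_plus_ps: "rec_nat 0 (\<lambda>n r. if triangle (Suc r) - Suc n = 0 then Suc r else r) z = pf z + ps z"
proof (induction z)
  case 0
  have "pr 0 0 = 0" by (simp add: prod_encode_def)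
  then show ?case by (metis add_0 old.nat.simps(6) pf_pr ps_pr)
next
  case (Suc z)
  define x y where "x = pf z" and "y = ps z"
  have z: "z = triangle (x + y) + x" unfolding x_def y_def
    using pr_pf_ps[of z] by (simp add: prod_encode_def)
  have "Suc z = (if y = 0 then pr 0 (Suc x) else pr (Suc x) (y - 1))"
    using z by (cases y) (auto simp: prod_encode_def)
  then have "pf (Suc z) + ps (Suc z) = (if y = 0 then Suc x else x + y)"
    by (cases y) simp_all
  moreover have "triangle (Suc (x + y)) - Suc z = 0 \<longleftrightarrow> y = 0" using z by auto
  ultimately show ?case using Suc by (simp add: x_def y_def)
qed

lemma computable_n_pf_plus_ps: "computable_n k f \<Longrightarrow> computable_n k (\<lambda>xs. pf (f xs) + ps (f xs))"
proof (rule computable_n_comp1[where f="\<lambda>z. pf z + ps z"])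
  have "computable_n 2 (\<lambda>xs. if triangle (Suc (xs ! 1)) - Suc (xs ! 0) = 0 then Suc (xs ! 1) else xs ! 1)"
    by (intro computable_n_if computable_n_diff computable_n_triangle computable_n_Suc computable_n_proj) simp_all
  from computable_n_rec1[OF this, of 0] show "computable_n 1 (\<lambda>xs. pf (xs ! 0) + ps (xs ! 0))"
    by (simp only: pf_plus_ps)
qed

text \<open>\<open>prod_encode\<close> adds the first component to the triangle number of the
  diagonal, so the diagonal determines both components.\<close>

lemma pf_eq: "pf z = z - triangle (pf z + ps z)"
  using pr_pf_ps[of z] unfolding prod_encode_def by (simp add: split_beta)

lemma computable_n_pf: assumes "computable_n k f" shows "computable_n k (\<lambda>xs. pf (f xs))"
  by (rule computable_n_cong[OF computable_n_diff[OF assms computable_n_triangle[OF computable_n_pf_plus_ps[OF assms]]]]) (simp flip: pf_eq)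

lemma computable_n_ps: assumes "computable_n k f" shows "computable_n k (\<lambda>xs. ps (f xs))"
  by (rule computable_n_cong[OF computable_n_diff[OF computable_n_pf_plus_ps[OF assms] computable_n_pf[OF assms]]]) simp

text \<open>Unary functions suffice from here on: further arguments travel inside one pair code, so
  a predicate of x and y is treated as a predicate of z with \<open>pf z\<close> and
  \<open>ps z\<close> in their place.\<close>

definition computable :: "(nat \<Rightarrow> nat) \<Rightarrow> bool" where
  "computable f \<longleftrightarrow> (\<exists>F. \<forall>x. eval F [x] (f x))"

lemma computable_cfn: "computable f \<longleftrightarrow> computable_n 1 (\<lambda>xs. f (xs ! 0))"
  unfolding computable_def computable_n_def
  by (rule arg_cong[of _ _ Ex], rule ext) (auto simp: length_Suc_conv; fastforce)

text \<open>Rules shaped after the syntax of terms, so that computability follows by descending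
  through an expression with \<open>intro\<close>.\<close>

named_theorems computable_intros

lemma computable_comp: "computable f \<Longrightarrow> computable g \<Longrightarrow> computable (\<lambda>x. f (g x))"
  unfolding computable_cfn by (rule computable_n_comp1)

lemma computable_basic [computable_intros]:
  "computable (\<lambda>x. x)" "computable (\<lambda>x. c)"
  "computable f \<Longrightarrow> computable (\<lambda>x. Suc (f x))" "computable f \<Longrightarrow> computable (\<lambda>x. pf (f x))" "computable f \<Longrightarrow> computable (\<lambda>x. ps (f x))"
  "computable f \<Longrightarrow> computable g \<Longrightarrow> computable (\<lambda>x. f x + g x)" "computable f \<Longrightarrow> computable g \<Longrightarrow> computable (\<lambda>x. f x * g x)"
  "computable f \<Longrightarrow> computable g \<Longrightarrow> computable (\<lambda>x. f x - g x)" "computable f \<Longrightarrow> computable g \<Longrightarrow> computable (\<lambda>x. pr (f x) (g x))"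
  unfolding computable_cfn
  by (auto intro!: computable_n_proj computable_n_const computable_n_Suc computable_n_pf computable_n_ps computable_n_add computable_n_mult computable_n_diff computable_n_pr)

lemma computable_rec [computable_intros]:
  assumes "computable f" "computable g" "computable (\<lambda>z. h (pf z) (pf (ps z)) (ps (ps z)))"
  shows "computable (\<lambda>x. rec_nat (g x) (h x) (f x))"
proof -
  have "computable_n 3 (\<lambda>xs. h (xs ! 2) (xs ! 0) (xs ! 1))"
    using computable_n_comp1[of "\<lambda>z. h (pf z) (pf (ps z)) (ps (ps z))" 3 "\<lambda>xs. pr (xs ! 2) (pr (xs ! 0) (xs ! 1))"]
      assms(3) by (simp add: computable_cfn computable_n_pr computable_n_proj)
  from computable_n_comp2[OF computable_n_rec2[OF assms(2)[unfolded computable_cfn] this], of 1 "\<lambda>xs. f (xs ! 0)" "\<lambda>xs. xs ! 0"]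
  show ?thesis using assms(1) by (simp add: computable_cfn computable_n_proj)
qed

definition decidable :: "(nat \<Rightarrow> bool) \<Rightarrow> bool" where "decidable P \<longleftrightarrow> computable (\<lambda>x. of_bool (P x))"

lemma computable_of_bool [computable_intros]: "decidable P \<Longrightarrow> computable (\<lambda>x. of_bool (P x))"
  unfolding decidable_def .

lemma computable_if [computable_intros]: "decidable P \<Longrightarrow> computable f \<Longrightarrow> computable g \<Longrightarrow> computable (\<lambda>x. if P x then f x else g x)"
proof -
  have eq: "(if P x then f x else g x) = of_bool (P x) * f x + (1 - of_bool (P x)) * g x" for x by auto
  show "decidable P \<Longrightarrow> computable f \<Longrightarrow> computable g \<Longrightarrow> ?thesis" unfolding eq by (intro computable_intros)
qed

lemma decidable_comp: "decidable P \<Longrightarrow> computable f \<Longrightarrow> decidable (\<lambda>x. P (f x))"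
  unfolding decidable_def by (rule computable_comp)

lemma decidable_const [computable_intros]: "decidable (\<lambda>x. c)"
  unfolding decidable_def by (rule computable_intros)

lemma decidable_eq [computable_intros]: "computable f \<Longrightarrow> computable g \<Longrightarrow> decidable (\<lambda>x. f x = g x)"
proof -
  have eq: "of_bool (f x = g x) = 1 - ((f x - g x) + (g x - f x))" for x by auto
  show "computable f \<Longrightarrow> computable g \<Longrightarrow> ?thesis" unfolding decidable_def eq by (intro computable_intros)
qed

lemma decidable_less [computable_intros]: "computable f \<Longrightarrow> computable g \<Longrightarrow> decidable (\<lambda>x. f x < g x)"
proof -
  have eq: "of_bool (f x < g x) = 1 - (1 - (g x - f x))" for x by auto
  show "computable f \<Longrightarrow> computable g \<Longrightarrow> ?thesis" unfolding decidable_def eq by (intro computable_intros)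
qed

lemma decidable_not [computable_intros]: "decidable P \<Longrightarrow> decidable (\<lambda>x. \<not> P x)"
proof -
  have eq: "of_bool (\<not> P x) = 1 - (of_bool (P x) :: nat)" for x by auto
  show "decidable P \<Longrightarrow> ?thesis" unfolding decidable_def[of "\<lambda>x. \<not> P x"] eq by (intro computable_intros)
qed

lemma decidable_conj [computable_intros]: "decidable P \<Longrightarrow> decidable Q \<Longrightarrow> decidable (\<lambda>x. P x \<and> Q x)"
proof -
  have eq: "of_bool (P x \<and> Q x) = of_bool (P x) * (of_bool (Q x) :: nat)" for x by auto
  assume "decidable P" "decidable Q"
  then have "computable (\<lambda>x. of_bool (P x) * of_bool (Q x))" by (intro computable_intros)
  then show ?thesis unfolding decidable_def eq .
qed

lemma decidable_disj [computable_intros]: "decidable P \<Longrightarrow> decidable Q \<Longrightarrow> decidable (\<lambda>x. P x \<or> Q x)"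
proof -
  have eq: "(P x \<or> Q x) = (\<not> (\<not> P x \<and> \<not> Q x))" for x by blast
  show "decidable P \<Longrightarrow> decidable Q \<Longrightarrow> ?thesis" unfolding eq by (intro computable_intros)
qed

lemma decidable_le [computable_intros]: "computable f \<Longrightarrow> computable g \<Longrightarrow> decidable (\<lambda>x. f x \<le> g x)"
  unfolding not_less[symmetric] by (intro computable_intros)

lemma decidable_all_less [computable_intros]:
  assumes "computable f" "decidable (\<lambda>z. P (pf z) (ps z))"
  shows "decidable (\<lambda>x. \<forall>y<f x. P x y)"
proof -
  have "of_bool (\<forall>y<n. P x y) = rec_nat (1 :: nat) (\<lambda>m r. r * of_bool (P x m)) n" for n x
  proof (induction n)
    case (Suc n)
    have "of_bool (\<forall>y<Suc n. P x y) = of_bool (\<forall>y<n. P x y) * (of_bool (P x n) :: nat)"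
      by (auto simp: less_Suc_eq)
    then show ?case using Suc by simp
  qed simp
  moreover have "decidable (\<lambda>z. P (pf z) (pf (ps z)))"
    by (rule decidable_comp[OF assms(2), of "\<lambda>z. pr (pf z) (pf (ps z))", simplified]) (intro computable_intros)
  then have "computable (\<lambda>x. rec_nat 1 (\<lambda>m r. r * of_bool (P x m)) (f x))"
    using assms(1) by (intro computable_intros)
  ultimately show ?thesis unfolding decidable_def by simp
qed

lemma decidable_ex_less [computable_intros]:
  assumes "computable f" "decidable (\<lambda>z. P (pf z) (ps z))"
  shows "decidable (\<lambda>x. \<exists>y<f x. P x y)"
  using decidable_not[OF decidable_all_less[OF assms(1) decidable_not[OF assms(2)]]] by simp

text \<open>Projection of a decidable relation instead of halting: closure under conjunction and
  quantifiers then only regroups witnesses and needs no interleaving of computations.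
  \<open>re_set_iff\<close> gives the equivalence with \<open>re_set\<close>.\<close>

definition semidecidable :: "(nat \<Rightarrow> bool) \<Rightarrow> bool" where
  "semidecidable P \<longleftrightarrow> (\<exists>Q. decidable (\<lambda>z. Q (pf z) (ps z)) \<and> (\<forall>x. P x \<longleftrightarrow> (\<exists>y. Q x y)))"

lemma computable_ps [computable_intros]: "computable ps"
  by (intro computable_basic(1,5))

named_theorems semidecidable_intros

lemma semidecidable_dp: assumes "decidable P" shows "semidecidable P"
  unfolding semidecidable_def by (intro exI[of _ "\<lambda>x y. P x"] conjI decidable_comp[OF assms] computable_intros) simp

lemma semidecidable_comp: assumes "semidecidable P" "computable f" shows "semidecidable (\<lambda>x. P (f x))"
proof -
  obtain Q where Q: "decidable (\<lambda>z. Q (pf z) (ps z))" "\<And>x. P x \<longleftrightarrow> (\<exists>y. Q x y)"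
    using assms(1) unfolding semidecidable_def by blast
  have "decidable (\<lambda>z. Q (f (pf z)) (ps z))"
    by (rule decidable_comp[OF Q(1), of "\<lambda>z. pr (f (pf z)) (ps z)", simplified]) (intro computable_intros computable_comp[OF assms(2)])
  then show ?thesis unfolding semidecidable_def by (intro exI[of _ "\<lambda>x y. Q (f x) y"]) (simp add: Q(2))
qed

lemma semidecidable_ex [semidecidable_intros]:
  assumes "semidecidable (\<lambda>z. P (pf z) (ps z))" shows "semidecidable (\<lambda>x. \<exists>y. P x y)"
proof -
  obtain Q where Q: "decidable (\<lambda>z. Q (pf z) (ps z))" "\<And>x. P (pf x) (ps x) \<longleftrightarrow> (\<exists>y. Q x y)"
    using assms unfolding semidecidable_def by blast
  have "decidable (\<lambda>z. Q (pr (pf z) (pf (ps z))) (ps (ps z)))"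
    by (rule decidable_comp[OF Q(1), of "\<lambda>z. pr (pr (pf z) (pf (ps z))) (ps (ps z))", simplified]) (intro computable_intros)
  moreover have "(\<exists>y. P x y) \<longleftrightarrow> (\<exists>w. Q (pr x (pf w)) (ps w))" for x
    using Q(2)[of "pr x _"] by (metis pf_pr ps_pr)
  ultimately show ?thesis unfolding semidecidable_def by (intro exI[of _ "\<lambda>x w. Q (pr x (pf w)) (ps w)"]) simp
qed

lemma semidecidable_conj [semidecidable_intros]:
  assumes "semidecidable P" "semidecidable Q" shows "semidecidable (\<lambda>x. P x \<and> Q x)"
proof -
  obtain P' where P: "decidable (\<lambda>z. P' (pf z) (ps z))" "\<And>x. P x \<longleftrightarrow> (\<exists>y. P' x y)"
    using assms(1) unfolding semidecidable_def by blast
  obtain Q' where Q: "decidable (\<lambda>z. Q' (pf z) (ps z))" "\<And>x. Q x \<longleftrightarrow> (\<exists>y. Q' x y)"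
    using assms(2) unfolding semidecidable_def by blast
  have "decidable (\<lambda>z. P' (pf z) (pf (ps z)) \<and> Q' (pf z) (ps (ps z)))"
    by (intro decidable_conj decidable_comp[OF P(1), of "\<lambda>z. pr (pf z) (pf (ps z))", simplified]
      decidable_comp[OF Q(1), of "\<lambda>z. pr (pf z) (ps (ps z))", simplified] computable_intros)
  moreover have "(P x \<and> Q x) \<longleftrightarrow> (\<exists>w. P' x (pf w) \<and> Q' x (ps w))" for x
    unfolding P(2) Q(2) by (metis pf_pr ps_pr)
  ultimately show ?thesis unfolding semidecidable_def
    by (intro exI[of _ "\<lambda>x w. P' x (pf w) \<and> Q' x (ps w)"]) simp
qed

lemma semidecidable_disj [semidecidable_intros]:
  assumes "semidecidable P" "semidecidable Q" shows "semidecidable (\<lambda>x. P x \<or> Q x)"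
proof -
  obtain P' where P: "decidable (\<lambda>z. P' (pf z) (ps z))" "\<And>x. P x \<longleftrightarrow> (\<exists>y. P' x y)"
    using assms(1) unfolding semidecidable_def by blast
  obtain Q' where Q: "decidable (\<lambda>z. Q' (pf z) (ps z))" "\<And>x. Q x \<longleftrightarrow> (\<exists>y. Q' x y)"
    using assms(2) unfolding semidecidable_def by blast
  show ?thesis unfolding semidecidable_def
    by (rule exI[of _ "\<lambda>x w. P' x w \<or> Q' x w"]) (use P Q decidable_disj in auto)
qed

lemma semidecidable_atoms [semidecidable_intros]:
  "semidecidable (\<lambda>x. c)" "computable f \<Longrightarrow> computable g \<Longrightarrow> semidecidable (\<lambda>x. f x = g x)" "computable f \<Longrightarrow> computable g \<Longrightarrow> semidecidable (\<lambda>x. f x < g x)"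
  "computable f \<Longrightarrow> computable g \<Longrightarrow> semidecidable (\<lambda>x. f x \<le> g x)" "decidable P \<Longrightarrow> semidecidable (\<lambda>x. \<not> P x)"
  by (intro semidecidable_dp computable_intros; assumption)+

text \<open>Finitely many witnesses lie below a common bound B, so the unbounded search moves in
  front of the bounded quantifier.\<close>

lemma semidecidable_all_less [semidecidable_intros]:
  assumes "computable f" "semidecidable (\<lambda>z. P (pf z) (ps z))"
  shows "semidecidable (\<lambda>x. \<forall>y<f x. P x y)"
proof -
  obtain Q where Q: "decidable (\<lambda>z. Q (pf z) (ps z))" "\<And>x. P (pf x) (ps x) \<longleftrightarrow> (\<exists>y. Q x y)"
    using assms(2) unfolding semidecidable_def by blast
  have P: "P x y \<longleftrightarrow> (\<exists>w. Q (pr x y) w)" for x y using Q(2)[of "pr x y"] by simp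
  have "(\<forall>y<n. P x y) \<longleftrightarrow> (\<exists>B. \<forall>y<n. \<exists>w<B. Q (pr x y) w)" for n x
  proof
    assume "\<forall>y<n. P x y"
    then obtain W where W: "\<And>y. y < n \<Longrightarrow> Q (pr x y) (W y)" unfolding P by metis
    have "W y < Suc (\<Sum>y<n. W y)" if "y < n" for y
      using that by (simp add: le_imp_less_Suc member_le_sum)
    then show "\<exists>B. \<forall>y<n. \<exists>w<B. Q (pr x y) w" using W by blast
  qed (auto simp: P)
  moreover have "decidable (\<lambda>z. Q (pr (pf (pf (pf z))) (ps (pf z))) (ps z))"
    by (rule decidable_comp[OF Q(1), of "\<lambda>z. pr (pr (pf (pf (pf z))) (ps (pf z))) (ps z)", simplified]) (intro computable_intros)
  then have "decidable (\<lambda>z. \<forall>y<f (pf z). \<exists>w<ps z. Q (pr (pf z) y) w)"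
    by (intro computable_intros computable_comp[OF assms(1)])
  then have "semidecidable (\<lambda>x. \<exists>B. \<forall>y<f x. \<exists>w<B. Q (pr x y) w)" by (intro semidecidable_intros semidecidable_dp)
  ultimately show ?thesis by simp
qed

lemma semidecidable_re_set: assumes "semidecidable P" shows "re_set {x. P x}"
proof -
  obtain Q where Q: "decidable (\<lambda>z. Q (pf z) (ps z))" "\<And>x. P x \<longleftrightarrow> (\<exists>y. Q x y)"
    using assms unfolding semidecidable_def by blast
  \<comment> \<open>\<open>Mn\<close> stops at the value 0, hence the negation; its search variable
    is the first argument, hence the exchange of \<open>pf\<close> and \<open>ps\<close>.\<close>
  have "decidable (\<lambda>z. \<not> Q (ps z) (pf z))"
    by (rule decidable_not[OF decidable_comp[OF Q(1), of "\<lambda>z. pr (ps z) (pf z)", simplified]]) (intro computable_intros)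
  then have "computable_n 2 (\<lambda>xs. of_bool (\<not> Q (xs ! 1) (xs ! 0)))"
    using computable_n_comp1[of "\<lambda>z. of_bool (\<not> Q (ps z) (pf z))" 2 "\<lambda>xs. pr (xs ! 0) (xs ! 1)"]
    unfolding decidable_def computable_cfn by (simp add: computable_n_pr computable_n_proj)
  then obtain F where "\<And>xs. length xs = 2 \<Longrightarrow> eval F xs (of_bool (\<not> Q (xs ! 1) (xs ! 0)))"
    unfolding computable_n_def by blast
  from this[of "[y, x]" for x y] have F: "eval F [y, x] (of_bool (\<not> Q x y))" for x y by simp
  have "(\<exists>n. eval (Mn F) [x] n) \<longleftrightarrow> P x" for x
  proof
    assume "\<exists>n. eval (Mn F) [x] n"
    then obtain n where "eval F [n, x] 0" by (auto elim: eval.cases)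
    then show "P x" using eval_det[OF F] Q(2) by fastforce
  next
    assume "P x"
    then have ex: "\<exists>y. Q x y" using Q(2) by simp
    define n where "n = (LEAST y. Q x y)"
    have n: "Q x n" "\<And>m. m < n \<Longrightarrow> \<not> Q x m"
      unfolding n_def using LeastI_ex[OF ex] not_less_Least by blast+
    have "eval (Mn F) [x] n"
    proof (rule eval.mn)
      show "eval F [n, x] 0" using F[of n x] n(1) by simp
      show "\<forall>m<n. \<exists>y>0. eval F [m, x] y"
        using F[of _ x] n(2) by (metis of_bool_eq(2) zero_less_one)
    qed
    then show "\<exists>n. eval (Mn F) [x] n" ..
  qed
  then show ?thesis unfolding re_set_def by auto
qed

section \<open>Lists of naturals coded as numbers\<close>

lemma list_code_eq_iff [simp]: "list_code xs = list_code ys \<longleftrightarrow> xs = ys"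
proof (induction xs arbitrary: ys)
  case Nil
  then show ?case by (cases ys) auto
next
  case (Cons x xs)
  then show ?case by (cases ys) auto
qed

lemma list_code_0: "list_code l = 0 \<longleftrightarrow> l = []"
  by (cases l) auto

text \<open>Every number is the code of a list, so searching through lists is searching through all
  numbers, with no test for valid codes.\<close>

lemma list_code_surj: "\<exists>l. list_code l = c"
proof (induction c rule: less_induct)
  case (less c)
  show ?case
  proof (cases c)
    case 0
    then show ?thesis by (intro exI[of _ "[]"]) simp
  next
    case (Suc d)
    have "ps d < c" using le_prod_encode_2[of "ps d" "pf d"] Suc by simp
    then obtain l where "list_code l = ps d" using less by blast
    then have "list_code (pf d # l) = c" using Suc by simp
    then show ?thesis by blast
  qed
qed

definition decode_list :: "nat \<Rightarrow> nat list" where "decode_list c = (THE l. list_code l = c)"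

lemma decode_list_list_code [simp]: "decode_list (list_code l) = l"
  unfolding decode_list_def by auto

lemma list_code_decode_list [simp]: "list_code (decode_list c) = c"
  using list_code_surj[of c] by auto

definition computable_list :: "(nat \<Rightarrow> nat list) \<Rightarrow> bool" where "computable_list F \<longleftrightarrow> computable (\<lambda>x. list_code (F x))"

lemma computable_list_code [computable_intros]: "computable_list F \<Longrightarrow> computable (\<lambda>x. list_code (F x))"
  by (simp add: computable_list_def)

lemma computable_list_basic [computable_intros]:
  "computable f \<Longrightarrow> computable_list (\<lambda>x. decode_list (f x))" "computable_list (\<lambda>x. c)"
  "computable f \<Longrightarrow> computable_list F \<Longrightarrow> computable_list (\<lambda>x. f x # F x)"
  unfolding computable_list_def list_code.simps list_code_decode_list by (assumption, rule computable_intros, rule computable_intros, rule computable_intros)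

lemma computable_list_comp: "computable_list F \<Longrightarrow> computable f \<Longrightarrow> computable_list (\<lambda>x. F (f x))"
  unfolding computable_list_def by (rule computable_comp)

lemma decidable_list_eq [computable_intros]: "computable_list F \<Longrightarrow> computable_list G \<Longrightarrow> decidable (\<lambda>x. F x = G x)"
  using decidable_eq[of "\<lambda>x. list_code (F x)" "\<lambda>x. list_code (G x)"] unfolding computable_list_def by simp

text \<open>The default 0 makes the entry a plain arithmetic expression in the code for every index,
  as \<open>nth0_tlc\<close> shows.\<close>

definition nth0 :: "nat list \<Rightarrow> nat \<Rightarrow> nat" where "nth0 l i = (if i < length l then l ! i else 0)"

text \<open>Iterated tail on codes: \<open>r - 1\<close> strips the \<open>Suc\<close> of a cons,
  and as \<open>ps 0 = 0\<close> the code of the empty list stays where it is.\<close>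

definition tlc :: "nat \<Rightarrow> nat \<Rightarrow> nat" where "tlc c = rec_nat c (\<lambda>_ r. ps (r - 1))"

lemma computable_tlc [computable_intros]: "computable f \<Longrightarrow> computable g \<Longrightarrow> computable (\<lambda>x. tlc (f x) (g x))"
  unfolding tlc_def by (intro computable_intros)

lemma pf_ps_0: "pf 0 = 0" "ps 0 = 0"
proof -
  have "pr 0 0 = 0" by (simp add: prod_encode_def)
  then show "pf 0 = 0" "ps 0 = 0" by (metis pf_pr, metis \<open>pr 0 0 = 0\<close> ps_pr)
qed

lemma tlc: "tlc (list_code l) i = list_code (drop i l)"
proof (induction i)
  case (Suc i)
  have "ps (list_code (drop i l) - 1) = list_code (drop (Suc i) l)"
    by (cases "i < length l") (simp_all add: Cons_nth_drop_Suc[symmetric] pf_ps_0)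
  then show ?case using Suc by (simp add: tlc_def)
qed (simp add: tlc_def)

lemma nth0_tlc: "nth0 l i = pf (tlc (list_code l) i - 1)"
  unfolding tlc nth0_def by (auto simp: Cons_nth_drop_Suc[symmetric] pf_ps_0)

lemma computable_nth0 [computable_intros]: "computable_list F \<Longrightarrow> computable f \<Longrightarrow> computable (\<lambda>x. nth0 (F x) (f x))"
  unfolding nth0_tlc by (intro computable_intros)

lemma length_le_list_code: "length l \<le> list_code l"
proof (induction l)
  case (Cons x l)
  then show ?case using le_prod_encode_2[of "list_code l" x] by simp
qed simp

text \<open>The length is the number of non-empty suffixes; the code itself bounds the length and so
  serves as the number of steps.\<close>

lemma computable_length [computable_intros]: assumes "computable_list F" shows "computable (\<lambda>x. length (F x))"
proof -
  have "rec_nat 0 (\<lambda>i r. if tlc (list_code l) i = 0 then r else Suc r) n = min n (length l)" for l n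
    by (induction n) (auto simp: tlc list_code_0 min_def)
  from this[of _ "list_code _"]
  have "length l = rec_nat 0 (\<lambda>i r. if tlc (list_code l) i = 0 then r else Suc r) (list_code l)" for l
    using length_le_list_code[of l] by (simp add: min_def)
  moreover have "computable (\<lambda>x. rec_nat 0 (\<lambda>i r. if tlc (list_code (F x)) i = 0 then r else Suc r) (list_code (F x)))"
    by (intro computable_intros assms computable_list_comp[OF assms])
  ultimately show ?thesis by simp
qed

lemma computable_foldl [computable_intros]:
  assumes "computable f" "computable_list F" "computable (\<lambda>z. h (pf z) (pf (ps z)) (ps (ps z)))"
  shows "computable (\<lambda>x. foldl (h x) (f x) (F x))"
proof -
  have "n \<le> length l \<Longrightarrow> foldl g a (take n l) = rec_nat a (\<lambda>i r. g r (nth0 l i)) n"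
    for g :: "nat \<Rightarrow> nat \<Rightarrow> nat" and a l n
    by (induction n) (auto simp: take_Suc_conv_app_nth nth0_def)
  from this[of "length _"] have "foldl g a l = rec_nat a (\<lambda>i r. g r (nth0 l i)) (length l)"
    for g :: "nat \<Rightarrow> nat \<Rightarrow> nat" and a l by (metis order_refl take_all)
  moreover have "computable (\<lambda>z. h (pf z) (ps (ps z)) (nth0 (F (pf z)) (pf (ps z))))"
    by (rule computable_comp[OF assms(3), of "\<lambda>z. pr (pf z) (pr (ps (ps z)) (nth0 (F (pf z)) (pf (ps z))))", simplified])
      (intro computable_intros computable_list_comp[OF assms(2)])
  then have "computable (\<lambda>x. rec_nat (f x) (\<lambda>i r. h x r (nth0 (F x) i)) (length (F x)))"
    by (intro computable_intros assms)
  ultimately show ?thesis by simp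
qed

text \<open>A left fold that conses reverses its list, so \<open>rev\<close>, append and
  \<open>map\<close> all come out of a single computable fold.\<close>

lemma list_code_foldl: "list_code (rev (map g l) @ xs) = foldl (\<lambda>a y. Suc (pr (g y) a)) (list_code xs) l"
  by (induction l arbitrary: xs) (auto simp flip: list_code.simps simp del: list_code.simps)

lemma computable_list_rev_map_append:
  assumes "computable_list F" "computable_list G" "computable (\<lambda>z. h (pf z) (ps z))"
  shows "computable_list (\<lambda>x. rev (map (h x) (F x)) @ G x)"
  unfolding computable_list_def list_code_foldl
  by (intro computable_foldl computable_intros assms computable_comp[OF assms(3), of "\<lambda>z. pr (pf z) (ps (ps z))", simplified])

lemma computable_list_rev [computable_intros]: "computable_list F \<Longrightarrow> computable_list (\<lambda>x. rev (F x))"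
  by (rule computable_list_rev_map_append[of F "\<lambda>_. []" "\<lambda>x y. y", simplified]) (assumption | intro computable_intros)+

lemma computable_list_append [computable_intros]: "computable_list F \<Longrightarrow> computable_list G \<Longrightarrow> computable_list (\<lambda>x. F x @ G x)"
  by (rule computable_list_rev_map_append[of "\<lambda>x. rev (F x)" G "\<lambda>x y. y", simplified]) (assumption | intro computable_intros)+

lemma computable_list_map [computable_intros]:
  "computable_list F \<Longrightarrow> computable (\<lambda>z. h (pf z) (ps z)) \<Longrightarrow> computable_list (\<lambda>x. map (h x) (F x))"
  using computable_list_rev[OF computable_list_rev_map_append[of F "\<lambda>_. []" h]] by (simp add: computable_list_basic(2))

lemma decidable_ball_set [computable_intros]:
  assumes "computable_list F" "decidable (\<lambda>z. P (pf z) (ps z))" shows "decidable (\<lambda>x. \<forall>y\<in>set (F x). P x y)"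
proof -
  have "(\<forall>y\<in>set (F x). P x y) \<longleftrightarrow> (\<forall>i<length (F x). P x (nth0 (F x) i))" for x
    by (auto simp: all_set_conv_all_nth nth0_def)
  moreover have "decidable (\<lambda>z. P (pf z) (nth0 (F (pf z)) (ps z)))"
    by (rule decidable_comp[OF assms(2), of "\<lambda>z. pr (pf z) (nth0 (F (pf z)) (ps z))", simplified])
      (intro computable_intros computable_list_comp[OF assms(1)])
  then have "decidable (\<lambda>x. \<forall>i<length (F x). P x (nth0 (F x) i))" by (intro computable_intros assms)
  ultimately show ?thesis by simp
qed

lemma semidecidable_lists [semidecidable_intros]:
  "computable_list F \<Longrightarrow> computable_list G \<Longrightarrow> semidecidable (\<lambda>x. F x = G x)"
  "computable_list F \<Longrightarrow> decidable (\<lambda>z. P (pf z) (ps z)) \<Longrightarrow> semidecidable (\<lambda>x. \<forall>y\<in>set (F x). P x y)"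
  by (intro semidecidable_dp computable_intros; assumption)+

lemma semidecidable_ex_list [semidecidable_intros]:
  assumes "semidecidable (\<lambda>z. P (pf z) (decode_list (ps z)))" shows "semidecidable (\<lambda>x. \<exists>l. P x l)"
proof -
  have "(\<exists>l. P x l) \<longleftrightarrow> (\<exists>c. P x (decode_list c))" for x by (metis decode_list_list_code)
  then show ?thesis using semidecidable_ex[OF assms] by simp
qed

text \<open>A generic proof system on numbers: \<open>step x L\<close> lets x be inferred from
  premises in L. \<open>eval\<close>, \<open>peq\<close> and \<open>comm_word\<close> are all coded
  in this way, so that one theorem makes them semidecidable.\<close>

inductive derivable :: "(nat \<Rightarrow> nat list \<Rightarrow> bool) \<Rightarrow> nat \<Rightarrow> bool" for step where
  derivable: "step x L \<Longrightarrow> \<forall>y\<in>set L. derivable step y \<Longrightarrow> derivable step x"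

text \<open>Proof trees flattened to lists. Conclusions stand in front of their premises, so
  appending two derivations gives a derivation.\<close>

inductive derivation :: "(nat \<Rightarrow> nat list \<Rightarrow> bool) \<Rightarrow> nat list \<Rightarrow> bool" for step where
  Nil: "derivation step []"
| Cons: "step x L \<Longrightarrow> set L \<subseteq> set D \<Longrightarrow> derivation step D \<Longrightarrow> derivation step (x # D)"

lemma derivation_append: "derivation step D \<Longrightarrow> derivation step E \<Longrightarrow> derivation step (D @ E)"
proof (induction rule: derivation.induct)
  case (Cons x L D)
  then show ?case using derivation.Cons[of step x L "D @ E"] by auto
qed simp

lemma derivable_iff: "derivable step x \<longleftrightarrow> (\<exists>D. derivation step D \<and> x \<in> set D)"
proof
  show "derivable step x \<Longrightarrow> \<exists>D. derivation step D \<and> x \<in> set D"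
  proof (induction rule: derivable.induct)
    case (derivable x L)
    have "\<exists>D. derivation step D \<and> set L' \<subseteq> set D" if "set L' \<subseteq> set L" for L'
      using that
    proof (induction L')
      case Nil
      then show ?case using derivation.Nil by auto
    next
      case (Cons y L')
      then obtain D E where "derivation step D" "set L' \<subseteq> set D" "derivation step E" "y \<in> set E"
        using derivable.IH by auto
      then have "derivation step (D @ E)" "set (y # L') \<subseteq> set (D @ E)" using derivation_append by auto
      then show ?case by blast
    qed
    then obtain D where "derivation step D" "set L \<subseteq> set D" by blast
    then have "derivation step (x # D)" "x \<in> set (x # D)" using derivable.hyps derivation.Cons[of step x L D] by auto
    then show ?case by blast
  qed
next
  have "derivation step D \<Longrightarrow> \<forall>x\<in>set D. derivable step x" for D
  proof (induction rule: derivation.induct)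
    case (Cons x L D)
    then have "derivable step x" by (intro derivable.derivable[of step x L]) auto
    then show ?case using Cons by simp
  qed simp
  then show "\<exists>D. derivation step D \<and> x \<in> set D \<Longrightarrow> derivable step x" by blast
qed

lemma in_set_nth0: "x \<in> set D \<longleftrightarrow> (\<exists>i<length D. nth0 D i = x)"
proof -
  have "(\<exists>i<length D. nth0 D i = x) \<longleftrightarrow> (\<exists>i<length D. D ! i = x)" by (auto simp: nth0_def)
  then show ?thesis by (simp add: in_set_conv_nth)
qed

text \<open>In terms of positions, every quantifier except the search for L is bounded or runs over
  a list, which fits the closure rules.\<close>

lemma derivation_iff:
  "derivation step D \<longleftrightarrow> (\<forall>i<length D. \<exists>L. step (nth0 D i) L \<and> (\<forall>y\<in>set L. \<exists>j<length D. i < j \<and> nth0 D j = y))"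
proof (induction D)
  case Nil
  then show ?case by (auto intro: derivation.Nil)
next
  case (Cons x D)
  have "derivation step (x # D) \<longleftrightarrow> (\<exists>L. step x L \<and> set L \<subseteq> set D) \<and> derivation step D"
    by (subst derivation.simps) blast
  moreover have "set L \<subseteq> set D \<longleftrightarrow> (\<forall>y\<in>set L. \<exists>j<length D. nth0 D j = y)" for L
    unfolding in_set_nth0[symmetric] by blast
  moreover have "nth0 (x # D) 0 = x" "\<And>i. nth0 (x # D) (Suc i) = nth0 D i" by (auto simp: nth0_def)
  ultimately show ?case unfolding Cons by (simp add: All_less_Suc2 Ex_less_Suc2)
qed

lemma semidecidable_derivable:
  assumes "semidecidable (\<lambda>z. step (pf z) (decode_list (ps z)))" shows "semidecidable (derivable step)"
proof -
  have "semidecidable (\<lambda>z. step (nth0 (decode_list (ps (pf (pf z)))) (ps (pf z))) (decode_list (ps z)))"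
    by (rule semidecidable_comp[OF assms, of "\<lambda>z. pr (nth0 (decode_list (ps (pf (pf z)))) (ps (pf z))) (ps z)", simplified])
      (intro computable_intros)
  then have "semidecidable (\<lambda>x. \<exists>D. derivation step D \<and> x \<in> set D)"
    unfolding derivation_iff in_set_nth0[of x for x] by (intro semidecidable_intros computable_intros)
  then show ?thesis by (simp flip: derivable_iff)
qed

declare list_code.simps [simp del]

lemma decidable_in_set [computable_intros]: "computable f \<Longrightarrow> computable_list F \<Longrightarrow> decidable (\<lambda>x. f x \<in> set (F x))"
  unfolding in_set_nth0 by (intro computable_intros computable_list_comp[of F pf] computable_comp[of f pf])

lemma semidecidable_in_set [semidecidable_intros]: "computable f \<Longrightarrow> computable_list F \<Longrightarrow> semidecidable (\<lambda>x. f x \<in> set (F x))"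
  by (intro semidecidable_dp computable_intros)

section \<open>A universal semidecidable predicate\<close>

fun recf_code :: "recf \<Rightarrow> nat" where
  "recf_code Zero = pr 0 0"
| "recf_code Succ = pr 1 0"
| "recf_code (Proj i) = pr 2 i"
| "recf_code (Cn f gs) = pr 3 (pr (recf_code f) (list_code (map recf_code gs)))"
| "recf_code (Pr f g) = pr 4 (pr (recf_code f) (recf_code g))"
| "recf_code (Mn f) = pr 5 (recf_code f)"

lemma recf_code_eq_iff [simp]: "recf_code f = recf_code g \<longleftrightarrow> f = g"
proof (induction f arbitrary: g)
  case (Cn f gs)
  have "map recf_code gs = map recf_code hs \<Longrightarrow> gs = hs" for hs
    using list.inj_map_strong[of gs hs recf_code recf_code] Cn by auto
  then show ?case using Cn by (cases g) auto
qed (case_tac g; auto)+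

abbreviation judgement :: "nat \<Rightarrow> nat list \<Rightarrow> nat \<Rightarrow> nat" where
  "judgement c xs y \<equiv> pr c (pr (list_code xs) y)"

text \<open>One disjunct per rule of \<open>eval\<close>, restricted to notions with closure rules:
  \<open>Proj\<close> splits the argument list instead of indexing it, and \<open>list_all2\<close>
  becomes a bounded quantifier over \<open>nth0\<close>.\<close>

definition eval_step :: "nat \<Rightarrow> nat list \<Rightarrow> bool" where
  "eval_step z L \<longleftrightarrow> (\<exists>c xs y. z = judgement c xs y \<and>
     (c = pr 0 0 \<and> y = 0
    \<or> c = pr 1 0 \<and> (\<exists>x l. xs = x # l \<and> y = Suc x)
    \<or> (\<exists>l l'. c = pr 2 (length l) \<and> xs = l @ y # l')
    \<or> (\<exists>f gs ys. c = pr 3 (pr f (list_code gs)) \<and> length gs = length ys \<and> judgement f ys y \<in> set L \<and>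
         (\<forall>i<length ys. judgement (nth0 gs i) xs (nth0 ys i) \<in> set L))
    \<or> (\<exists>f g l. c = pr 4 (pr f g) \<and> xs = 0 # l \<and> judgement f l y \<in> set L)
    \<or> (\<exists>f g n l w. c = pr 4 (pr f g) \<and> xs = Suc n # l \<and> judgement c (n # l) w \<in> set L \<and>
         judgement g (n # w # l) y \<in> set L)
    \<or> (\<exists>f. c = pr 5 f \<and> judgement f (y # xs) 0 \<in> set L \<and>
         (\<forall>m<y. \<exists>w. 0 < w \<and> judgement f (m # xs) w \<in> set L))))"

lemma eval_step_judgement: "eval_step (judgement c xs y) L \<longleftrightarrow>
     (c = pr 0 0 \<and> y = 0
    \<or> c = pr 1 0 \<and> (\<exists>x l. xs = x # l \<and> y = Suc x)
    \<or> (\<exists>l l'. c = pr 2 (length l) \<and> xs = l @ y # l')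
    \<or> (\<exists>f gs ys. c = pr 3 (pr f (list_code gs)) \<and> length gs = length ys \<and> judgement f ys y \<in> set L \<and>
         (\<forall>i<length ys. judgement (nth0 gs i) xs (nth0 ys i) \<in> set L))
    \<or> (\<exists>f g l. c = pr 4 (pr f g) \<and> xs = 0 # l \<and> judgement f l y \<in> set L)
    \<or> (\<exists>f g n l w. c = pr 4 (pr f g) \<and> xs = Suc n # l \<and> judgement c (n # l) w \<in> set L \<and>
         judgement g (n # w # l) y \<in> set L)
    \<or> (\<exists>f. c = pr 5 f \<and> judgement f (y # xs) 0 \<in> set L \<and>
         (\<forall>m<y. \<exists>w. 0 < w \<and> judgement f (m # xs) w \<in> set L)))"
  unfolding eval_step_def by simp

lemma semidecidable_derivable_eval_step: "semidecidable (derivable eval_step)"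
  by (rule semidecidable_derivable) (unfold eval_step_def, intro semidecidable_intros computable_intros)

lemma eval_imp_derivable: "eval f xs y \<Longrightarrow> derivable eval_step (judgement (recf_code f) xs y)"
proof (induction rule: eval.induct)
  case (zero xs)
  show ?case by (rule derivable.derivable[of _ _ "[]"]) (auto simp: eval_step_judgement)
next
  case (succ x xs)
  show ?case by (rule derivable.derivable[of _ _ "[]"]) (auto simp: eval_step_judgement)
next
  case (proj i xs)
  then have "xs = take i xs @ xs ! i # drop (Suc i) xs" "length (take i xs) = i"
    by (simp_all add: id_take_nth_drop)
  then have "eval_step (judgement (recf_code (Proj i)) xs (xs ! i)) []"
    unfolding eval_step_judgement recf_code.simps by metis
  then show ?case by (rule derivable.derivable) simp
next
  case (comp xs gs ys f z)
  then have len: "length gs = length ys" and IH: "\<And>i. i < length ys \<Longrightarrow> derivable eval_step (judgement (recf_code (gs ! i)) xs (ys ! i))"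
    by (auto simp: list_all2_conv_all_nth)
  let ?L = "judgement (recf_code f) ys z # map (\<lambda>i. judgement (recf_code (gs ! i)) xs (ys ! i)) [0..<length ys]"
  have "eval_step (judgement (recf_code (Cn f gs)) xs z) ?L"
  proof -
    have "\<exists>fc gs' ys'. recf_code (Cn f gs) = pr 3 (pr fc (list_code gs')) \<and> length gs' = length ys' \<and> judgement fc ys' z \<in> set ?L \<and>
        (\<forall>i<length ys'. judgement (nth0 gs' i) xs (nth0 ys' i) \<in> set ?L)"
      by (intro exI[of _ "recf_code f"] exI[of _ "map recf_code gs"] exI[of _ ys]) (use len in \<open>auto simp: nth0_def\<close>)
    then show ?thesis unfolding eval_step_judgement by blast
  qed
  then show ?case by (rule derivable.derivable) (use comp.IH IH in auto)
next
  case (pr0 f xs y g)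
  then show ?case by (intro derivable.derivable[of _ _ "[judgement (recf_code f) xs y]"]) (auto simp: eval_step_judgement)
next
  case (prS f g n xs y z)
  have "eval_step (judgement (recf_code (Pr f g)) (Suc n # xs) z) [judgement (recf_code (Pr f g)) (n # xs) y, judgement (recf_code g) (n # y # xs) z]"
    unfolding eval_step_judgement recf_code.simps by auto
  then show ?case by (rule derivable.derivable) (use prS in auto)
next
  case (mn f n xs)
  then obtain w where w: "\<And>m. m < n \<Longrightarrow> 0 < w m" "\<And>m. m < n \<Longrightarrow> derivable eval_step (judgement (recf_code f) (m # xs) (w m))"
    by metis
  have "eval_step (judgement (recf_code (Mn f)) xs n) (judgement (recf_code f) (n # xs) 0 # map (\<lambda>m. judgement (recf_code f) (m # xs) (w m)) [0..<n])"
    unfolding eval_step_judgement recf_code.simps using w(1) by (auto simp: image_iff)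
  then show ?case by (rule derivable.derivable) (use mn w in auto)
qed

lemma derivable_imp_eval: "derivable eval_step z \<Longrightarrow> z = judgement (recf_code f) xs y \<Longrightarrow> eval f xs y"
proof (induction arbitrary: f xs y rule: derivable.induct)
  case (derivable z L)
  have IH: "judgement (recf_code f) xs y \<in> set L \<Longrightarrow> eval f xs y" for f xs y using derivable.IH by blast
  have e: "eval_step (judgement (recf_code f) xs y) L" using derivable by simp
  show ?case
  proof (cases f)
    case Zero
    then show ?thesis using e by (auto simp: eval_step_judgement intro: eval.zero)
  next
    case Succ
    then show ?thesis using e by (auto simp: eval_step_judgement intro: eval.succ)
  next
    case (Proj i)
    then obtain l l' where "i = length l" "xs = l @ y # l'" using e by (auto simp: eval_step_judgement)
    then show ?thesis using eval.proj[of i xs] Proj by simp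
  next
    case (Cn f' gs)
    then obtain ys where ys: "length gs = length ys" "judgement (recf_code f') ys y \<in> set L"
      "\<And>i. i < length ys \<Longrightarrow> judgement (nth0 (map recf_code gs) i) xs (nth0 ys i) \<in> set L"
      using e by (auto simp: eval_step_judgement)
    then have "\<And>i. i < length ys \<Longrightarrow> judgement (recf_code (gs ! i)) xs (ys ! i) \<in> set L" by (simp add: nth0_def)
    then show ?thesis unfolding Cn using ys IH
      by (intro eval.comp[where ys=ys]) (auto simp: list_all2_conv_all_nth)
  next
    case (Pr f' g)
    then consider l where "xs = 0 # l" "judgement (recf_code f') l y \<in> set L"
      | n l w where "xs = Suc n # l" "judgement (recf_code f) (n # l) w \<in> set L" "judgement (recf_code g) (n # w # l) y \<in> set L"
      using e by (auto simp: eval_step_judgement)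
    then show ?thesis
    proof cases
      case 1
      then show ?thesis using IH unfolding Pr by (auto intro: eval.pr0)
    next
      case 2
      then have "eval f (n # l) w" "eval g (n # w # l) y" using IH by blast+
      then show ?thesis using eval.prS[of f' g n l w y] Pr 2(1) by simp
    qed
  next
    case (Mn f')
    then have "judgement (recf_code f') (y # xs) 0 \<in> set L" "\<forall>m<y. \<exists>w. 0 < w \<and> judgement (recf_code f') (m # xs) w \<in> set L"
      using e by (auto simp: eval_step_judgement)
    then show ?thesis using IH unfolding Mn by (metis eval.mn)
  qed
qed

lemma eval_iff_derivable: "eval f xs y \<longleftrightarrow> derivable eval_step (judgement (recf_code f) xs y)"
  using eval_imp_derivable derivable_imp_eval by blast

text \<open>From left to right an interpreter is needed: halting of a fixed \<open>recf\<close>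
  turns into the search for a derivation of one of its evaluations.\<close>

lemma re_set_iff: "re_set A \<longleftrightarrow> semidecidable (\<lambda>x. x \<in> A)"
proof
  assume "re_set A"
  then obtain f where f: "\<And>x. x \<in> A \<longleftrightarrow> (\<exists>y. derivable eval_step (judgement (recf_code f) [x] y))"
    unfolding re_set_def eval_iff_derivable by blast
  show "semidecidable (\<lambda>x. x \<in> A)" unfolding f
    by (intro semidecidable_intros semidecidable_comp[OF semidecidable_derivable_eval_step] computable_intros)
next
  show "semidecidable (\<lambda>x. x \<in> A) \<Longrightarrow> re_set A" using semidecidable_re_set[of "\<lambda>x. x \<in> A"] by simp
qed

text \<open>The diagonal halting set: a program enumerating its complement contradicts itself on its
  own code.\<close>

lemma undecidable: obtains K where "semidecidable K" "\<not> semidecidable (\<lambda>x. \<not> K x)"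
proof
  let ?K = "\<lambda>x. \<exists>y. derivable eval_step (judgement x [x] y)"
  show "semidecidable ?K" by (intro semidecidable_intros semidecidable_comp[OF semidecidable_derivable_eval_step] computable_intros)
  show "\<not> semidecidable (\<lambda>x. \<not> ?K x)"
  proof
    assume "semidecidable (\<lambda>x. \<not> ?K x)"
    then have "re_set {x. \<not> ?K x}" by (rule semidecidable_re_set)
    then obtain f where "\<And>x. x \<in> {x. \<not> ?K x} \<longleftrightarrow> (\<exists>y. eval f [x] y)" unfolding re_set_def by blast
    from this[of "recf_code f"] show False unfolding eval_iff_derivable by blast
  qed
qed

lemma dec_set_re_set: assumes "dec_set A" shows "re_set A"
proof -
  have "computable (\<lambda>x. of_bool (x \<in> A))" using assms unfolding dec_set_def computable_def of_bool_def by blast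
  then show ?thesis unfolding re_set_iff by (intro semidecidable_dp) (simp add: decidable_def)
qed

section \<open>Right-computable reals\<close>

text \<open>Stands in for the codes of rationals: fractions need not be reduced, and naturals
  suffice because a rational above some \<alpha> \<ge> 0 is positive.\<close>

definition ratio_above :: "real \<Rightarrow> nat \<Rightarrow> nat \<Rightarrow> bool" where
  "ratio_above \<alpha> a b \<longleftrightarrow> 0 < b \<and> \<alpha> < real a / real b"

text \<open>The factor 2 is \<open>int_encode\<close> on non-negative integers.\<close>

lemma rat_code_fract:
  assumes "coprime a b" "0 < b" shows "rat_code (of_nat a / of_nat b) = pr (2 * a) b"
proof -
  have "rat_of_nat a / of_nat b = Fract (int a) (int b)" by (simp add: Fract_of_int_quotient)
  moreover have "quotient_of (Fract (int a) (int b)) = (int a, int b)"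
    using assms by (simp add: quotient_of_Fract normalize_stable)
  ultimately show ?thesis by (simp add: rat_code_def int_encode_def sum_encode_def)
qed

lemma pos_rat: assumes "(q :: rat) > 0"
  obtains a b where "coprime a b" "0 < b" "q = of_nat a / of_nat b"
proof -
  obtain i j where ij: "quotient_of q = (i, j)" by (cases "quotient_of q")
  then have "j > 0" "coprime i j" "q = of_int i / of_int j"
    by (simp_all add: quotient_of_denom_pos quotient_of_coprime quotient_of_div)
  moreover then have "i > 0" using assms by (simp add: zero_less_divide_iff)
  ultimately have "coprime (nat i) (nat j)" "0 < nat j" "q = of_nat (nat i) / of_nat (nat j)"
    by (simp_all add: coprime_int_iff[symmetric])
  then show ?thesis using that by blast
qed

text \<open>\<open>rat_code\<close> only sees reduced fractions; arbitrary ones are reached by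
  searching for the common factor.\<close>

lemma ratio_above_iff_coprime:
  "ratio_above \<alpha> a b \<longleftrightarrow> (\<exists>c a' b'. a = c * a' \<and> b = c * b' \<and> 0 < b \<and> coprime a' b' \<and> ratio_above \<alpha> a' b')"
proof
  assume A: "ratio_above \<alpha> a b"
  then have b: "0 < b" by (simp add: ratio_above_def)
  let ?g = "gcd a b"
  obtain a' b' where a': "a = ?g * a'" "b = ?g * b'" by (meson dvdE gcd_dvd1 gcd_dvd2)
  have "coprime a' b'" using a' b by (metis gcd_coprime gcd_nat.neutr_eq_iff mult.commute neq0_conv)
  moreover have "ratio_above \<alpha> a' b'" using A b a' unfolding ratio_above_def
    by (smt (verit) mult_divide_mult_cancel_left of_nat_0_eq_iff of_nat_mult mult_eq_0_iff neq0_conv)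
  ultimately show "\<exists>c a' b'. a = c * a' \<and> b = c * b' \<and> 0 < b \<and> coprime a' b' \<and> ratio_above \<alpha> a' b'"
    using a' b by blast
qed (auto simp: ratio_above_def)

text \<open>As an existential statement over naturals, coprimality is semidecidable by the closure
  rules, with no computation of a gcd.\<close>

lemma coprime_bezout:
  assumes "0 < a" "0 < b" shows "coprime a b \<longleftrightarrow> (\<exists>u v :: nat. a * u = b * v + 1)"
proof
  assume "coprime a b"
  then show "\<exists>u v. a * u = b * v + 1"
    using bezout_nat[of a b] assms by (auto simp: mult.commute)
next
  assume "\<exists>u v. a * u = b * v + 1"
  then obtain u v where "a * u = b * v + 1" by blast
  then show "coprime a b" by (metis coprimeI dvd_add_right_iff dvd_mult2)
qed

lemma right_computable_iff:
  assumes "\<alpha> \<ge> 0"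
  shows "right_computable \<alpha> \<longleftrightarrow> semidecidable (\<lambda>z. ratio_above \<alpha> (pf z) (ps z))"
proof -
  let ?A = "rat_code ` {q. \<alpha> < of_rat q}"
  have A: "x \<in> ?A \<longleftrightarrow> (\<exists>a b. x = pr (2 * a) b \<and> coprime a b \<and> ratio_above \<alpha> a b)" for x
  proof
    assume "x \<in> ?A"
    then obtain q where q: "\<alpha> < of_rat q" "x = rat_code q" by blast
    have "(0 :: real) < of_rat q" using q(1) assms by linarith
    then have "q > 0" by simp
    then obtain a b where "coprime a b" "0 < b" "q = of_nat a / of_nat b" by (rule pos_rat)
    then show "\<exists>a b. x = pr (2 * a) b \<and> coprime a b \<and> ratio_above \<alpha> a b"
      using q rat_code_fract by (intro exI[of _ a] exI[of _ b]) (auto simp: ratio_above_def of_rat_divide)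
  next
    assume "\<exists>a b. x = pr (2 * a) b \<and> coprime a b \<and> ratio_above \<alpha> a b"
    then obtain a b where "x = pr (2 * a) b" "coprime a b" "ratio_above \<alpha> a b" by blast
    then have "x = rat_code (of_nat a / of_nat b)" "\<alpha> < of_rat (of_nat a / of_nat b)"
      by (simp_all add: ratio_above_def rat_code_fract of_rat_divide)
    then show "x \<in> ?A" by blast
  qed
  have 1: "pr (2 * a) b \<in> ?A \<longleftrightarrow> coprime a b \<and> ratio_above \<alpha> a b" for a b unfolding A by simp
  \<comment> \<open>\<open>P\<close> expresses pairs by codes and \<open>A'\<close> codes by pairs,
    each by a search; they serve the two directions.\<close>
  have P: "ratio_above \<alpha> a b \<longleftrightarrow> (\<exists>c a' b'. a = c * a' \<and> b = c * b' \<and> 0 < b \<and> pr (2 * a') b' \<in> ?A)" for a b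
    unfolding 1 by (rule ratio_above_iff_coprime)
  have pos: "ratio_above \<alpha> a b \<Longrightarrow> 0 < a \<and> 0 < b" for a b
    using assms by (cases "a = 0") (auto simp: ratio_above_def)
  have A': "x \<in> ?A \<longleftrightarrow> (\<exists>a b u v. x = pr (2 * a) b \<and> a * u = b * v + 1 \<and> ratio_above \<alpha> a b)" for x
    unfolding A using pos coprime_bezout by metis
  show ?thesis unfolding right_computable_def re_set_iff
  proof
    assume *: "semidecidable (\<lambda>x. x \<in> ?A)"
    have A_code: "semidecidable (\<lambda>x. pr (f x) (g x) \<in> ?A)" if "computable f" "computable g" for f g
      using semidecidable_comp[OF *, of "\<lambda>x. pr (f x) (g x)"] computable_basic(9)[OF that] by simp
    show "semidecidable (\<lambda>z. ratio_above \<alpha> (pf z) (ps z))" unfolding P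
      by (intro A_code semidecidable_intros computable_intros)
  next
    assume *: "semidecidable (\<lambda>z. ratio_above \<alpha> (pf z) (ps z))"
    have ratio_above_code: "semidecidable (\<lambda>x. ratio_above \<alpha> (f x) (g x))" if "computable f" "computable g" for f g
      using semidecidable_comp[OF *, of "\<lambda>x. pr (f x) (g x)"] computable_basic(9)[OF that] by simp
    show "semidecidable (\<lambda>x. x \<in> ?A)" unfolding A' by (intro ratio_above_code semidecidable_intros computable_intros)
  qed
qed

lemma ratio_above_dense:
  assumes "0 \<le> x" "x < y" obtains a b where "ratio_above x a b" "real a / real b < y"
proof -
  obtain q where q: "x < of_rat q" "of_rat q < y" using of_rat_dense[OF assms(2)] by blast
  then have "(0 :: real) < of_rat q" using assms by linarith
  then have "q > 0" by simp
  then obtain a b where "0 < b" "q = of_nat a / of_nat b" by (rule pos_rat)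
  then show ?thesis using q that by (auto simp: ratio_above_def of_rat_divide)
qed

lemma right_computableI:
  assumes "\<alpha> \<ge> 0" "\<And>a b. ratio_above \<alpha> a b \<longleftrightarrow> P a b" "semidecidable (\<lambda>z. P (pf z) (ps z))"
  shows "right_computable \<alpha>"
  using assms by (simp add: right_computable_iff)

lemma semidecidable_ratio_above:
  assumes "\<alpha> \<ge> 0" "right_computable \<alpha>" "computable f" "computable g"
  shows "semidecidable (\<lambda>x. ratio_above \<alpha> (f x) (g x))"
  using semidecidable_comp[of "\<lambda>z. ratio_above \<alpha> (pf z) (ps z)" "\<lambda>x. pr (f x) (g x)"] assms computable_basic(9)[of f g]
  by (simp add: right_computable_iff)

text \<open>Density leaves room for a rational above each summand. Strictness sits in the summands,
  so a weak inequality between naturals is enough after clearing denominators.\<close>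

lemma ratio_above_add_iff:
  assumes "\<alpha> \<ge> 0" "\<beta> \<ge> 0"
  shows "ratio_above (\<alpha> + \<beta>) a b \<longleftrightarrow>
    0 < b \<and> (\<exists>c d e f. ratio_above \<alpha> c d \<and> ratio_above \<beta> e f \<and> (c * f + e * d) * b \<le> a * (d * f))"
proof
  assume A: "ratio_above (\<alpha> + \<beta>) a b"
  then have b: "0 < b" and lt: "\<alpha> < real a / real b - \<beta>" by (auto simp: ratio_above_def)
  obtain c d where cd: "ratio_above \<alpha> c d" "real c / real d < real a / real b - \<beta>"
    using ratio_above_dense[OF assms(1) lt] .
  then have "\<beta> < real a / real b - real c / real d" by simp
  then obtain e f where ef: "ratio_above \<beta> e f" "real e / real f < real a / real b - real c / real d"
    using ratio_above_dense[OF assms(2)] by blast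
  then have pos: "0 < real d" "0 < real f" "0 < real b" using cd b by (auto simp: ratio_above_def)
  have "real c / real d + real e / real f < real a / real b" using ef by simp
  then have "(real c * real f + real e * real d) * real b < real a * (real d * real f)"
    using pos by (simp add: field_simps)
  then have "real ((c * f + e * d) * b) < real (a * (d * f))" by simp
  then have "(c * f + e * d) * b \<le> a * (d * f)" by (simp only: of_nat_less_iff)
  then show "0 < b \<and> (\<exists>c d e f. ratio_above \<alpha> c d \<and> ratio_above \<beta> e f \<and> (c * f + e * d) * b \<le> a * (d * f))"
    using b cd ef by blast
next
  assume "0 < b \<and> (\<exists>c d e f. ratio_above \<alpha> c d \<and> ratio_above \<beta> e f \<and> (c * f + e * d) * b \<le> a * (d * f))"
  then obtain c d e f where b: "0 < b" and cd: "ratio_above \<alpha> c d" and ef: "ratio_above \<beta> e f"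
    and le: "(c * f + e * d) * b \<le> a * (d * f)" by blast
  then have pos: "0 < real d" "0 < real f" "0 < real b" by (auto simp: ratio_above_def)
  have "real ((c * f + e * d) * b) \<le> real (a * (d * f))" using le by (simp only: of_nat_le_iff)
  then have "real c / real d + real e / real f \<le> real a / real b"
    using pos by (simp add: field_simps)
  then show "ratio_above (\<alpha> + \<beta>) a b" using cd ef b unfolding ratio_above_def by linarith
qed

lemma right_computable_add:
  assumes "\<alpha> \<ge> 0" "\<beta> \<ge> 0" "right_computable \<alpha>" "right_computable \<beta>"
  shows "right_computable (\<alpha> + \<beta>)"
  by (rule right_computableI, use assms in simp, rule ratio_above_add_iff[OF assms(1,2)])
    (intro semidecidable_intros computable_intros semidecidable_ratio_above[OF assms(1,3)] semidecidable_ratio_above[OF assms(2,4)])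

lemma computable_imp_right_computable: "computable_real \<alpha> \<Longrightarrow> right_computable \<alpha>"
  unfolding computable_real_def right_computable_def by (rule dec_set_re_set)

section \<open>Algebraic numbers\<close>

lemma computable_power [computable_intros]: "computable f \<Longrightarrow> computable g \<Longrightarrow> computable (\<lambda>x. f x ^ g x)"
proof -
  have eq: "a ^ n = rec_nat 1 (\<lambda>_ r. r * a) n" for a n :: nat by (induction n) auto
  assume "computable f" "computable g"
  then have "computable (\<lambda>x. rec_nat 1 (\<lambda>_ r. r * f x) (g x))" by (intro computable_intros computable_comp[of f pf])
  then show ?thesis by (simp only: eq)
qed

text \<open>With n fixed, every summand may have a program of its own. Thus the coefficients of a
  given polynomial enter as constants, without uniformity in i.\<close>

lemma computable_sum_fixed: "(\<And>i. computable (f i)) \<Longrightarrow> computable (\<lambda>x. \<Sum>i<(n::nat). f i x)"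
  by (induction n) (simp_all add: computable_intros)

lemma computable_sum [computable_intros]:
  assumes "computable f" "computable (\<lambda>z. g (pf z) (ps z))" shows "computable (\<lambda>x. \<Sum>i<f x. g x i)"
proof -
  have eq: "(\<Sum>i<n. h i) = rec_nat 0 (\<lambda>i r. r + h i) n" for h :: "nat \<Rightarrow> nat" and n
    by (induction n) auto
  have "computable (\<lambda>z. g (pf z) (pf (ps z)))"
    by (rule computable_comp[OF assms(2), of "\<lambda>z. pr (pf z) (pf (ps z))", simplified]) (intro computable_intros)
  then have "computable (\<lambda>x. rec_nat 0 (\<lambda>i r. r + g x i) (f x))" by (intro computable_intros assms(1))
  then show ?thesis by (simp only: eq)
qed

text \<open>Among integer polynomials vanishing at x one of least degree has a derivative of smaller
  degree, which cannot vanish there; passing to \<open>- p\<close> fixes the sign.\<close>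

lemma algebraic_simple_root:
  assumes "algebraic (x :: real)"
  shows "\<exists>p. (\<forall>i. coeff p i \<in> \<int>) \<and> poly p x = 0 \<and> poly (pderiv p) x > 0"
proof -
  define A where "A p \<longleftrightarrow> (\<forall>i. coeff p i \<in> \<int>) \<and> p \<noteq> 0 \<and> poly p x = 0" for p
  obtain p0 where "A p0" using assms unfolding algebraic_def A_def by blast
  then obtain p where p: "A p" and min: "\<And>q. A q \<Longrightarrow> degree p \<le> degree q"
    using ex_has_least_nat[of A p0 degree] by blast
  have deg: "degree p > 0"
  proof (rule ccontr)
    assume "\<not> degree p > 0"
    then obtain c where "p = [:c:]" using degree_eq_zeroE by blast
    then show False using p by (simp add: A_def)
  qed
  have nz: "poly (pderiv p) x \<noteq> 0"
  proof
    assume "poly (pderiv p) x = 0"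
    then have "A (pderiv p)" using p deg by (auto simp: A_def coeff_pderiv pderiv_eq_0_iff)
    then show False using min[of "pderiv p"] deg by (simp add: degree_pderiv)
  qed
  show ?thesis
  proof (cases "poly (pderiv p) x > 0")
    case True
    then show ?thesis using p by (auto simp: A_def)
  next
    case False
    then show ?thesis using p nz by (intro exI[of _ "- p"]) (simp add: A_def pderiv_minus)
  qed
qed

lemma algebraic_imp_right_computable:
  assumes "\<alpha> \<ge> 0" "algebraic \<alpha>" shows "right_computable \<alpha>"
proof -
  obtain p where p: "\<forall>i. coeff p i \<in> \<int>" "poly p \<alpha> = 0" "poly (pderiv p) \<alpha> > 0"
    using algebraic_simple_root[OF assms(2)] by blast
  obtain d1 where d1: "d1 > 0" "\<And>h. 0 < h \<Longrightarrow> h < d1 \<Longrightarrow> 0 < poly p (\<alpha> + h)"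
    using DERIV_pos_inc_right[OF poly_DERIV[of p \<alpha>] p(3)] p(2) by auto
  obtain d2 where d2: "d2 > 0" "\<And>h. 0 < h \<Longrightarrow> h < d2 \<Longrightarrow> poly p (\<alpha> - h) < 0"
    using DERIV_pos_inc_left[OF poly_DERIV[of p \<alpha>] p(3)] p(2) by auto
  \<comment> \<open>Rational end points of an interval around \<alpha> on which the sign of p tells
    the side. The left one may equal \<alpha>, which covers \<alpha> = 0.\<close>
  obtain c d where cd: "ratio_above \<alpha> c d" "real c / real d < \<alpha> + d1"
    using ratio_above_dense[OF assms(1), of "\<alpha> + d1"] d1(1) by auto
  obtain e f where ef: "0 < f" "real e / real f \<le> \<alpha>" "\<alpha> - d2 < real e / real f"
  proof (cases "\<alpha> = 0")
    case True
    then show ?thesis using that[of 1 0] d2(1) by simp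
  next
    case False
    then have "max 0 (\<alpha> - d2) < \<alpha>" using assms d2(1) by simp
    then obtain a b where "ratio_above (max 0 (\<alpha> - d2)) a b" "real a / real b < \<alpha>"
      by (rule ratio_above_dense[OF max.cobounded1])
    then show ?thesis using that[of b a] by (auto simp: ratio_above_def)
  qed
  have "\<exists>k. coeff p i = of_int k" for i using p(1) Ints_cases by blast
  then obtain z where z: "\<And>i. coeff p i = of_int (z i)" by metis
  define n where "n = Suc (degree p)"
  \<comment> \<open>Times b^n, the value p(a/b) is a difference of two natural numbers: P collects
    the positive coefficients, N the negative ones.\<close>
  define P where "P a b = (\<Sum>i<n. nat (z i) * a ^ i * b ^ (n - i))" for a b
  define N where "N a b = (\<Sum>i<n. nat (- z i) * a ^ i * b ^ (n - i))" for a b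
  have PN: "N a b < P a b \<longleftrightarrow> 0 < poly p (real a / real b)" if "0 < b" for a b
  proof -
    have nz: "of_int k = real (nat k) - real (nat (- k))" for k by (cases "k \<ge> 0") auto
    have "real (P a b) - real (N a b) = (\<Sum>i<n. of_int (z i) * real a ^ i * real b ^ (n - i))"
      unfolding P_def N_def of_nat_sum sum_subtractf[symmetric]
      by (rule sum.cong) (simp_all add: nz left_diff_distrib)
    also have "\<dots> = (\<Sum>i<n. real b ^ n * (coeff p i * (real a / real b) ^ i))"
    proof (rule sum.cong)
      fix i assume "i \<in> {..<n}"
      then have "real b ^ n = real b ^ (n - i) * real b ^ i" by (simp flip: power_add)
      then show "of_int (z i) * real a ^ i * real b ^ (n - i) = real b ^ n * (coeff p i * (real a / real b) ^ i)"
        using that by (simp add: z power_divide)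
    qed (rule HOL.refl)
    also have "\<dots> = real b ^ n * poly p (real a / real b)"
      by (simp add: poly_altdef n_def sum_distrib_left lessThan_Suc_atMost)
    finally have "real (P a b) - real (N a b) = real b ^ n * poly p (real a / real b)" .
    moreover have "real b ^ n > 0" using that by simp
    ultimately have "0 < real (P a b) - real (N a b) \<longleftrightarrow> 0 < poly p (real a / real b)"
      by (simp only: zero_less_mult_iff) auto
    then show ?thesis by simp
  qed
  have frac: "a * d \<le> c * b \<longleftrightarrow> real a / real b \<le> real c / real d" if "0 < b" "0 < d" for a b c d
  proof -
    have "real a / real b \<le> real c / real d \<longleftrightarrow> real (a * d) \<le> real (c * b)"
      using that by (simp add: field_simps)
    then show ?thesis by (simp only: of_nat_le_iff)
  qed
  \<comment> \<open>Beyond c/d a fraction is certainly above \<alpha>, below e/f never, and in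
    between the sign of p decides.\<close>
  have "ratio_above \<alpha> a b \<longleftrightarrow> 0 < b \<and> (c * b \<le> a * d \<or> e * b \<le> a * f \<and> a * d \<le> c * b \<and> N a b < P a b)" for a b
  proof (cases "0 < b")
    case b: True
    have d: "0 < d" using cd by (simp add: ratio_above_def)
    let ?t = "real a / real b"
    have "\<alpha> < ?t \<longleftrightarrow> real c / real d \<le> ?t \<or> real e / real f \<le> ?t \<and> ?t \<le> real c / real d \<and> 0 < poly p ?t"
    proof
      assume "\<alpha> < ?t"
      then show "real c / real d \<le> ?t \<or> real e / real f \<le> ?t \<and> ?t \<le> real c / real d \<and> 0 < poly p ?t"
        using d1(2)[of "?t - \<alpha>"] cd ef by auto
    next
      assume "real c / real d \<le> ?t \<or> real e / real f \<le> ?t \<and> ?t \<le> real c / real d \<and> 0 < poly p ?t"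
      then show "\<alpha> < ?t"
      proof
        assume "real c / real d \<le> ?t"
        then show ?thesis using cd by (auto simp: ratio_above_def)
      next
        assume *: "real e / real f \<le> ?t \<and> ?t \<le> real c / real d \<and> 0 < poly p ?t"
        show ?thesis
        proof (rule ccontr)
          assume "\<not> \<alpha> < ?t"
          then show False using * d2(2)[of "\<alpha> - ?t"] p(2) ef by (cases "\<alpha> = ?t") auto
        qed
      qed
    qed
    then show ?thesis using b PN[OF b] frac[OF d b, of c a] frac[OF ef(1) b, of e a] frac[OF b d, of a c]
      by (simp add: ratio_above_def)
  qed (simp add: ratio_above_def)
  moreover have "semidecidable (\<lambda>x. 0 < ps x \<and> (c * ps x \<le> pf x * d \<or> e * ps x \<le> pf x * f \<and> pf x * d \<le> c * ps x \<and>
      N (pf x) (ps x) < P (pf x) (ps x)))"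
    unfolding N_def P_def by (intro semidecidable_intros computable_intros computable_sum_fixed)
  ultimately show ?thesis by (rule right_computableI[OF assms(1)])
qed

lemma right_computable_not_closed_diff:
  obtains \<alpha> \<beta> where "\<alpha> \<ge> 0" "\<beta> \<ge> 0" "right_computable \<alpha>" "right_computable \<beta>"
    "\<alpha> - \<beta> > 0" "\<not> right_computable (\<alpha> - \<beta>)"
proof -
  obtain K where K: "semidecidable K" "\<not> semidecidable (\<lambda>x. \<not> K x)" by (rule undecidable)
  obtain Q where Q: "decidable (\<lambda>z. Q (pf z) (ps z))" "\<And>x. K x \<longleftrightarrow> (\<exists>y. Q x y)"
    using K(1) unfolding semidecidable_def by blast
  \<comment> \<open>Stage N of the enumeration of K: a witness for n has shown up below N.\<close>
  define F where "F N n \<longleftrightarrow> (\<exists>y<N. Q n y)" for N n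
  have F_K: "F N n \<Longrightarrow> K n" for N n by (auto simp: F_def Q(2))
  define g where "g n = of_bool (K n) * (1 / 3 :: real) ^ n" for n
  define \<gamma> where "\<gamma> = suminf g"
  have geo: "(\<lambda>n. (1 / 3 :: real) ^ n) sums (3 / 2)" using geometric_sums[of "1 / 3 :: real"] by simp
  have g: "0 \<le> g n" "g n \<le> (1 / 3) ^ n" for n by (auto simp: g_def)
  have summ: "summable g"
    by (rule summable_comparison_test[OF _ sums_summable[OF geo]]) (use g in auto)
  have \<gamma>: "0 \<le> \<gamma>" "\<gamma> \<le> 3 / 2" unfolding \<gamma>_def
    using suminf_nonneg[OF summ] suminf_le[OF g(2) summ sums_summable[OF geo]] g(1) sums_unique[OF geo] by auto
  define s where "s N = (\<Sum>n<N. of_bool (F N n) * (1 / 3 :: real) ^ n)" for N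
  \<comment> \<open>The partial sum \<open>s N\<close> scaled by 3^N to a natural number.\<close>
  define v :: "nat \<Rightarrow> nat" where "v N = (\<Sum>n<N. of_bool (F N n) * 3 ^ (N - n))" for N
  have pow: "(3 :: real) ^ (N - n) = 3 ^ N * (1 / 3) ^ n" if "n < N" for n N :: nat
    using that by (simp add: power_diff power_one_over)
  have v: "real (v N) = 3 ^ N * s N" for N
    unfolding v_def s_def sum_distrib_left of_nat_sum
    by (rule sum.cong) (auto simp: pow)
  have s_sum: "s N = sum g {n \<in> {..<N}. F N n}" for N
    unfolding s_def g_def using F_K by (intro sum.mono_neutral_cong_right) auto
  have sum_le: "finite A \<Longrightarrow> sum g A \<le> \<gamma>" for A
    unfolding \<gamma>_def using sum_le_suminf[OF summ] g(1) by auto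
  have s_le: "s N \<le> \<gamma>" for N unfolding s_sum by (rule sum_le) simp
  \<comment> \<open>A late stage N knows all members of K below M; the sum of their witnesses is a
    sufficient delay.\<close>
  have found: "\<exists>N>M. sum g {..<M} \<le> s N" for M
  proof -
    obtain w where w: "\<And>n. K n \<Longrightarrow> Q n (w n)" using Q(2) by metis
    define N where "N = Suc M + (\<Sum>n<M. Suc (w n))"
    have "F N n" if "n < M" "K n" for n
    proof -
      have "Suc (w n) \<le> (\<Sum>n<M. Suc (w n))" using that by (intro member_le_sum) auto
      then show ?thesis using w[OF that(2)] unfolding F_def N_def by (intro exI[of _ "w n"]) auto
    qed
    then have "sum g {..<M} \<le> s N" unfolding s_def g_def
      by (intro sum_le_included[where i="\<lambda>x. x"]) (auto simp: N_def intro!: mult_right_mono)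
    then show ?thesis unfolding N_def by (intro exI[of _ N]) (auto simp: N_def)
  qed
  \<comment> \<open>The sums \<open>s N\<close> approach \<gamma> from below, so 2 - \<gamma> is
    approached from above; it is non-negative because \<gamma> \<le> 3/2. Subtracting it from 3
    gives 1 + \<gamma>, with the wrong direction of approach.\<close>
  have ab1: "ratio_above (2 - \<gamma>) a b \<longleftrightarrow> 0 < b \<and> (\<exists>N. 2 * b * 3 ^ N < a * 3 ^ N + b * v N)" for a b
  proof (cases "0 < b")
    case b: True
    have eq: "2 * b * 3 ^ N < a * 3 ^ N + b * v N \<longleftrightarrow> 2 - s N < real a / real b" for N
    proof -
      have "2 - s N < real a / real b \<longleftrightarrow> (2 - s N) * real b * 3 ^ N < real a * 3 ^ N"
        using b by (simp add: pos_less_divide_eq)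
      also have "\<dots> \<longleftrightarrow> real (2 * b * 3 ^ N) < real (a * 3 ^ N + b * v N)"
        by (simp add: v algebra_simps)
      finally show ?thesis by (simp only: of_nat_less_iff)
    qed
    have "2 - \<gamma> < real a / real b \<longleftrightarrow> (\<exists>N. 2 - s N < real a / real b)"
    proof
      assume "2 - \<gamma> < real a / real b"
      then have "2 - real a / real b < suminf g" by (simp add: \<gamma>_def)
      then have "\<forall>\<^sub>F M in sequentially. 2 - real a / real b < sum g {..<M}"
        using summable_LIMSEQ[OF summ] by (rule order_tendstoD(1)[rotated])
      then obtain M where "2 - real a / real b < sum g {..<M}" by (auto simp: eventually_sequentially)
      then show "\<exists>N. 2 - s N < real a / real b" using found[of M] by (smt (verit))
    next
      assume "\<exists>N. 2 - s N < real a / real b"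
      then show "2 - \<gamma> < real a / real b" using s_le by (smt (verit))
    qed
    then show ?thesis using b eq by (simp add: ratio_above_def)
  qed (simp add: ratio_above_def)
  have F: "decidable (\<lambda>x. F (f x) (h x))" if "computable f" "computable h" for f h
  proof -
    have "decidable (\<lambda>z. Q (h (pf z)) (ps z))"
      by (rule decidable_comp[OF Q(1), of "\<lambda>z. pr (h (pf z)) (ps z)", simplified])
        (intro computable_intros computable_comp[OF that(2)])
    then show ?thesis unfolding F_def using that by (intro computable_intros)
  qed
  have cv: "computable (\<lambda>x. v (f x))" if "computable f" for f
    unfolding v_def by (rule computable_sum, fact) (intro computable_intros F computable_comp[OF that])
  have r\<beta>: "right_computable (2 - \<gamma>)"
    by (rule right_computableI[OF _ ab1]) (use \<gamma> in simp, intro semidecidable_intros cv computable_intros)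
  \<comment> \<open>Upper bounds for \<gamma> would enumerate the complement of K: n is excluded
    once such a bound drops below \<open>s N + (1/3)^n\<close> at a stage N that has not found
    n.\<close>
  have "\<not> right_computable (1 + \<gamma>)"
  proof
    assume R: "right_computable (1 + \<gamma>)"
    have eq: "a * 3 ^ N < b * (v N + 3 ^ (N - n)) + b * 3 ^ N \<longleftrightarrow> real a / real b < 1 + s N + (1 / 3) ^ n"
      if "0 < b" "n < N" for a b n N
    proof -
      have *: "real (b * (v N + 3 ^ (N - n)) + b * 3 ^ N) = (1 + s N + (1 / 3) ^ n) * real b * 3 ^ N"
        by (simp add: v pow[OF that(2)] algebra_simps)
      have "real a / real b < 1 + s N + (1 / 3) ^ n \<longleftrightarrow> real a * 3 ^ N < (1 + s N + (1 / 3) ^ n) * real b * 3 ^ N"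
        using that by (simp add: pos_divide_less_eq)
      also have "\<dots> \<longleftrightarrow> real (a * 3 ^ N) < real (b * (v N + 3 ^ (N - n)) + b * 3 ^ N)"
        unfolding * by simp
      finally show ?thesis by (simp only: of_nat_less_iff)
    qed
    have "\<not> K n \<longleftrightarrow> (\<exists>a b N. ratio_above (1 + \<gamma>) a b \<and> n < N \<and> \<not> F N n \<and>
        a * 3 ^ N < b * (v N + 3 ^ (N - n)) + b * 3 ^ N)" for n
    proof
      assume nK: "\<not> K n"
      obtain N where N: "Suc n < N" "sum g {..<Suc n} \<le> s N" using found[of "Suc n"] by blast
      have "\<gamma> = (\<Sum>i. g (i + Suc n)) + sum g {..<Suc n}"
        unfolding \<gamma>_def by (rule suminf_split_initial_segment[OF summ])
      moreover have sums: "(\<lambda>i. (1 / 3 :: real) ^ Suc n * (1 / 3) ^ i) sums ((1 / 3) ^ Suc n * (3 / 2))"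
        by (rule sums_mult[OF geo])
      have "g (i + Suc n) \<le> (1 / 3) ^ Suc n * (1 / 3) ^ i" for i
        using g(2)[of "i + Suc n"] by (simp add: power_add mult.commute)
      then have "(\<Sum>i. g (i + Suc n)) \<le> (\<Sum>i. (1 / 3) ^ Suc n * (1 / 3) ^ i)"
        by (rule suminf_le[OF _ summable_ignore_initial_segment[OF summ] sums_summable[OF sums]])
      then have "(\<Sum>i. g (i + Suc n)) \<le> (1 / 3) ^ Suc n * (3 / 2)" by (simp only: sums_unique[OF sums])
      \<comment> \<open>Here base 3 matters: all later terms together weigh at most half of the
        n-th. In base 2 they could weigh as much, leaving no gap.\<close>
      moreover have "(1 / 3 :: real) ^ Suc n * (3 / 2) < (1 / 3) ^ n" by simp
      ultimately have "1 + \<gamma> < 1 + s N + (1 / 3) ^ n" using N(2) by linarith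
      then obtain a b where ab: "ratio_above (1 + \<gamma>) a b" "real a / real b < 1 + s N + (1 / 3) ^ n"
        using ratio_above_dense[of "1 + \<gamma>"] \<gamma> by (metis add_nonneg_nonneg zero_le_one)
      then show "\<exists>a b N. ratio_above (1 + \<gamma>) a b \<and> n < N \<and> \<not> F N n \<and> a * 3 ^ N < b * (v N + 3 ^ (N - n)) + b * 3 ^ N"
        using eq[of b n N a] N(1) nK F_K[of N n] by (intro exI[of _ a] exI[of _ b] exI[of _ N]) (auto simp: ratio_above_def)
    next
      assume "\<exists>a b N. ratio_above (1 + \<gamma>) a b \<and> n < N \<and> \<not> F N n \<and> a * 3 ^ N < b * (v N + 3 ^ (N - n)) + b * 3 ^ N"
      then obtain a b N where *: "ratio_above (1 + \<gamma>) a b" "n < N" "\<not> F N n"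
        "real a / real b < 1 + s N + (1 / 3) ^ n" using eq by (auto simp: ratio_above_def)
      show "\<not> K n"
      proof
        assume "K n"
        \<comment> \<open>A member n of K not yet found contributes its whole weight on top of
          \<open>s N\<close>.\<close>
        have "s N + (1 / 3) ^ n = sum g (insert n {m \<in> {..<N}. F N m})"
          using * \<open>K n\<close> by (subst sum.insert) (auto simp: s_sum g_def)
        also have "\<dots> \<le> \<gamma>" by (rule sum_le) simp
        finally show False using * by (auto simp: ratio_above_def)
      qed
    qed
    moreover have "semidecidable (\<lambda>n. \<exists>a b N. ratio_above (1 + \<gamma>) a b \<and> n < N \<and> \<not> F N n \<and>
        a * 3 ^ N < b * (v N + 3 ^ (N - n)) + b * 3 ^ N)"
      using \<gamma> by (intro semidecidable_intros semidecidable_ratio_above R F cv computable_intros) simp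
    ultimately show False using K(2) by simp
  qed
  moreover have "ratio_above 3 a b \<longleftrightarrow> 0 < b \<and> 3 * b < a" for a b
  proof -
    have "real (3 * b) < real a \<longleftrightarrow> 3 * b < a" by (rule of_nat_less_iff)
    then show ?thesis by (auto simp: ratio_above_def pos_less_divide_eq)
  qed
  then have "right_computable 3" by (rule right_computableI[rotated]) (intro semidecidable_intros computable_intros, simp)
  ultimately show ?thesis using that[of 3 "2 - \<gamma>"] \<gamma> r\<beta> by simp
qed

section \<open>Commutator length in presented groups\<close>

lemma inv_letter_inv_letter [simp]: "inv_letter (inv_letter x) = x"
  by (auto simp: inv_letter_def)

lemma inv_letter_less_iff [simp]: "inv_letter x < 2 * n \<longleftrightarrow> x < 2 * n"
  by (auto simp: inv_letter_def elim!: evenE oddE)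

lemma winv_simps [simp]: "winv [] = []" "winv (x # w) = winv w @ [inv_letter x]"
  "winv (u @ v) = winv v @ winv u" "winv (winv w) = w"
  by (simp_all add: winv_def rev_map[symmetric] comp_def)

lemma words_simps [simp]: "[] \<in> words n" "x # w \<in> words n \<longleftrightarrow> x < 2 * n \<and> w \<in> words n"
  "u @ v \<in> words n \<longleftrightarrow> u \<in> words n \<and> v \<in> words n" "winv w \<in> words n \<longleftrightarrow> w \<in> words n"
  by (auto simp: words_def winv_def)

lemma wpow_simps [simp]: "wpow w 0 = []" "wpow w (Suc m) = w @ wpow w m"
  by (simp_all add: wpow_def)

lemma wpow_in_words [simp]: "w \<in> words n \<Longrightarrow> wpow w m \<in> words n"
  by (induction m) auto

lemma wpow_add: "wpow w (j + k) = wpow w j @ wpow w k"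
  by (induction j) auto

lemma wpow_mult: "wpow w (j * k) = wpow (wpow w j) k"
  by (induction k) (auto simp: wpow_add)

lemma wpow_commute: "wpow w m @ w = w @ wpow w m"
  by (induction m) auto

section \<open>Equality in the presented group\<close>

lemma peq_context: "peq R u v \<Longrightarrow> peq R (p @ u @ q) (p @ v @ q)"
proof (induction rule: peq.induct)
  case (cancel u x v)
  show ?case using peq.cancel[of R "p @ u" x "v @ q"] by simp
next
  case (rel r u v)
  then show ?case using peq.rel[of r R "p @ u" "v @ q"] by simp
qed (auto intro: peq.intros)

lemma peq_append: "peq R u u' \<Longrightarrow> peq R v v' \<Longrightarrow> peq R (u @ v) (u' @ v')"
  using peq_context[of R u u' "[]" v] peq_context[of R v v' u' "[]"] by (auto intro: peq.trans)

lemmas [trans] = peq.trans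

lemma peq_right_inv: "peq R (w @ winv w) []"
proof (induction w)
  case (Cons x w)
  have "peq R ([x] @ (w @ winv w) @ [inv_letter x]) ([x] @ [] @ [inv_letter x])"
    by (rule peq_context[OF Cons])
  also have "peq R \<dots> []" using peq.cancel[of R "[]" x "[]"] by simp
  finally show ?case by simp
qed (auto intro: peq.refl)

lemma peq_cancel: "peq R (p @ w @ winv w @ q) (p @ q)" "peq R (p @ winv w @ w @ q) (p @ q)"
  using peq_context[OF peq_right_inv, of R p w q] peq_context[OF peq_right_inv, of R p "winv w" q] by auto

lemma peq_winv:
  assumes "peq R u v" shows "peq R (winv u) (winv v)"
proof -
  have "peq R (winv u) (winv u @ v @ winv v)" using peq_cancel(1)[of R "winv u" v "[]"] by (simp add: peq.sym)
  also have "peq R \<dots> (winv u @ u @ winv v)" by (rule peq_context[OF peq.sym[OF assms]])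
  also have "peq R \<dots> (winv v)" using peq_cancel(2)[of R "[]" u "winv v"] by simp
  finally show ?thesis .
qed

lemma peq_wpow: "peq R u v \<Longrightarrow> peq R (wpow u m) (wpow v m)"
  by (induction m) (auto intro: peq.refl peq_append)

text \<open>Separates the syntactic product of commutators from the equality modulo R; both halves
  are inductive and so fit \<open>derivable\<close>.\<close>

inductive comm_word :: "nat \<Rightarrow> nat \<Rightarrow> nat list \<Rightarrow> bool" for n where
  Nil: "comm_word n 0 []"
| step: "x \<in> words n \<Longrightarrow> y \<in> words n \<Longrightarrow> comm_word n k v \<Longrightarrow> comm_word n (Suc k) (wcomm x y @ v)"

lemma comm_word_iff:
  "comm_word n k v \<longleftrightarrow> (\<exists>xs ys. length xs = k \<and> length ys = k \<and> set xs \<subseteq> words n \<and> set ys \<subseteq> words n \<and>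
     v = concat (map2 wcomm xs ys))"
proof
  show "comm_word n k v \<Longrightarrow> \<exists>xs ys. length xs = k \<and> length ys = k \<and> set xs \<subseteq> words n \<and> set ys \<subseteq> words n \<and>
     v = concat (map2 wcomm xs ys)"
  proof (induction rule: comm_word.induct)
    case (step x y k v)
    then obtain xs ys where "length xs = k" "length ys = k" "set xs \<subseteq> words n" "set ys \<subseteq> words n"
      "v = concat (map2 wcomm xs ys)" by blast
    then show ?case using step.hyps by (intro exI[of _ "x # xs"] exI[of _ "y # ys"]) auto
  qed auto
next
  have "length xs = length ys \<Longrightarrow> set xs \<subseteq> words n \<Longrightarrow> set ys \<subseteq> words n \<Longrightarrow>
    comm_word n (length xs) (concat (map2 wcomm xs ys))" for xs ys
    by (induction xs ys rule: list_induct2) (auto intro: comm_word.intros)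
  then show "\<exists>xs ys. length xs = k \<and> length ys = k \<and> set xs \<subseteq> words n \<and> set ys \<subseteq> words n \<and>
     v = concat (map2 wcomm xs ys) \<Longrightarrow> comm_word n k v" by metis
qed

lemma prod_comms_iff: "prod_comms n R g k \<longleftrightarrow> (\<exists>v. comm_word n k v \<and> peq R g v)"
  unfolding prod_comms_def comm_word_iff by blast

lemma comm_word_append: "comm_word n j u \<Longrightarrow> comm_word n k v \<Longrightarrow> comm_word n (j + k) (u @ v)"
  by (induction rule: comm_word.induct) (auto intro: comm_word.intros)

lemma prod_comms_peq: "prod_comms n R u k \<Longrightarrow> peq R v u \<Longrightarrow> prod_comms n R v k"
  unfolding prod_comms_iff by (blast intro: peq.trans)

lemma prod_comms_append: "prod_comms n R u j \<Longrightarrow> prod_comms n R v k \<Longrightarrow> prod_comms n R (u @ v) (j + k)"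
  unfolding prod_comms_iff by (blast intro: comm_word_append peq_append)

lemma prod_comms_Nil: "prod_comms n R [] 0"
  unfolding prod_comms_iff by (blast intro: comm_word.Nil peq.refl)

lemma prod_comms_wcomm: "x \<in> words n \<Longrightarrow> y \<in> words n \<Longrightarrow> prod_comms n R (wcomm x y) 1"
  unfolding prod_comms_iff using comm_word.step[OF _ _ comm_word.Nil] peq.refl by fastforce

lemma prod_comms_wpow: "prod_comms n R u k \<Longrightarrow> prod_comms n R (wpow u m) (m * k)"
  by (induction m) (auto intro: prod_comms_Nil prod_comms_append)

text \<open>Conjugation passes to the factors: a conjugate of a commutator is the commutator of the
  conjugates.\<close>

lemma prod_comms_conj:
  assumes "prod_comms n R u k" and w: "w \<in> words n" shows "prod_comms n R (w @ u @ winv w) k"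
proof -
  have "prod_comms n R (w @ v @ winv w) k" if "comm_word n k v" for v using that
  proof (induction rule: comm_word.induct)
    case Nil
    show ?case using prod_comms_peq[OF prod_comms_Nil] peq_right_inv[of R w] by simp
  next
    case (step x y k v)
    let ?c = "\<lambda>x. w @ x @ winv w"
    have "peq R (wcomm (?c x) (?c y)) (w @ wcomm x y @ winv w)"
    proof -
      have "peq R (wcomm (?c x) (?c y)) ((w @ x) @ y @ winv w @ (w @ winv x @ winv w) @ (w @ winv y @ winv w))"
        using peq_cancel(2)[of R "w @ x" w "y @ winv w @ (w @ winv x @ winv w) @ (w @ winv y @ winv w)"]
        by (simp add: wcomm_def)
      also have "peq R \<dots> ((w @ x @ y) @ (winv x @ winv w @ w @ winv y @ winv w))"
        using peq_cancel(2)[of R "w @ x @ y" w "winv x @ winv w @ w @ winv y @ winv w"] by simp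
      also have "peq R \<dots> ((w @ x @ y @ winv x) @ (winv y @ winv w))"
        using peq_cancel(2)[of R "w @ x @ y @ winv x" w "winv y @ winv w"] by simp
      finally show ?thesis by (simp add: wcomm_def)
    qed
    then have 1: "peq R ((w @ wcomm x y @ winv w) @ ?c v) (wcomm (?c x) (?c y) @ ?c v)"
      using peq_append[OF peq.sym peq.refl] by blast
    have "peq R (?c (wcomm x y @ v)) ((w @ wcomm x y @ winv w) @ ?c v)"
      using peq.sym[OF peq_cancel(2)[of R "w @ wcomm x y" w "v @ winv w"]] by simp
    also note 1
    finally have "peq R (?c (wcomm x y @ v)) (wcomm (?c x) (?c y) @ ?c v)" .
    moreover have "prod_comms n R (wcomm (?c x) (?c y) @ ?c v) (1 + k)"
      by (rule prod_comms_append[OF prod_comms_wcomm step.IH]) (use step w in auto)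
    ultimately show ?case using prod_comms_peq by fastforce
  qed
  moreover obtain v where "comm_word n k v" "peq R u v" using assms(1) unfolding prod_comms_iff by blast
  ultimately show ?thesis using peq_context prod_comms_peq by blast
qed

text \<open>The inverse of [x,y] is [y,x], even letter by letter.\<close>

lemma prod_comms_winv: assumes "prod_comms n R u k" shows "prod_comms n R (winv u) k"
proof -
  have "prod_comms n R (winv v) k" if "comm_word n k v" for v using that
  proof (induction rule: comm_word.induct)
    case (step x y k v)
    have "prod_comms n R (winv v @ wcomm y x) (k + 1)"
      by (rule prod_comms_append[OF step.IH prod_comms_wcomm[OF step.hyps(2,1)]])
    then show ?case by (simp add: wcomm_def)
  qed (simp add: prod_comms_Nil)
  then show ?thesis using assms peq_winv prod_comms_peq unfolding prod_comms_iff[of n R u] by blast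
qed

text \<open>Two more factors cost one commutator:
  \<open>a a w b b = a [a w, b a\<^sup>-\<^sup>1] a\<^sup>-\<^sup>1 (a b w a b)\<close>.\<close>
lemma power_prod:
  assumes ab: "a \<in> words n" "b \<in> words n"
  shows "\<exists>c. prod_comms n R c (m div 2) \<and> peq R (wpow a m @ wpow b m) (c @ wpow (a @ b) m)"
proof (induction m rule: induct_nat_012)
  case 0
  show ?case using prod_comms_Nil peq.refl by fastforce
next
  case 1
  show ?case using prod_comms_Nil[of n R] peq.refl[of R "a @ b"] by (intro exI[of _ "[]"]) auto
next
  case (ge2 m)
  then obtain c where c: "prod_comms n R c (m div 2)" "peq R (wpow a m @ wpow b m) (c @ wpow (a @ b) m)" by blast
  define w where "w = wpow (a @ b) m"
  have ww: "w \<in> words n" using ab by (simp add: w_def)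
  define e where "e = wcomm (a @ w) (b @ winv a)"
  let ?c = "(a @ a) @ c @ winv (a @ a)" and ?e = "a @ e @ winv a"
  have Y: "wpow (a @ b) (Suc (Suc m)) = a @ b @ w @ a @ b"
    using wpow_commute[of "a @ b" m] by (simp add: w_def)
  have "peq R (?e @ wpow (a @ b) (Suc (Suc m))) (a @ a @ w @ b @ b)"
  proof -
    have "peq R (?e @ wpow (a @ b) (Suc (Suc m)))
        ((a @ a @ w @ b @ winv a @ winv w) @ (winv a @ a) @ winv b @ b @ w @ a @ b)"
      using peq_cancel(2)[of R "a @ a @ w @ b @ winv a @ winv w @ winv a @ a @ winv b" a "b @ w @ a @ b"]
      unfolding Y e_def wcomm_def by simp
    also have "peq R \<dots> ((a @ a @ w @ b @ winv a @ winv w) @ winv b @ b @ w @ a @ b)"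
      using peq_cancel(2)[of R "a @ a @ w @ b @ winv a @ winv w" a "winv b @ b @ w @ a @ b"] by simp
    also have "peq R \<dots> ((a @ a @ w @ b @ winv a @ winv w) @ w @ a @ b)" by (rule peq_cancel(2))
    also have "peq R \<dots> ((a @ a @ w @ b @ winv a) @ a @ b)"
      using peq_cancel(2)[of R "a @ a @ w @ b @ winv a" w "a @ b"] by simp
    also have "peq R \<dots> (a @ a @ w @ b @ b)"
      using peq_cancel(2)[of R "a @ a @ w @ b" a b] by simp
    finally show ?thesis .
  qed
  then have 1: "peq R (?c @ (a @ a @ w @ b @ b)) ((?c @ ?e) @ wpow (a @ b) (Suc (Suc m)))"
    using peq_append[OF peq.refl peq.sym] by fastforce
  have "wpow b (Suc (Suc m)) = wpow b m @ b @ b" using wpow_add[of b m 2] by (simp add: numeral_2_eq_2)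
  then have "wpow a (Suc (Suc m)) @ wpow b (Suc (Suc m)) = (a @ a) @ (wpow a m @ wpow b m) @ b @ b"
    by simp
  also have "peq R \<dots> ((a @ a) @ (c @ w) @ b @ b)" unfolding w_def by (rule peq_context[OF c(2)])
  also have "peq R \<dots> (?c @ (a @ a @ w @ b @ b))"
    using peq.sym[OF peq_cancel(2)[of R "(a @ a) @ c" "a @ a" "w @ b @ b"]] by simp
  also note 1
  finally have "peq R (wpow a (Suc (Suc m)) @ wpow b (Suc (Suc m))) ((?c @ ?e) @ wpow (a @ b) (Suc (Suc m)))" .
  moreover have "prod_comms n R (?c @ ?e) (m div 2 + 1)"
    unfolding e_def
    by (intro prod_comms_append prod_comms_conj c prod_comms_wcomm) (use ab ww in auto)
  ultimately show ?case by (intro exI[of _ "?c @ ?e"]) simp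
qed

text \<open>From u^m v^m = c (uv)^m: the factor c costs \<open>m div 2\<close> commutators and the
  two powers cost one each.\<close>

lemma prod_comms_wpow_append:
  assumes "u \<in> words n" "v \<in> words n" "\<And>m. prod_comms n R (wpow u m) 1" "\<And>m. prod_comms n R (wpow v m) 1"
  shows "prod_comms n R (wpow (u @ v) m) (m div 2 + 2)"
proof -
  obtain c where c: "prod_comms n R c (m div 2)" "peq R (wpow u m @ wpow v m) (c @ wpow (u @ v) m)"
    using power_prod[OF assms(1,2)] by blast
  have "peq R (wpow (u @ v) m) (winv c @ c @ wpow (u @ v) m)"
    using peq_cancel(2)[of R "[]" c] by (simp add: peq.sym)
  also have "peq R \<dots> (winv c @ wpow u m @ wpow v m)"
    by (rule peq_append[OF peq.refl peq.sym[OF c(2)]])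
  finally have "peq R (wpow (u @ v) m) (winv c @ wpow u m @ wpow v m)" .
  moreover have "prod_comms n R (winv c @ wpow u m @ wpow v m) (m div 2 + (1 + 1))"
    by (intro prod_comms_append prod_comms_winv c assms)
  ultimately show ?thesis using prod_comms_peq by fastforce
qed

lemma peq_wpow_conj: "peq R (wpow (w @ u @ winv w) m) (w @ wpow u m @ winv w)"
proof (induction m)
  case 0
  then show ?case using peq_right_inv by (simp add: peq.sym)
next
  case (Suc m)
  have "peq R (wpow (w @ u @ winv w) (Suc m)) ((w @ u) @ winv w @ w @ wpow u m @ winv w)"
    using peq_append[OF peq.refl[of R "w @ u @ winv w"] Suc] by simp
  also have "peq R \<dots> ((w @ u) @ wpow u m @ winv w)" by (rule peq_cancel(2))
  finally show ?case by simp
qed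

lemma prod_comms_wpow_conj:
  assumes "w \<in> words n" "\<And>m. prod_comms n R (wpow u m) k"
  shows "prod_comms n R (wpow (w @ u @ winv w) m) k"
  by (rule prod_comms_peq[OF prod_comms_conj[OF assms(2,1)] peq_wpow_conj])

text \<open>As in \<open>BS(1,2)\<close>: \<open>a f\<^sup>m a\<^sup>-\<^sup>1 = f\<^bsup>2m\<^esup>\<close>, so \<open>f\<^sup>m = [a, f\<^sup>m]\<close>.\<close>
lemma prod_comms_wpow_square:
  assumes "a \<in> words n" "f \<in> words n" "peq R (a @ f @ winv a) (f @ f)"
  shows "prod_comms n R (wpow f m) 1"
proof -
  have ff: "wpow (f @ f) m = wpow f m @ wpow f m" by (metis wpow_add wpow_mult mult_2 numeral_2_eq_2 wpow_simps append_Nil2)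
  have "peq R (a @ wpow f m @ winv a) (wpow f m @ wpow f m)"
    using peq.trans[OF peq.sym[OF peq_wpow_conj] peq_wpow[OF assms(3), of m]] by (simp add: ff)
  then have "peq R ((a @ wpow f m @ winv a) @ winv (wpow f m)) ((wpow f m @ wpow f m) @ winv (wpow f m))"
    by (rule peq_append[OF _ peq.refl])
  then have "peq R (wcomm a (wpow f m)) (wpow f m @ wpow f m @ winv (wpow f m))" by (simp add: wcomm_def)
  also have "peq R \<dots> (wpow f m)" using peq_cancel(1)[of R "wpow f m" "wpow f m" "[]"] by simp
  finally have "peq R (wpow f m) (wcomm a (wpow f m))" by (rule peq.sym)
  then show ?thesis
    using prod_comms_peq[OF prod_comms_wcomm[OF assms(1) wpow_in_words[OF assms(2)]]] by blast
qed

section \<open>The stable commutator length is right-computable\<close>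

text \<open>Division of m by p; the last summand is independent of m and absorbs the remainder as
  well as \<open>u 0\<close>, which need not vanish.\<close>

lemma subadditive_le:
  fixes u :: "nat \<Rightarrow> nat"
  assumes sub: "\<And>i j. u (i + j) \<le> u i + u j" and "0 < p"
  shows "real (u m) \<le> real m * (real (u p) / real p) + real (u 0 + (\<Sum>r<p. u r))"
proof -
  have mult: "u (p * k) \<le> u 0 + k * u p" for k
  proof (induction k)
    case (Suc k)
    then show ?case using sub[of p "p * k"] by simp
  qed simp
  have "u (m mod p) \<le> (\<Sum>r<p. u r)" using assms(2) by (intro member_le_sum) auto
  moreover have "u m \<le> u (p * (m div p)) + u (m mod p)" using sub[of "p * (m div p)" "m mod p"] by simp
  ultimately have "u m \<le> (m div p) * u p + (u 0 + (\<Sum>r<p. u r))" using mult[of "m div p"] by linarith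
  then have "real (u m) \<le> real (m div p) * real (u p) + real (u 0 + (\<Sum>r<p. u r))"
    by (metis of_nat_add of_nat_le_iff of_nat_mult)
  moreover have "real (m div p) * real (u p) \<le> real m / real p * real (u p)"
    by (intro mult_right_mono of_nat_div_le_of_nat) simp
  ultimately show ?thesis by simp
qed

lemma fekete:
  fixes u :: "nat \<Rightarrow> nat"
  assumes sub: "\<And>i j. u (i + j) \<le> u i + u j"
  shows "(\<lambda>m. real (u m) / real m) \<longlonglongrightarrow> (INF m\<in>{1..}. real (u m) / real m)" (is "?f \<longlonglongrightarrow> ?L")
proof (rule LIMSEQ_I)
  fix e :: real assume e: "0 < e"
  have bdd: "bdd_below (?f ` {1..})" by (rule bdd_belowI[of _ 0]) auto
  have "?L < ?L + e / 2" using e by simp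
  then have "\<exists>p\<in>{1..}. ?f p < ?L + e / 2" by (subst (asm) cINF_less_iff[OF _ bdd]) simp
  then obtain p where p: "1 \<le> p" "?f p < ?L + e / 2" by auto
  define B where "B = real (u 0 + (\<Sum>r<p. u r))"
  obtain N :: nat where N: "2 * B / e < real N" using reals_Archimedean2 by blast
  have "norm (?f m - ?L) < e" if m: "Suc N \<le> m" for m
  proof -
    have "?L \<le> ?f m" using m by (intro cINF_lower[OF bdd]) auto
    moreover have "?f m \<le> ?f p + B / real m"
    proof -
      have "?f m \<le> (real m * ?f p + B) / real m"
        using subadditive_le[of u p m, OF sub] p(1) unfolding B_def by (intro divide_right_mono) auto
      also have "\<dots> = ?f p + B / real m" using m by (simp add: add_divide_distrib)
      finally show ?thesis .
    qed
    moreover have "B / real m < e / 2"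
    proof -
      have "real N < real m" using m by simp
      then have "2 * B / e < real m" using N by linarith
      then show ?thesis using m e by (simp add: field_simps)
    qed
    ultimately show ?thesis using p(2) unfolding real_norm_def by linarith
  qed
  then show "\<exists>no. \<forall>n\<ge>no. norm (?f n - ?L) < e" by blast
qed

text \<open>Upper bounds for scl that a search can find: any power and any number of commutators,
  with no minimality to verify.\<close>

definition ratios :: "nat \<Rightarrow> nat list set \<Rightarrow> nat list \<Rightarrow> real set" where
  "ratios n R g = {real k / real M | M k. 1 \<le> M \<and> prod_comms n R (wpow g M) k}"

lemma prod_comms_cl: "in_comm_sub n R g \<Longrightarrow> prod_comms n R g (cl n R g)"
  unfolding in_comm_sub_def cl_def by (rule LeastI_ex)

lemma cl_le: "prod_comms n R g k \<Longrightarrow> cl n R g \<le> k"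
  unfolding cl_def by (rule Least_le)

lemma bdd_below_ratios: "bdd_below (ratios n R g)"
  by (rule bdd_belowI[of _ 0]) (auto simp: ratios_def)

lemma ratios_nonempty: "1 \<le> N \<Longrightarrow> in_comm_sub n R (wpow g N) \<Longrightarrow> ratios n R g \<noteq> {}"
  unfolding ratios_def in_comm_sub_def by blast

text \<open>Both the limit and the least N disappear: if g^M is a product of k commutators, then
  (g^N)^M is one of N k, and conversely powers of g^N are powers of g.\<close>

lemma scl_eq_Inf:
  assumes "\<exists>N\<ge>1. in_comm_sub n R (wpow g N)"
  shows "scl n R g = ereal (Inf (ratios n R g))"
proof -
  define N where "N = (LEAST N. N \<ge> 1 \<and> in_comm_sub n R (wpow g N))"
  have N: "1 \<le> N" "in_comm_sub n R (wpow g N)" using LeastI_ex[OF assms] by (auto simp: N_def)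
  define u where "u m = cl n R (wpow (wpow g N) m)" for m
  have u: "prod_comms n R (wpow (wpow g N) m) (u m)" for m
  proof -
    obtain k where "prod_comms n R (wpow g N) k" using N(2) in_comm_sub_def by blast
    then show ?thesis unfolding u_def by (intro prod_comms_cl) (auto simp: in_comm_sub_def intro: prod_comms_wpow)
  qed
  let ?L = "INF m\<in>{1..}. real (u m) / real m"
  have sub: "u (i + j) \<le> u i + u j" for i j
    unfolding u_def[of "i + j"] wpow_add by (intro cl_le prod_comms_append u)
  have "scl_comm n R (wpow g N) = ?L"
    unfolding scl_comm_def u_def[symmetric] by (rule limI[OF fekete[OF sub]])
  moreover have "?L / real N = Inf (ratios n R g)"
  proof (rule antisym)
    have "?L / real N \<le> real k / real M" if "1 \<le> M" "prod_comms n R (wpow g M) k" for M k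
    proof -
      have "prod_comms n R (wpow (wpow g N) M) (N * k)"
        using prod_comms_wpow[OF that(2), of N] by (simp add: wpow_mult[symmetric] mult.commute)
      then have "real (u M) \<le> real (N * k)" unfolding u_def using cl_le of_nat_le_iff by blast
      then have "real (u M) / real M \<le> real N * (real k / real M)" using that(1) by (simp add: field_simps)
      moreover have "?L \<le> real (u M) / real M"
        by (rule cINF_lower[OF bdd_belowI[of _ 0]]) (use that(1) in auto)
      ultimately show ?thesis using N(1) by (simp add: field_simps)
    qed
    then show "?L / real N \<le> Inf (ratios n R g)"
      by (intro cInf_greatest[OF ratios_nonempty[OF N]]) (auto simp: ratios_def)
    have "Inf (ratios n R g) * real N \<le> real (u m) / real m" if "1 \<le> m" for m
    proof -
      have "real (u m) / real (N * m) \<in> ratios n R g"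
        using u[of m] N(1) that unfolding ratios_def wpow_mult[symmetric] by fastforce
      then have "Inf (ratios n R g) \<le> real (u m) / real (N * m)" by (rule cInf_lower[OF _ bdd_below_ratios])
      then show ?thesis using N(1) that by (simp add: field_simps)
    qed
    then have "Inf (ratios n R g) * real N \<le> ?L" by (intro cINF_greatest) auto
    then show "Inf (ratios n R g) \<le> ?L / real N" using N(1) by (simp add: pos_le_divide_eq)
  qed
  moreover have "scl n R g = ereal (scl_comm n R (wpow g N) / real N)"
    unfolding scl_def N_def Let_def using assms by (rule if_P)
  ultimately show ?thesis by simp
qed

text \<open>An infimum lies below a number as soon as one element does, so a strict upper bound for
  scl is witnessed by a single power.\<close>

lemma ratio_above_scl_iff:
  assumes "scl n R g = ereal s"
  shows "0 \<le> s" "ratio_above s a b \<longleftrightarrow> 0 < b \<and> (\<exists>M k. 1 \<le> M \<and> prod_comms n R (wpow g M) k \<and> k * b < a * M)"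
proof -
  have ex: "\<exists>N\<ge>1. in_comm_sub n R (wpow g N)" using assms unfolding scl_def by (auto split: if_splits)
  then have s: "s = Inf (ratios n R g)" and ne: "ratios n R g \<noteq> {}"
    using scl_eq_Inf[OF ex] assms ratios_nonempty by auto
  show "0 \<le> s" unfolding s using ne by (intro cInf_greatest) (auto simp: ratios_def)
  have "s < x \<longleftrightarrow> (\<exists>M k. 1 \<le> M \<and> prod_comms n R (wpow g M) k \<and> real k / real M < x)" for x
    unfolding s cInf_less_iff[OF ne bdd_below_ratios] by (auto simp: ratios_def)
  moreover have "real k / real M < real a / real b \<longleftrightarrow> k * b < a * M" if "0 < b" "1 \<le> M" for k M
  proof -
    have "real k / real M < real a / real b \<longleftrightarrow> real (k * b) < real (a * M)"
      using that by (simp add: field_simps)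
    then show ?thesis by (simp only: of_nat_less_iff)
  qed
  ultimately show "ratio_above s a b \<longleftrightarrow> 0 < b \<and> (\<exists>M k. 1 \<le> M \<and> prod_comms n R (wpow g M) k \<and> k * b < a * M)"
    unfolding ratio_above_def by blast
qed

section \<open>Enumeration of equalities and of products of commutators\<close>

lemma decidable_even [computable_intros]: assumes "computable f" shows "decidable (\<lambda>x. even (f x))"
proof -
  have "rec_nat (0 :: nat) (\<lambda>_ r. 1 - r) k = of_bool (odd k)" for k by (induction k) auto
  then have eq: "even k \<longleftrightarrow> rec_nat (0 :: nat) (\<lambda>_ r. 1 - r) k = 0" for k by simp
  show ?thesis unfolding eq by (intro computable_intros assms)
qed

lemma computable_inv_letter [computable_intros]: "computable f \<Longrightarrow> computable (\<lambda>x. inv_letter (f x))"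
  unfolding inv_letter_def by (intro computable_intros)

lemma computable_list_winv [computable_intros]: "computable_list F \<Longrightarrow> computable_list (\<lambda>x. winv (F x))"
  unfolding winv_def by (intro computable_intros)

lemma computable_list_wcomm [computable_intros]: "computable_list F \<Longrightarrow> computable_list G \<Longrightarrow> computable_list (\<lambda>x. wcomm (F x) (G x))"
  unfolding wcomm_def by (intro computable_intros)

lemma computable_list_wpow [computable_intros]: assumes "computable_list F" "computable f" shows "computable_list (\<lambda>x. wpow (F x) (f x))"
proof -
  have "list_code (wpow w m) = rec_nat (list_code []) (\<lambda>_ r. list_code (w @ decode_list r)) m" for w m
  proof (induction m)
    case (Suc m)
    have "rec_nat (list_code []) (\<lambda>_ r. list_code (w @ decode_list r)) m = list_code (wpow w m)" using Suc by simp
    then show ?case by simp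
  qed simp
  then show ?thesis unfolding computable_list_def
    by (simp only:) (intro computable_intros assms computable_list_comp[OF assms(1)])
qed

lemma decidable_words [computable_intros]: "computable_list F \<Longrightarrow> decidable (\<lambda>x. F x \<in> words n)"
  unfolding words_def mem_Collect_eq by (intro computable_intros)

definition peq_step :: "nat list set \<Rightarrow> nat \<Rightarrow> nat list \<Rightarrow> bool" where
  "peq_step R z L \<longleftrightarrow> (\<exists>u v. z = pr (list_code u) (list_code v) \<and>
     (u = v \<or> pr (list_code v) (list_code u) \<in> set L
    \<or> (\<exists>w. pr (list_code u) (list_code w) \<in> set L \<and> pr (list_code w) (list_code v) \<in> set L)
    \<or> (\<exists>p x q. u = p @ [x, inv_letter x] @ q \<and> v = p @ q)
    \<or> (\<exists>p r q. list_code r \<in> list_code ` R \<and> u = p @ r @ q \<and> v = p @ q)))"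

lemma peq_step_code: "peq_step R (pr (list_code u) (list_code v)) L \<longleftrightarrow>
     u = v \<or> pr (list_code v) (list_code u) \<in> set L
    \<or> (\<exists>w. pr (list_code u) (list_code w) \<in> set L \<and> pr (list_code w) (list_code v) \<in> set L)
    \<or> (\<exists>p x q. u = p @ [x, inv_letter x] @ q \<and> v = p @ q)
    \<or> (\<exists>p r q. r \<in> R \<and> u = p @ r @ q \<and> v = p @ q)"
  unfolding peq_step_def by (simp add: image_iff)

lemma peq_iff_derivable: "peq R u v \<longleftrightarrow> derivable (peq_step R) (pr (list_code u) (list_code v))"
proof
  show "peq R u v \<Longrightarrow> derivable (peq_step R) (pr (list_code u) (list_code v))"
  proof (induction rule: peq.induct)
    case (refl u)
    show ?case by (rule derivable.derivable[of _ _ "[]"]) (simp_all add: peq_step_code)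
  next
    case (sym u v)
    then show ?case by (intro derivable.derivable[of _ _ "[pr (list_code u) (list_code v)]"]) (simp_all add: peq_step_code)
  next
    case (trans u v w)
    then show ?case
      by (intro derivable.derivable[of _ _ "[pr (list_code u) (list_code v), pr (list_code v) (list_code w)]"])
        (auto simp: peq_step_code)
  next
    case (cancel u x v)
    have "\<exists>p y q. u @ [x, inv_letter x] @ v = p @ [y, inv_letter y] @ q \<and> u @ v = p @ q" by blast
    then show ?case by (intro derivable.derivable[of _ _ "[]"]) (unfold peq_step_code, blast, simp)
  next
    case (rel r u v)
    then have "\<exists>p r' q. r' \<in> R \<and> u @ r @ v = p @ r' @ q \<and> u @ v = p @ q" by blast
    then show ?case by (intro derivable.derivable[of _ _ "[]"]) (unfold peq_step_code, blast, simp)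
  qed
next
  have "derivable (peq_step R) z \<Longrightarrow> z = pr (list_code u) (list_code v) \<Longrightarrow> peq R u v" for z
  proof (induction arbitrary: u v rule: derivable.induct)
    case (derivable z L)
    have IH: "pr (list_code u) (list_code v) \<in> set L \<Longrightarrow> peq R u v" for u v using derivable.IH by blast
    have "peq_step R (pr (list_code u) (list_code v)) L" using derivable by simp
    then show ?case unfolding peq_step_code
      by (elim disjE exE conjE) (use IH in \<open>blast intro: peq.intros\<close>)+
  qed
  then show "derivable (peq_step R) (pr (list_code u) (list_code v)) \<Longrightarrow> peq R u v" by blast
qed

lemma semidecidable_peq:
  assumes "re_set (list_code ` R)" "computable_list F" "computable_list G" shows "semidecidable (\<lambda>x. peq R (F x) (G x))"
proof -
  have R: "semidecidable (\<lambda>x. list_code (F x) \<in> list_code ` R)" if "computable_list F" for F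
    using semidecidable_comp[OF assms(1)[unfolded re_set_iff] that[unfolded computable_list_def]] .
  have "semidecidable (\<lambda>z. peq_step R (pf z) (decode_list (ps z)))"
    unfolding peq_step_def by (intro R semidecidable_intros computable_intros)
  from semidecidable_comp[OF semidecidable_derivable[OF this], of "\<lambda>x. pr (list_code (F x)) (list_code (G x))"]
  show ?thesis unfolding peq_iff_derivable using assms by (simp add: computable_basic(9) computable_list_def)
qed

definition comm_word_step :: "nat \<Rightarrow> nat \<Rightarrow> nat list \<Rightarrow> bool" where
  "comm_word_step n z L \<longleftrightarrow> z = pr 0 (list_code []) \<or> (\<exists>x y k v. z = pr (Suc k) (list_code (wcomm x y @ v)) \<and>
     x \<in> words n \<and> y \<in> words n \<and> pr k (list_code v) \<in> set L)"

lemma comm_word_iff_derivable: "comm_word n k v \<longleftrightarrow> derivable (comm_word_step n) (pr k (list_code v))"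
proof
  show "comm_word n k v \<Longrightarrow> derivable (comm_word_step n) (pr k (list_code v))"
  proof (induction rule: comm_word.induct)
    case Nil
    show ?case by (rule derivable.derivable[of _ _ "[]"]) (simp_all add: comm_word_step_def)
  next
    case (step x y k v)
    then show ?case by (intro derivable.derivable[of _ _ "[pr k (list_code v)]"]) (auto simp: comm_word_step_def)
  qed
next
  have "derivable (comm_word_step n) z \<Longrightarrow> z = pr k (list_code v) \<Longrightarrow> comm_word n k v" for z
  proof (induction arbitrary: k v rule: derivable.induct)
    case (derivable z L)
    then consider "k = 0" "v = []" | x y k' v' where "k = Suc k'" "v = wcomm x y @ v'" "x \<in> words n" "y \<in> words n"
      "pr k' (list_code v') \<in> set L"
      by (auto simp: comm_word_step_def)
    then show ?case using derivable.IH by cases (auto intro: comm_word.intros)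
  qed
  then show "derivable (comm_word_step n) (pr k (list_code v)) \<Longrightarrow> comm_word n k v" by blast
qed

lemma semidecidable_comm_word:
  assumes "computable f" "computable_list F" shows "semidecidable (\<lambda>x. comm_word n (f x) (F x))"
proof -
  have words: "semidecidable (\<lambda>x. G x \<in> words n)" if "computable_list G" for G by (intro semidecidable_dp computable_intros that)
  have "semidecidable (\<lambda>z. comm_word_step n (pf z) (decode_list (ps z)))"
    unfolding comm_word_step_def by (intro words semidecidable_intros computable_intros)
  from semidecidable_comp[OF semidecidable_derivable[OF this], of "\<lambda>x. pr (f x) (list_code (F x))"]
  show ?thesis unfolding comm_word_iff_derivable using assms by (simp add: computable_basic(9) computable_list_def)
qed

lemma scl_right_computable:
  assumes "rec_pres n R" "scl n R g = ereal s" shows "right_computable s"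
proof (rule right_computableI[OF ratio_above_scl_iff(1)[OF assms(2)] ratio_above_scl_iff(2)[OF assms(2)]])
  have R: "re_set (list_code ` R)" using assms(1) by (simp add: rec_pres_def)
  show "semidecidable (\<lambda>z. 0 < ps z \<and> (\<exists>M k. 1 \<le> M \<and> prod_comms n R (wpow g M) k \<and> k * ps z < pf z * M))"
    unfolding prod_comms_iff by (intro semidecidable_peq[OF R] semidecidable_comm_word semidecidable_intros computable_intros)
qed

text \<open>The value 0 is treated apart, since the action constructed below needs translations of
  positive length.\<close>

lemma trivial_group_scl: "0 \<in> SCL_rp"
proof -
  have pc: "prod_comms 0 {} (wpow [] M) 0" for M :: nat
    using prod_comms_wpow[OF prod_comms_Nil, of 0 "{}" M] by simp
  have "\<exists>N\<ge>1. in_comm_sub 0 {} (wpow [] N)" using pc in_comm_sub_def by blast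
  then have "scl 0 {} [] = ereal (Inf (ratios 0 {} []))" by (rule scl_eq_Inf)
  moreover have "Inf (ratios 0 {} []) = 0"
  proof (rule antisym)
    show "Inf (ratios 0 {} []) \<le> 0"
      by (rule cInf_lower[OF _ bdd_below_ratios]) (use pc[of 1] in \<open>force simp: ratios_def\<close>)
    show "0 \<le> Inf (ratios 0 {} [])"
      by (rule cInf_greatest[OF ratios_nonempty[of 1]]) (use prod_comms_Nil in \<open>auto simp: ratios_def in_comm_sub_def\<close>)
  qed
  moreover have "rec_pres 0 {}" unfolding rec_pres_def re_set_iff by (simp add: semidecidable_atoms(1))
  ultimately have "rec_pres 0 {} \<and> [] \<in> words 0 \<and> scl 0 {} [] = ereal 0" by simp
  then show ?thesis unfolding SCL_rp_def by blast
qed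

section \<open>Lifts of circle homeomorphisms\<close>

text \<open>Continuity is implied: an increasing surjection of the line has no jumps.\<close>

definition homeo :: "(real \<Rightarrow> real) \<Rightarrow> bool" where
  "homeo F \<longleftrightarrow> strict_mono F \<and> surj F \<and> (\<forall>t. F (t + 1) = F t + 1)"

lemma homeo_less [simp]: "homeo F \<Longrightarrow> F s < F t \<longleftrightarrow> s < t"
  and homeo_le [simp]: "homeo F \<Longrightarrow> F s \<le> F t \<longleftrightarrow> s \<le> t"
  and homeo_eq [simp]: "homeo F \<Longrightarrow> F s = F t \<longleftrightarrow> s = t"
  unfolding homeo_def by (auto simp: strict_mono_less strict_mono_less_eq strict_mono_eq)

lemma homeo_bij: "homeo F \<Longrightarrow> bij F"
  unfolding homeo_def bij_def using strict_mono_imp_inj_on by blast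

lemma homeo_inv1 [simp]: "homeo F \<Longrightarrow> F (inv F t) = t"
  and homeo_inv2 [simp]: "homeo F \<Longrightarrow> inv F (F t) = t"
  using homeo_bij by (auto simp: bij_def surj_f_inv_f)

lemma homeo_add1: "homeo F \<Longrightarrow> F (t + 1) = F t + 1"
  by (simp add: homeo_def)

lemma homeo_add_int [simp]: assumes "homeo F" shows "F (t + of_int m) = F t + of_int m"
proof (induction m rule: int_induct[where k=0])
  case (step1 i)
  then show ?case using homeo_add1[OF assms, of "t + of_int i"] by (simp add: algebra_simps)
next
  case (step2 i)
  then show ?case using homeo_add1[OF assms, of "t + of_int i - 1"] by (simp add: algebra_simps)
qed simp

lemma homeo_id [simp]: "homeo id" "homeo (\<lambda>t. t)"
  by (auto simp: homeo_def strict_mono_def id_def)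

lemma homeo_comp: assumes "homeo F" "homeo G" shows "homeo (F \<circ> G)"
  using assms comp_surj[of G F] unfolding homeo_def by (auto simp: strict_mono_def)

lemma homeo_inv: assumes "homeo F" shows "homeo (inv F)"
proof -
  have "inv F s < inv F t" if "s < t" for s t using homeo_less[OF assms, of "inv F s" "inv F t"] assms that by simp
  moreover have "inv F (t + 1) = inv F t + 1" for t
    using homeo_add1[OF assms, of "inv F t"] assms homeo_inv2[of F "inv F t + 1"] by simp
  moreover have "surj (inv F)" by (rule bij_is_surj[OF bij_imp_bij_inv[OF homeo_bij[OF assms]]])
  ultimately show ?thesis by (simp add: homeo_def strict_mono_def)
qed

lemma homeo_inv_inv: "homeo F \<Longrightarrow> inv (inv F) = F"
  by (simp add: homeo_bij inv_inv_eq)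

lemma homeo_funpow: "homeo F \<Longrightarrow> homeo (F ^^ n)"
  by (induction n) (simp_all add: homeo_comp)

lemma homeo_translation: "homeo (\<lambda>t. t + c)"
proof -
  have "surj (\<lambda>t. t + c)" by (rule surjI[of _ "\<lambda>t. t - c"]) simp
  then show ?thesis by (auto simp: homeo_def strict_mono_def)
qed

text \<open>Up to an integer translation, \<open>y\<close> moves every point to the right and some point by less than 1;
  the same then holds for the conjugate \<open>x y x\<^sup>-\<^sup>1\<close>.\<close>
lemma homeo_commutator_less:
  assumes x: "homeo x" and y: "homeo y"
  shows "x (y (inv x (inv y t))) < t + 2"
proof -
  let ?D = "range (\<lambda>t. y t - t)"
  have low: "y 0 - 1 \<le> y t - t" for t
  proof -
    have "y (of_int \<lfloor>t\<rfloor>) \<le> y t" using y by simp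
    moreover have "y (of_int \<lfloor>t\<rfloor>) = y 0 + of_int \<lfloor>t\<rfloor>" using homeo_add_int[OF y, of 0] by simp
    ultimately show ?thesis by linarith
  qed
  then have bdd: "bdd_below ?D" by (intro bdd_belowI[of _ "y 0 - 1"]) auto
  define n where "n = \<lfloor>Inf ?D\<rfloor>"
  have ge: "t + of_int n \<le> y t" for t
  proof -
    have "Inf ?D \<le> y t - t" by (rule cInf_lower[OF _ bdd]) simp
    then show ?thesis unfolding n_def by linarith
  qed
  have "Inf ?D < of_int n + 1" unfolding n_def by linarith
  then obtain t0 where t0: "y t0 < t0 + of_int (n + 1)"
    using cInf_less_iff[OF _ bdd] by (auto simp: algebra_simps)
  define p where "p = x t0"
  have le: "x (y (inv x (inv y s))) \<le> x (y (inv x s)) - of_int n" for s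
  proof -
    have "inv y s \<le> s - of_int n" using ge[of "inv y s"] y by simp
    then have "x (y (inv x (inv y s))) \<le> x (y (inv x (s + of_int (- n))))"
      using x y homeo_inv[OF x] by (simp del: homeo_add_int)
    then show ?thesis using x y homeo_inv[OF x] by (simp del: of_int_minus)
  qed
  have "x (y t0) < x (t0 + of_int (n + 1))" using t0 x by (simp del: homeo_add_int)
  then have "x (y t0) < x t0 + of_int (n + 1)" using homeo_add_int[OF x] by metis
  then have p1: "x (y (inv x (inv y p))) < p + 1" using le[of p] x by (simp add: p_def)
  \<comment> \<open>An integer translate of p lies in [t, t + 1); monotonicity carries the bound 1
    at p over to t at the price of another 1.\<close>
  define m where "m = \<lceil>t - p\<rceil>"
  have m: "t \<le> p + of_int m" "p + of_int m < t + 1" unfolding m_def by linarith+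
  have "x (y (inv x (inv y t))) \<le> x (y (inv x (inv y (p + of_int m))))"
    using x y homeo_inv[OF x] homeo_inv[OF y] m(1) by (simp del: homeo_add_int)
  also have "\<dots> = x (y (inv x (inv y p))) + of_int m"
    using x y homeo_inv[OF x] homeo_inv[OF y] by simp
  finally show ?thesis using p1 m(2) by linarith
qed

section \<open>Words acting on the line\<close>

definition letter_map :: "(nat \<Rightarrow> real \<Rightarrow> real) \<Rightarrow> nat \<Rightarrow> real \<Rightarrow> real" where
  "letter_map \<rho> x = (if even x then \<rho> (x div 2) else inv (\<rho> (x div 2)))"

definition word_map :: "(nat \<Rightarrow> real \<Rightarrow> real) \<Rightarrow> nat list \<Rightarrow> real \<Rightarrow> real" where
  "word_map \<rho> w = foldr (\<lambda>x F. letter_map \<rho> x \<circ> F) w id"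

lemma word_map_simps [simp]: "word_map \<rho> [] = id" "word_map \<rho> (x # w) = letter_map \<rho> x \<circ> word_map \<rho> w"
  by (simp_all add: word_map_def)

context
  fixes \<rho> :: "nat \<Rightarrow> real \<Rightarrow> real"
  assumes homeo_gen: "\<And>i. homeo (\<rho> i)"
begin

lemma homeo_letter_map: "homeo (letter_map \<rho> x)"
  by (simp add: letter_map_def homeo_gen homeo_inv)

lemma homeo_word_map [simp]: "homeo (word_map \<rho> w)"
proof (induction w)
  case (Cons x w)
  then show ?case unfolding word_map_simps by (intro homeo_comp homeo_letter_map)
qed simp

lemma word_map_append [simp]: "word_map \<rho> (u @ v) = word_map \<rho> u \<circ> word_map \<rho> v"
  by (induction u) (simp_all add: comp_assoc)

lemma letter_map_inv_letter: "letter_map \<rho> (inv_letter x) = inv (letter_map \<rho> x)"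
  by (auto simp: letter_map_def inv_letter_def homeo_inv_inv homeo_gen elim: oddE)

lemma word_map_winv [simp]: "word_map \<rho> (winv w) = inv (word_map \<rho> w)"
proof (induction w)
  case (Cons x w)
  have "word_map \<rho> (winv (x # w)) = inv (word_map \<rho> w) \<circ> inv (letter_map \<rho> x)"
    using Cons by (simp add: letter_map_inv_letter)
  also have "\<dots> = inv (letter_map \<rho> x \<circ> word_map \<rho> w)"
    by (intro o_inv_distrib[symmetric] homeo_bij homeo_letter_map homeo_word_map)
  finally show ?case unfolding word_map_simps .
qed simp

lemma word_map_wpow [simp]: "word_map \<rho> (wpow w m) = word_map \<rho> w ^^ m"
  by (induction m) simp_all

lemma word_map_peq:
  assumes "\<And>r. r \<in> R \<Longrightarrow> word_map \<rho> r = id" "peq R u v" shows "word_map \<rho> u = word_map \<rho> v"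
  using assms(2)
proof (induction rule: peq.induct)
  case (cancel u x v)
  have "letter_map \<rho> x \<circ> inv (letter_map \<rho> x) = id" using homeo_letter_map by auto
  then show ?case by (simp add: letter_map_inv_letter comp_assoc[symmetric])
qed (auto simp: assms(1))

lemma word_map_comm_word: "comm_word n k v \<Longrightarrow> word_map \<rho> v t \<le> t + 2 * real k"
proof (induction arbitrary: t rule: comm_word.induct)
  case (step x y k v)
  have "word_map \<rho> (wcomm x y @ v) t \<le> word_map \<rho> v t + 2"
    using homeo_commutator_less[of "word_map \<rho> x" "word_map \<rho> y" "word_map \<rho> v t"] by (simp add: wcomm_def less_imp_le)
  then show ?case using step.IH[of t] by simp
qed simp

lemma ratio_lower_bound:
  assumes "\<And>r. r \<in> R \<Longrightarrow> word_map \<rho> r = id" "word_map \<rho> g = (\<lambda>t. t + 2 * \<alpha>)"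
    "prod_comms n R (wpow g M) k" "1 \<le> M"
  shows "\<alpha> \<le> real k / real M"
proof -
  obtain v where v: "comm_word n k v" "peq R (wpow g M) v" using assms(3) unfolding prod_comms_iff by blast
  have "((\<lambda>t. t + 2 * \<alpha>) ^^ M) 0 = real M * (2 * \<alpha>)" by (induction M) (auto simp: algebra_simps)
  then have "real M * (2 * \<alpha>) \<le> 0 + 2 * real k"
    using word_map_peq[OF assms(1) v(2)] word_map_comm_word[OF v(1), of 0] assms(2) by simp
  then show ?thesis using assms(4) by (simp add: field_simps)
qed
end

section \<open>Conjugating maps of the line\<close>

text \<open>Half-open intervals tile, so neighbouring pieces glue without a matching condition at
  the common end point.\<close>

definition oiso :: "(real \<Rightarrow> real) \<Rightarrow> real \<Rightarrow> real \<Rightarrow> real \<Rightarrow> real \<Rightarrow> bool" where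
  "oiso E a b c d \<longleftrightarrow> strict_mono_on {a..<b} E \<and> E ` {a..<b} = {c..<d}"

lemma oiso_linear:
  assumes "a < b" "c < d" shows "oiso (\<lambda>t. c + (t - a) * ((d - c) / (b - a))) a b c d"
  unfolding oiso_def
proof
  have k: "0 < (d - c) / (b - a)" using assms by simp
  show "strict_mono_on {a..<b} (\<lambda>t. c + (t - a) * ((d - c) / (b - a)))"
  proof (rule strict_mono_onI)
    fix r s :: real assume "r < s"
    then have "(r - a) * ((d - c) / (b - a)) < (s - a) * ((d - c) / (b - a))"
      using k by (intro mult_strict_right_mono) auto
    then show "c + (r - a) * ((d - c) / (b - a)) < c + (s - a) * ((d - c) / (b - a))" by simp
  qed
  have 1: "(b - a) * ((d - c) / (b - a)) = d - c" using assms by simp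
  show "(\<lambda>t. c + (t - a) * ((d - c) / (b - a))) ` {a..<b} = {c..<d}"
  proof safe
    fix t assume t: "t \<in> {a..<b}"
    then have "(t - a) * ((d - c) / (b - a)) < (b - a) * ((d - c) / (b - a))"
      using k by (intro mult_strict_right_mono) auto
    moreover have "0 \<le> (t - a) * ((d - c) / (b - a))" using k t by (intro mult_nonneg_nonneg) auto
    ultimately show "c + (t - a) * ((d - c) / (b - a)) \<in> {c..<d}"
      unfolding 1 by (simp del: times_divide_eq_right)
  next
    fix y assume y: "y \<in> {c..<d}"
    let ?t = "a + (y - c) * ((b - a) / (d - c))"
    have "(y - c) * ((b - a) / (d - c)) < (d - c) * ((b - a) / (d - c))"
      using assms y by (intro mult_strict_right_mono) auto
    then have "?t < b" using assms by simp
    moreover have "0 \<le> (y - c) * ((b - a) / (d - c))" using assms y by (intro mult_nonneg_nonneg) auto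
    ultimately have "?t \<in> {a..<b}" by (simp del: times_divide_eq_right)
    moreover have "y = c + (?t - a) * ((d - c) / (b - a))" using assms by simp
    ultimately show "y \<in> (\<lambda>t. c + (t - a) * ((d - c) / (b - a))) ` {a..<b}" by blast
  qed
qed

lemma oiso_shift: "oiso (\<lambda>t. t + s) a b (a + s) (b + s)"
  unfolding oiso_def by (auto simp: strict_mono_on_def add.commute)

lemma oiso_glue:
  assumes E: "oiso E a b c d" and F: "oiso F b e d f" and "a \<le> b" "b \<le> e" "c \<le> d" "d \<le> f"
  shows "oiso (\<lambda>t. if t < b then E t else F t) a e c f" (is "oiso ?G a e c f")
proof -
  have "strict_mono_on {a..<e} ?G"
  proof (rule strict_mono_onI)
    fix s t assume st: "s \<in> {a..<e}" "t \<in> {a..<e}" "s < t"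
    show "?G s < ?G t"
    proof (cases "s < b \<and> b \<le> t")
      case True
      then have "E s \<in> {c..<d}" "F t \<in> {d..<f}" using E F st unfolding oiso_def by (metis atLeastLessThan_iff imageI)+
      then show ?thesis using True by simp
    next
      case False
      then show ?thesis using E F st unfolding oiso_def by (auto simp: strict_mono_on_def)
    qed
  qed
  moreover have "?G ` {a..<e} = E ` {a..<b} \<union> F ` {b..<e}" using assms(3,4) by (auto simp: image_iff)
  then have "?G ` {a..<e} = {c..<f}" using E F assms(5,6) unfolding oiso_def by auto
  ultimately show ?thesis by (simp add: oiso_def)
qed

definition periodic_ext :: "real \<Rightarrow> (real \<Rightarrow> real) \<Rightarrow> real \<Rightarrow> real" where
  "periodic_ext p E t = E (t - of_int \<lfloor>t - p\<rfloor>) + of_int \<lfloor>t - p\<rfloor>"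

lemma periodic_ext_eq:
  assumes "p \<le> t" "t < p + 1" shows "periodic_ext p E (t + of_int m) = E t + of_int m"
proof -
  have "\<lfloor>t + of_int m - p\<rfloor> = m" using assms by linarith
  then show ?thesis by (simp add: periodic_ext_def)
qed

lemma period_cases:
  fixes p t :: real obtains x m where "t = x + of_int m" "p \<le> x" "x < p + 1"
proof -
  have "t = (t - of_int \<lfloor>t - p\<rfloor>) + of_int \<lfloor>t - p\<rfloor>" by simp
  moreover have "p \<le> t - of_int \<lfloor>t - p\<rfloor>" "t - of_int \<lfloor>t - p\<rfloor> < p + 1" by linarith+
  ultimately show ?thesis using that by blast
qed

lemma homeo_periodic_ext:
  assumes "oiso E p (p + 1) p (p + 1)" shows "homeo (periodic_ext p E)"
proof -
  have range: "p \<le> E x \<and> E x < p + 1" if "p \<le> x" "x < p + 1" for x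
    using assms that unfolding oiso_def by (metis atLeastLessThan_iff imageI)
  have "periodic_ext p E s < periodic_ext p E t" if st: "s < t" for s t
  proof -
    obtain x m where x: "s = x + of_int m" "p \<le> x" "x < p + 1" by (rule period_cases)
    obtain y n where y: "t = y + of_int n" "p \<le> y" "y < p + 1" by (rule period_cases)
    have "m \<le> n" using x y st by linarith
    show ?thesis
    proof (cases "m = n")
      case True
      then have "E x < E y" using x y st assms unfolding oiso_def strict_mono_on_def by auto
      then show ?thesis using x y True by (simp add: periodic_ext_eq)
    next
      case False
      then have "of_int m + 1 \<le> (of_int n :: real)" using \<open>m \<le> n\<close> by linarith
      then show ?thesis using x y range[of x] range[of y] by (simp add: periodic_ext_eq)
    qed
  qed
  moreover have "surj (periodic_ext p E)"
    unfolding surj_def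
  proof
    fix y
    obtain z m where z: "y = z + of_int m" "p \<le> z" "z < p + 1" by (rule period_cases)
    then have "z \<in> E ` {p..<p + 1}" using assms unfolding oiso_def by auto
    then obtain x where x: "E x = z" "p \<le> x" "x < p + 1" by auto
    then show "\<exists>t. y = periodic_ext p E t" using z periodic_ext_eq[of p x E m] by (intro exI[of _ "x + of_int m"]) simp
  qed
  moreover have "periodic_ext p E (t + 1) = periodic_ext p E t + 1" for t
  proof -
    obtain x m where x: "t = x + of_int m" "p \<le> x" "x < p + 1" by (rule period_cases)
    have "t + 1 = x + of_int (m + 1)" using x by simp
    then show ?thesis using x periodic_ext_eq[of p x E "m + 1"] periodic_ext_eq[of p x E m] by (simp add: add.assoc)
  qed
  ultimately show ?thesis by (simp add: homeo_def strict_mono_def)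
qed

text \<open>All supports below are the translates of the arc from \<open>1/8\<close> to \<open>1\<close>.\<close>
definition push :: "(real \<Rightarrow> real) \<Rightarrow> bool" where
  "push h \<longleftrightarrow> homeo h \<and> (\<forall>t. t \<le> h t) \<and> (\<forall>t. h t = t \<longleftrightarrow> frac t \<le> 1 / 8)"

section \<open>Integer iterates and the orbit of the point 1/2\<close>

definition ipow :: "(real \<Rightarrow> real) \<Rightarrow> int \<Rightarrow> real \<Rightarrow> real" where
  "ipow h n = (if 0 \<le> n then h ^^ nat n else inv h ^^ nat (- n))"

lemma homeo_ipow: "homeo h \<Longrightarrow> homeo (ipow h n)"
  by (auto simp: ipow_def intro: homeo_funpow homeo_inv)

lemma ipow_0 [simp]: "ipow h 0 t = t"
  by (simp add: ipow_def)

lemma ipow_add1: assumes "homeo h" shows "ipow h (n + 1) t = h (ipow h n t)"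
proof (cases "0 \<le> n")
  case True
  then have "nat (n + 1) = Suc (nat n)" by simp
  then show ?thesis using True by (simp add: ipow_def)
next
  case False
  then have "nat (- n) = Suc (nat (- (n + 1)))" by simp
  then have "h (ipow h n t) = (inv h ^^ nat (- (n + 1))) t" using False assms by (simp add: ipow_def)
  moreover have "(inv h ^^ nat (- (n + 1))) t = ipow h (n + 1) t" using False by (auto simp: ipow_def)
  ultimately show ?thesis by simp
qed

lemma ipow_commute: assumes "homeo h" shows "ipow h n (h t) = h (ipow h n t)"
proof -
  have "(inv h ^^ k) (h t) = h ((inv h ^^ k) t)" for k
    by (induction k) (simp_all add: assms)
  then show ?thesis by (simp add: ipow_def funpow_swap1)
qed

lemma ipow_minus_cancel: assumes "homeo h" shows "ipow h n (ipow h (- n) t) = t"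
proof (induction n rule: int_induct[where k=0])
  case (step1 i)
  have "ipow h (- i) t = h (ipow h (- (i + 1)) t)" using ipow_add1[OF assms, of "- (i + 1)" t] by simp
  moreover have "ipow h (i + 1) s = ipow h i (h s)" for s
    using ipow_add1[OF assms] step1(1) by (simp add: ipow_def funpow_swap1 nat_add_distrib)
  ultimately show ?case using step1 by simp
next
  case (step2 i)
  have i: "nat (- (i - 1)) = Suc (nat (- i))" using step2(1) by simp
  have "ipow h (- (i - 1)) t = h (ipow h (- i) t)" using ipow_add1[OF assms, of "- i" t] by (simp add: algebra_simps)
  moreover have "ipow h (i - 1) (h s) = ipow h i s" for s
    using step2(1) i assms by (auto simp: ipow_def funpow_swap1)
  ultimately show ?case using step2 by simp
qed simp

text \<open>A coordinate on the arc in which h becomes x + 1: linear from [0,1) onto the fundamental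
  domain [1/2, h(1/2)), then carried along by the iterates of h.\<close>

definition orbit_map :: "(real \<Rightarrow> real) \<Rightarrow> real \<Rightarrow> real" where
  "orbit_map h x = ipow h \<lfloor>x\<rfloor> (1 / 2 + frac x * (h (1 / 2) - 1 / 2))"

context
  fixes h :: "real \<Rightarrow> real"
  assumes push: "push h"
begin

lemma homeo_push: "homeo h" using push by (simp add: push_def)

lemma push_arc: "1 / 8 < t \<Longrightarrow> t < 1 \<Longrightarrow> t < h t \<and> h t < 1 \<and> 1 / 8 < inv h t \<and> inv h t < t"
proof -
  assume t: "1 / 8 < t" "t < 1"
  have "frac t = t" using t by (simp add: frac_eq)
  then have "h t \<noteq> t" using push t by (simp add: push_def)
  then have lt: "t < h t" using push unfolding push_def by (metis order_le_imp_less_or_eq)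
  have "frac 1 \<le> (1 / 8 :: real)" "frac (1 / 8) \<le> (1 / 8 :: real)" by (simp_all add: frac_def)
  then have "h 1 = 1" "h (1 / 8) = 1 / 8" using push unfolding push_def by blast+
  then have "h t < 1" "h (1 / 8) < t" using homeo_less[OF homeo_push, of t 1] t by auto
  then have "h t < 1" "1 / 8 < inv h t"
    using homeo_less[OF homeo_push, of "1 / 8" "inv h t"] homeo_push by auto
  moreover have "h (inv h t) < h t" using lt homeo_push by simp
  ultimately show ?thesis using lt homeo_less[OF homeo_push] by blast
qed

lemma ipow_arc: "1 / 8 < t \<Longrightarrow> t < 1 \<Longrightarrow> 1 / 8 < ipow h n t \<and> ipow h n t < 1"
proof -
  have *: "1 / 8 < t \<Longrightarrow> t < 1 \<Longrightarrow> 1 / 8 < (h ^^ k) t \<and> (h ^^ k) t < 1" for k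
    by (induction k) (use push_arc in \<open>auto intro: less_trans\<close>)
  have "1 / 8 < t \<Longrightarrow> t < 1 \<Longrightarrow> 1 / 8 < (inv h ^^ k) t \<and> (inv h ^^ k) t < 1" for k
    by (induction k) (use push_arc in \<open>auto intro: less_trans\<close>)
  with * show "1 / 8 < t \<Longrightarrow> t < 1 \<Longrightarrow> 1 / 8 < ipow h n t \<and> ipow h n t < 1" by (auto simp: ipow_def)
qed

lemma ipow_mono:
  assumes t: "1 / 8 < t" "t < 1" and "m \<le> n" shows "ipow h m t \<le> ipow h n t"
  using assms(3)
proof (induction n rule: int_ge_induct[where k=m])
  case (step i)
  then show ?case using push_arc[of "ipow h i t"] ipow_arc[OF t, of i] ipow_add1[OF homeo_push, of i t] by auto
qed auto

text \<open>Were the orbit bounded inside the arc, its supremum L would be moved by h; an orbit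
  point beyond \<open>inv h L\<close> is sent beyond L.\<close>

lemma orbit_cofinal: assumes t: "1 / 8 < t" "t < 1" shows "\<exists>n. t < ipow h n (1 / 2)"
proof (rule ccontr)
  assume "\<not> ?thesis"
  then have le: "ipow h n (1 / 2) \<le> t" for n by (meson not_less)
  let ?A = "range (\<lambda>n. ipow h n (1 / 2))"
  have bdd: "bdd_above ?A" using le by (intro bdd_aboveI[of _ t]) auto
  define L where "L = Sup ?A"
  have up: "ipow h n (1 / 2) \<le> L" for n unfolding L_def by (rule cSup_upper[OF _ bdd]) simp
  have "L \<le> t" unfolding L_def by (rule cSup_least) (use le in auto)
  moreover have "1 / 8 < L" using up[of 0] by simp
  ultimately have "inv h L < L" using push_arc[of L] t by auto
  then obtain n where "inv h L < ipow h n (1 / 2)" unfolding L_def using less_cSup_iff[OF _ bdd] by auto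
  then have "h (inv h L) < h (ipow h n (1 / 2))" using homeo_push by (simp del: homeo_inv1)
  then have "L < ipow h (n + 1) (1 / 2)" using homeo_push by (simp add: ipow_add1)
  then show False using up[of "n + 1"] by simp
qed

lemma orbit_coinitial: assumes t: "1 / 8 < t" "t < 1" shows "\<exists>n. ipow h n (1 / 2) \<le> t"
proof (rule ccontr)
  assume "\<not> ?thesis"
  then have le: "t \<le> ipow h n (1 / 2)" for n by (meson not_le less_imp_le)
  let ?A = "range (\<lambda>n. ipow h n (1 / 2))"
  have bdd: "bdd_below ?A" using le by (intro bdd_belowI[of _ t]) auto
  define L where "L = Inf ?A"
  have up: "L \<le> ipow h n (1 / 2)" for n unfolding L_def by (rule cInf_lower[OF _ bdd]) simp
  have "t \<le> L" unfolding L_def by (rule cInf_greatest) (use le in auto)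
  moreover have "L < 1" using up[of 0] by simp
  ultimately have "L < h L" using push_arc[of L] t by auto
  then obtain n where "ipow h n (1 / 2) < h L" unfolding L_def using cInf_less_iff[OF _ bdd] by auto
  moreover have "ipow h n (1 / 2) = h (ipow h (n - 1) (1 / 2))"
    using ipow_add1[OF homeo_push, of "n - 1" "1 / 2"] by simp
  ultimately have "ipow h (n - 1) (1 / 2) < L" using homeo_push by simp
  then show False using up[of "n - 1"] by simp
qed

lemma orbit_map_bounds:
  "ipow h \<lfloor>x\<rfloor> (1 / 2) \<le> orbit_map h x" "orbit_map h x < ipow h (\<lfloor>x\<rfloor> + 1) (1 / 2)"
proof -
  let ?d = "h (1 / 2) - 1 / 2"
  have d: "0 < ?d" using push_arc[of "1 / 2"] by simp
  then show "ipow h \<lfloor>x\<rfloor> (1 / 2) \<le> orbit_map h x"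
    unfolding orbit_map_def using homeo_ipow[OF homeo_push] by simp
  have "frac x * ?d < 1 * ?d" by (intro mult_strict_right_mono d frac_lt_1)
  then have "ipow h \<lfloor>x\<rfloor> (1 / 2 + frac x * ?d) < ipow h \<lfloor>x\<rfloor> (h (1 / 2))"
    using homeo_ipow[OF homeo_push] by simp
  then show "orbit_map h x < ipow h (\<lfloor>x\<rfloor> + 1) (1 / 2)"
    by (simp add: orbit_map_def ipow_add1[OF homeo_push] ipow_commute[OF homeo_push])
qed

lemma orbit_map_less: assumes "x < y" shows "orbit_map h x < orbit_map h y"
proof (cases "\<lfloor>x\<rfloor> = \<lfloor>y\<rfloor>")
  case True
  then have "frac x < frac y" using assms by (simp add: frac_def)
  then have "frac x * (h (1 / 2) - 1 / 2) < frac y * (h (1 / 2) - 1 / 2)"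
    using push_arc[of "1 / 2"] by (intro mult_strict_right_mono) auto
  then show ?thesis unfolding orbit_map_def True using homeo_ipow[OF homeo_push] by simp
next
  case False
  then have "\<lfloor>x\<rfloor> + 1 \<le> \<lfloor>y\<rfloor>" using floor_mono[of x y] assms by linarith
  then have "ipow h (\<lfloor>x\<rfloor> + 1) (1 / 2) \<le> ipow h \<lfloor>y\<rfloor> (1 / 2)" by (intro ipow_mono) auto
  then show ?thesis using orbit_map_bounds[of x] orbit_map_bounds[of y] by linarith
qed

lemma orbit_map_add1: "orbit_map h (x + 1) = h (orbit_map h x)"
  by (simp add: orbit_map_def ipow_add1[OF homeo_push] frac_def)

lemma orbit_map_in_arc: "1 / 8 < orbit_map h x" "orbit_map h x < 1"
  using orbit_map_bounds[of x] ipow_arc[of "1 / 2" "\<lfloor>x\<rfloor>"] ipow_arc[of "1 / 2" "\<lfloor>x\<rfloor> + 1"] by linarith+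

text \<open>As the orbit leaves t on both sides, some iterate of the fundamental domain contains t;
  pulling back reaches the linear piece.\<close>

lemma orbit_map_surj: assumes t: "1 / 8 < t" "t < 1" shows "\<exists>x. orbit_map h x = t"
proof -
  obtain a where a: "ipow h a (1 / 2) \<le> t" using orbit_coinitial[OF t] by blast
  obtain b where b: "t < ipow h b (1 / 2)" using orbit_cofinal[OF t] by blast
  have "\<exists>n. ipow h n (1 / 2) \<le> t \<and> t < ipow h (n + 1) (1 / 2)"
  proof (rule ccontr)
    assume *: "\<not> ?thesis"
    have "ipow h n (1 / 2) \<le> t" if "a \<le> n" for n using that
      by (induction n rule: int_ge_induct) (use a * in \<open>auto simp: not_less\<close>)
    moreover have "ipow h b (1 / 2) \<le> ipow h (max a b) (1 / 2)" by (intro ipow_mono) auto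
    ultimately show False using b by (metis max.cobounded1 not_less order_trans)
  qed
  then obtain n where n: "ipow h n (1 / 2) \<le> t" "t < ipow h (n + 1) (1 / 2)" by blast
  define s where "s = ipow h (- n) t"
  have s: "ipow h n s = t" unfolding s_def by (rule ipow_minus_cancel[OF homeo_push])
  have "1 / 2 \<le> s" using n(1) homeo_le[OF homeo_ipow[OF homeo_push], of n "1 / 2" s] s by simp
  moreover have "s < h (1 / 2)"
  proof -
    obtain r where r: "h r = s" using homeo_inv1[OF homeo_push] by blast
    have "ipow h n (h r) = h (ipow h n r)" by (rule ipow_commute[OF homeo_push])
    then have "h (ipow h n r) < h (ipow h n (1 / 2))" using n(2) s r by (simp add: ipow_add1[OF homeo_push])
    then have "r < 1 / 2" using homeo_push homeo_ipow[OF homeo_push] by simp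
    then show ?thesis using r homeo_less[OF homeo_push] by blast
  qed
  moreover define q where "q = (s - 1 / 2) / (h (1 / 2) - 1 / 2)"
  have d: "0 < h (1 / 2) - 1 / 2" using push_arc[of "1 / 2"] by simp
  ultimately have q: "0 \<le> q" "q < 1" "1 / 2 + q * (h (1 / 2) - 1 / 2) = s" by (simp_all add: q_def)
  then have "orbit_map h (q + of_int n) = t" 
  proof -
    have "\<lfloor>q + of_int n\<rfloor> = n" using q by linarith
    then show ?thesis using s q by (simp add: orbit_map_def frac_def)
  qed
  then show ?thesis ..
qed
end

text \<open>In their orbit coordinates both maps are the unit translation, so passing from one
  coordinate to the other conjugates them. On the common fixed arc the identity does.\<close>

lemma push_conjugate:
  assumes f: "push f" and h: "push h"
  obtains c where "homeo c" "\<And>t. c (f t) = h (c t)" "\<And>t. frac t \<le> 1 / 8 \<Longrightarrow> c t = t"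
proof -
  define E where "E t = (if t \<le> 1 / 8 then t else orbit_map h (SOME x. orbit_map f x = t))" for t
  have E: "E (orbit_map f x) = orbit_map h x" for x
  proof -
    have "(SOME y. orbit_map f y = orbit_map f x) = x"
      by (rule some_equality) (metis orbit_map_less[OF f] linorder_neqE less_irrefl)+
    then show ?thesis using orbit_map_in_arc[OF f, of x] by (simp add: E_def)
  qed
  have "oiso E 0 (0 + 1) 0 (0 + 1)" unfolding oiso_def
  proof
    show "strict_mono_on {0..<0 + 1} E"
    proof (rule strict_mono_onI)
      fix s t :: real assume st: "s \<in> {0..<0 + 1}" "t \<in> {0..<0 + 1}" "s < t"
      show "E s < E t"
      proof (cases "t \<le> 1 / 8")
        case True
        then show ?thesis using st by (simp add: E_def)
      next
        case False
        then obtain y where y: "t = orbit_map f y" using orbit_map_surj[OF f, of t] st by auto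
        show ?thesis
        proof (cases "s \<le> 1 / 8")
          case True
          then have "E s = s" by (simp add: E_def)
          then show ?thesis using True orbit_map_in_arc[OF h, of y] unfolding y E by simp
        next
          case False
          then obtain x where x: "s = orbit_map f x" using orbit_map_surj[OF f, of s] st by auto
          have "x < y" using orbit_map_less[OF f, of y x] st(3) unfolding x y by (metis less_asym linorder_neqE)
          then show ?thesis unfolding x y E by (rule orbit_map_less[OF h])
        qed
      qed
    qed
    show "E ` {0..<0 + 1} = {0..<0 + 1}"
    proof (intro equalityI subsetI)
      fix y assume "y \<in> E ` {0..<0 + 1}"
      then obtain t where t: "y = E t" "0 \<le> t" "t < 1" by auto
      then show "y \<in> {0..<0 + 1}"
        using orbit_map_in_arc[OF h, of "SOME x. orbit_map f x = t"] by (auto simp: E_def)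
    next
      fix y :: real assume y: "y \<in> {0..<0 + 1}"
      show "y \<in> E ` {0..<0 + 1}"
      proof (cases "y \<le> 1 / 8")
        case True
        then show ?thesis using y by (intro image_eqI[of _ _ y]) (auto simp: E_def)
      next
        case False
        then obtain x where "y = orbit_map h x" using orbit_map_surj[OF h, of y] y by auto
        then show ?thesis using orbit_map_in_arc[OF f, of x] E by (intro image_eqI[of _ _ "orbit_map f x"]) auto
      qed
    qed
  qed
  then have c: "homeo (periodic_ext 0 E)" by (rule homeo_periodic_ext)
  let ?c = "periodic_ext 0 E"
  have fix_eq: "?c t = t" if "frac t \<le> 1 / 8" for t
    using that periodic_ext_eq[of 0 "frac t" E "\<lfloor>t\<rfloor>"] frac_lt_1[of t] by (simp add: E_def frac_def)
  have "?c (f t) = h (?c t)" for t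
  proof (cases "frac t \<le> 1 / 8")
    case True
    then have "f t = t" "h t = t" using f h unfolding push_def by blast+
    then show ?thesis using fix_eq[OF True] by simp
  next
    case False
    then have "1 / 8 < frac t" by (simp only: not_le)
    then obtain x where x: "frac t = orbit_map f x" using orbit_map_surj[OF f _ frac_lt_1] by metis
    then have t: "t = orbit_map f x + of_int \<lfloor>t\<rfloor>" by (simp add: frac_def)
    have ev: "?c (orbit_map f y + of_int \<lfloor>t\<rfloor>) = orbit_map h y + of_int \<lfloor>t\<rfloor>" for y
      using periodic_ext_eq[of 0 "orbit_map f y" E] orbit_map_in_arc[OF f, of y] E by simp
    have "f t = orbit_map f (x + 1) + of_int \<lfloor>t\<rfloor>"
      by (subst t) (simp add: homeo_push[OF f] orbit_map_add1[OF f])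
    then have "?c (f t) = orbit_map h (x + 1) + of_int \<lfloor>t\<rfloor>" by (simp only: ev)
    moreover have "?c t = orbit_map h x + of_int \<lfloor>t\<rfloor>" by (subst t) (rule ev)
    ultimately show ?thesis by (simp add: homeo_push[OF h] orbit_map_add1[OF h])
  qed
  then show ?thesis using that[OF c] fix_eq by blast
qed

text \<open>Monotonicity needs no convexity of the supports: if \<open>s < t\<close> with \<open>s\<close> in \<open>S i\<close> and \<open>t\<close> in \<open>S j\<close>, then
  \<open>F i s < F i t = t\<close>, and \<open>F j\<close> fixes \<open>F i s\<close>.\<close>
lemma disjoint_union_homeo:
  fixes F :: "nat \<Rightarrow> real \<Rightarrow> real"
  assumes homeo: "\<And>j. homeo (F j)"
    and supp: "\<And>j t. t \<notin> S j \<Longrightarrow> F j t = t"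
    and disj: "\<And>i j t. t \<in> S i \<Longrightarrow> t \<in> S j \<Longrightarrow> i = j"
    and per: "\<And>j t. t + 1 \<in> S j \<longleftrightarrow> t \<in> S j"
  obtains B where "homeo B" "\<And>j t. t \<in> S j \<Longrightarrow> B t = F j t"
proof -
  define U where "U G t = (if \<exists>j. t \<in> S j then G (THE j. t \<in> S j) t else t)" for G :: "nat \<Rightarrow> real \<Rightarrow> real" and t
  have U: "U G t = G j t" if "t \<in> S j" for G j t
  proof -
    have "(THE j. t \<in> S j) = j" using that disj by blast
    then show ?thesis using that by (auto simp: U_def)
  qed
  have U': "U G t = t" if "\<And>j. t \<notin> S j" for G t using that by (auto simp: U_def)
  have inS: "F j t \<in> S j" if "t \<in> S j" for j t
    using that supp[of "F j t" j] homeo_eq[OF homeo[of j], of "F j t" t] by metis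
  have supp_inv: "t \<notin> S j \<Longrightarrow> inv (F j) t = t" for j t using supp homeo_inv2[OF homeo] by metis
  have inS_inv: "inv (F j) t \<in> S j" if "t \<in> S j" for j t
    using that supp[of "inv (F j) t" j] homeo_inv1[OF homeo, of j t] by metis
  have "U F s < U F t" if st: "s < t" for s t
  proof (cases "\<exists>i. s \<in> S i")
    case True
    then obtain i where i: "s \<in> S i" by blast
    show ?thesis
    proof (cases "\<exists>j. t \<in> S j \<and> j \<noteq> i")
      case True
      then obtain j where j: "t \<in> S j" "j \<noteq> i" by blast
      then have "F i s < F i t" "F i t = t" using homeo_less[OF homeo] st supp[of t i] disj by blast+
      then have "F j (F i s) < F j t" using homeo_less[OF homeo] by simp
      moreover have "F j (F i s) = F i s" using supp[of "F i s" j] inS[OF i] disj j by blast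
      ultimately show ?thesis using U i j by simp
    next
      case False
      then have "U F t = F i t" using U U' supp by metis
      then show ?thesis using U[OF i] homeo_less[OF homeo] st by simp
    qed
  next
    case False
    then have s: "U F s = s" using U' by blast
    show ?thesis
    proof (cases "\<exists>j. t \<in> S j")
      case True
      then obtain j where j: "t \<in> S j" by blast
      have "F j s < F j t" using homeo_less[OF homeo] st by simp
      then show ?thesis using s U[OF j] supp[of s j] False by simp
    next
      case False
      then show ?thesis using s st U' by simp
    qed
  qed
  moreover have "surj (U F)"
  proof (rule surjI[of _ "U (\<lambda>j. inv (F j))"])
    fix t
    show "U F (U (\<lambda>j. inv (F j)) t) = t"
    proof (cases "\<exists>j. t \<in> S j")
      case True
      then obtain j where j: "t \<in> S j" by blast
      then show ?thesis using U[OF j] U[OF inS_inv[OF j]] homeo_inv1[OF homeo] by simp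
    next
      case False
      then show ?thesis using U' by simp
    qed
  qed
  moreover have "U F (t + 1) = U F t + 1" for t
  proof (cases "\<exists>j. t \<in> S j")
    case True
    then obtain j where j: "t \<in> S j" by blast
    then show ?thesis using U per homeo_add1[OF homeo] by simp
  next
    case False
    then show ?thesis using U' per by simp
  qed
  ultimately have "homeo (U F)" by (simp add: homeo_def strict_mono_def)
  then show ?thesis using that U by blast
qed

abbreviation lin :: "real \<Rightarrow> real \<Rightarrow> real \<Rightarrow> real \<Rightarrow> real \<Rightarrow> real" where
  "lin a b c d \<equiv> \<lambda>t. c + (t - a) * ((d - c) / (b - a))"

section \<open>Translations as products of two conjugates\<close>

text \<open>Brings a map whose fixed arc has been moved and shrunk by y back to the standard fixed
  arc.\<close>

lemma push_scale:
  assumes y: "homeo y" and F: "homeo F" "\<And>t. t \<le> F t"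
    and fix_iff: "\<And>t. F t = t \<longleftrightarrow> (\<exists>m::int. y 0 + of_int m \<le> t \<and> t \<le> y (1 / 8) + of_int m)"
  shows "push (inv y \<circ> F \<circ> y)"
  unfolding push_def
proof (intro conjI allI)
  show "homeo (inv y \<circ> F \<circ> y)" by (intro homeo_comp homeo_inv y F)
  show "t \<le> (inv y \<circ> F \<circ> y) t" for t
    using homeo_le[OF homeo_inv[OF y], of "y t" "F (y t)"] F(2) y by simp
  fix t
  have "(inv y \<circ> F \<circ> y) t = t \<longleftrightarrow> F (y t) = y t"
    using y by (metis comp_apply homeo_inv1 homeo_inv2)
  also have "\<dots> \<longleftrightarrow> (\<exists>m::int. y (0 + of_int m) \<le> y t \<and> y t \<le> y (1 / 8 + of_int m))"
    unfolding fix_iff homeo_add_int[OF y] ..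
  also have "\<dots> \<longleftrightarrow> (\<exists>m::int. of_int m \<le> t \<and> t \<le> 1 / 8 + of_int m)"
    using y by (simp del: homeo_add_int)
  also have "\<dots> \<longleftrightarrow> frac t \<le> 1 / 8"
  proof
    assume "\<exists>m::int. of_int m \<le> t \<and> t \<le> 1 / 8 + of_int m"
    then obtain m :: int where m: "of_int m \<le> t" "t \<le> 1 / 8 + of_int m" by blast
    then have "\<lfloor>t\<rfloor> = m" by linarith
    then show "frac t \<le> 1 / 8" using m by (simp add: frac_def)
  next
    assume "frac t \<le> 1 / 8"
    then show "\<exists>m::int. of_int m \<le> t \<and> t \<le> 1 / 8 + of_int m"
      by (intro exI[of _ "\<lfloor>t\<rfloor>"]) (auto simp: frac_def)
  qed
  finally show "(inv y \<circ> F \<circ> y) t = t \<longleftrightarrow> frac t \<le> 1 / 8" .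
qed

text \<open>On one arc \<open>f2\<close> agrees with the translation; its image is the arc fixed by
  \<open>f1 = T f2\<^sup>-\<^sup>1\<close>, where \<open>T\<close> is the translation.\<close>
lemma translation_split:
  fixes s \<eta> :: real
  assumes "0 < s" "0 < \<eta>" "3 * \<eta> < 1 - s"
  shows "\<exists>f1 f2. homeo f1 \<and> homeo f2 \<and> (\<forall>t. f1 (f2 t) = t + s) \<and> (\<forall>t. t \<le> f1 t) \<and> (\<forall>t. t \<le> f2 t) \<and>
    (\<forall>t. f2 t = t \<longleftrightarrow> (\<exists>m::int. of_int m \<le> t \<and> t \<le> \<eta> + of_int m)) \<and>
    (\<forall>t. f1 t = t \<longleftrightarrow> (\<exists>m::int. of_int m - 2 * \<eta> \<le> t \<and> t \<le> of_int m - \<eta>))"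
proof -
  define A where "A = lin \<eta> (1 - s - 2 * \<eta>) \<eta> (1 - 2 * \<eta>)"
  define B where "B = lin (1 - s - \<eta>) 1 (1 - \<eta>) 1"
  \<comment> \<open>The third piece is the shift by s onto [1 - 2 \<eta>, 1 - \<eta>). The bound
    \<open>3 * \<eta> < 1 - s\<close> makes the second piece non-empty.\<close>
  define E where "E t = (if t < \<eta> then t + 0 else if t < 1 - s - 2 * \<eta> then A t
      else if t < 1 - s - \<eta> then t + s else B t)" for t
  have S: "oiso (\<lambda>t. t + s) (1 - s - 2 * \<eta>) (1 - s - \<eta>) (1 - 2 * \<eta>) (1 - \<eta>)"
    using oiso_shift[of s "1 - s - 2 * \<eta>" "1 - s - \<eta>"] by simp
  have O: "oiso (\<lambda>t. t + 0) 0 \<eta> 0 \<eta>" using oiso_shift[of 0 0 \<eta>] by simp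
  have "oiso E 0 1 0 1"
    unfolding E_def A_def B_def
    by (rule oiso_glue[OF O oiso_glue[OF oiso_linear oiso_glue[OF S oiso_linear]]]) (use assms in auto)
  then have F: "homeo (periodic_ext 0 E)" by (intro homeo_periodic_ext) simp
  define f2 where "f2 = periodic_ext 0 E"
  have f2: "f2 (x + of_int m) = E x + of_int m" if "0 \<le> x" "x < 1" for x m
    unfolding f2_def using that periodic_ext_eq[of 0 x] by simp
  \<comment> \<open>The graph of E runs between the identity and the shift by s: contact with the
    former gives the fixed points of f2, contact with the latter those of f1.\<close>
  have E: "x \<le> E x \<and> E x \<le> x + s \<and> (E x = x \<longleftrightarrow> x \<le> \<eta>) \<and>
      (E x = x + s \<longleftrightarrow> 1 - s - 2 * \<eta> \<le> x \<and> x \<le> 1 - s - \<eta>)" if x: "0 \<le> x" "x < 1" for x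
  proof -
    consider "x < \<eta>" | "\<eta> \<le> x" "x < 1 - s - 2 * \<eta>" | "1 - s - 2 * \<eta> \<le> x" "x < 1 - s - \<eta>" | "1 - s - \<eta> \<le> x"
      by linarith
    then show ?thesis
    proof cases
      case 1
      then show ?thesis using assms by (simp add: E_def)
    next
      case 2
      have D: "0 < 1 - s - 2 * \<eta> - \<eta>" using assms by simp
      have "A x = x + (x - \<eta>) * (s / (1 - s - 2 * \<eta> - \<eta>))"
        using D by (simp add: A_def field_simps)
      moreover have "0 \<le> (x - \<eta>) * (s / (1 - s - 2 * \<eta> - \<eta>))" using 2 D assms by simp
      moreover have "(x - \<eta>) * (s / (1 - s - 2 * \<eta> - \<eta>)) < s" using 2 D assms by (simp add: pos_divide_less_eq)
      moreover have "(x - \<eta>) * (s / (1 - s - 2 * \<eta> - \<eta>)) = 0 \<longleftrightarrow> x = \<eta>" using D assms by auto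
      ultimately show ?thesis using 2 by (auto simp: E_def)
    next
      case 3
      then show ?thesis using assms by (simp add: E_def)
    next
      case 4
      have D: "0 < s + \<eta>" using assms by simp
      have "B x = x + s - (x - (1 - s - \<eta>)) * (s / (s + \<eta>))"
        using D by (simp add: B_def field_simps)
      moreover have "0 \<le> (x - (1 - s - \<eta>)) * (s / (s + \<eta>))" using 4 D assms by simp
      moreover have "(x - (1 - s - \<eta>)) * (s / (s + \<eta>)) < s" using x 4 D assms by (simp add: pos_divide_less_eq)
      moreover have "(x - (1 - s - \<eta>)) * (s / (s + \<eta>)) = 0 \<longleftrightarrow> x = 1 - s - \<eta>" using D assms by auto
      ultimately show ?thesis using 4 assms by (auto simp: E_def)
    qed
  qed
  have between: "t \<le> f2 t \<and> f2 t \<le> t + s" for t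
  proof -
    obtain x m where "t = x + of_int m" "0 \<le> x" "x < 0 + 1" by (rule period_cases)
    then show ?thesis using f2[of x m] E[of x] by simp
  qed
  have fix2: "f2 t = t \<longleftrightarrow> (\<exists>m::int. of_int m \<le> t \<and> t \<le> \<eta> + of_int m)" for t
  proof -
    obtain x n where x: "t = x + of_int n" "0 \<le> x" "x < 0 + 1" by (rule period_cases)
    have "m = n" if "of_int m \<le> t" "t \<le> \<eta> + of_int m" for m using that x assms by linarith
    then have "(\<exists>m::int. of_int m \<le> t \<and> t \<le> \<eta> + of_int m) \<longleftrightarrow> of_int n \<le> t \<and> t \<le> \<eta> + of_int n" by blast
    also have "\<dots> \<longleftrightarrow> x \<le> \<eta>" using x by auto
    finally have "(\<exists>m::int. of_int m \<le> t \<and> t \<le> \<eta> + of_int m) \<longleftrightarrow> x \<le> \<eta>" .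
    then show ?thesis using x f2[of x n] E[of x] by simp
  qed
  have trans2: "f2 t = t + s \<longleftrightarrow> (\<exists>m::int. 1 - s - 2 * \<eta> + of_int m \<le> t \<and> t \<le> 1 - s - \<eta> + of_int m)" for t
  proof -
    obtain x n where x: "t = x + of_int n" "0 \<le> x" "x < 0 + 1" by (rule period_cases)
    have "m = n" if "1 - s - 2 * \<eta> + of_int m \<le> t" "t \<le> 1 - s - \<eta> + of_int m" for m using that x assms by linarith
    then have "(\<exists>m::int. 1 - s - 2 * \<eta> + of_int m \<le> t \<and> t \<le> 1 - s - \<eta> + of_int m) \<longleftrightarrow>
        1 - s - 2 * \<eta> + of_int n \<le> t \<and> t \<le> 1 - s - \<eta> + of_int n" by blast
    also have "\<dots> \<longleftrightarrow> 1 - s - 2 * \<eta> \<le> x \<and> x \<le> 1 - s - \<eta>" using x by auto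
    finally have "(\<exists>m::int. 1 - s - 2 * \<eta> + of_int m \<le> t \<and> t \<le> 1 - s - \<eta> + of_int m) \<longleftrightarrow>
        1 - s - 2 * \<eta> \<le> x \<and> x \<le> 1 - s - \<eta>" .
    then show ?thesis using x f2[of x n] E[of x] by simp
  qed
  have h2: "homeo f2" using F by (simp add: f2_def)
  define f1 where "f1 = (\<lambda>t. t + s) \<circ> inv f2"
  have h1: "homeo f1" unfolding f1_def by (intro homeo_comp homeo_translation homeo_inv h2)
  have comp: "f1 (f2 t) = t + s" for t using h2 by (simp add: f1_def)
  have ge1: "t \<le> f1 t" for t using between[of "inv f2 t"] h2 by (simp add: f1_def)
  have fix1: "f1 t = t \<longleftrightarrow> (\<exists>m::int. of_int m - 2 * \<eta> \<le> t \<and> t \<le> of_int m - \<eta>)" for t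
  proof -
    have "f1 t = t \<longleftrightarrow> inv f2 t = t - s" by (auto simp: f1_def)
    also have "\<dots> \<longleftrightarrow> f2 (t - s) = t - s + s" using h2 by (metis diff_add_cancel homeo_inv1 homeo_inv2)
    also have "\<dots> \<longleftrightarrow> (\<exists>m::int. of_int (m + 1) - 2 * \<eta> \<le> t \<and> t \<le> of_int (m + 1) - \<eta>)"
      unfolding trans2 by (simp add: algebra_simps)
    also have "\<dots> \<longleftrightarrow> (\<exists>m::int. of_int m - 2 * \<eta> \<le> t \<and> t \<le> of_int m - \<eta>)"
      by (metis diff_add_cancel)
    finally show ?thesis .
  qed
  show ?thesis
    by (intro exI[of _ f1] exI[of _ f2] conjI allI h1 h2 comp ge1 fix2 fix1) (use between in simp)
qed

lemma push_exists: obtains f where "push f"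
proof -
  \<comment> \<open>With \<eta> = 1/8 the second factor already has the standard fixed arc, and 3/8
    < 1/2 is admissible.\<close>
  obtain f2 :: "real \<Rightarrow> real" where f: "homeo f2" "\<forall>t. t \<le> f2 t"
    "\<forall>t. f2 t = t \<longleftrightarrow> (\<exists>m::int. of_int m \<le> t \<and> t \<le> 1 / 8 + of_int m)"
    using translation_split[of "1 / 2" "1 / 8"] by auto
  have "push (inv id \<circ> f2 \<circ> id)" by (rule push_scale) (use f in auto)
  then show ?thesis by (rule that)
qed

text \<open>The i-th iterate takes [0, 1/8] and [-1/4, -1/8] to [0, \<eta>] and [-2 \<eta>, -\<eta>]
  with \<eta> = 1/8 / 2^i, the two fixed arcs in \<open>translation_split\<close>.\<close>

lemma homeo_contraction: "\<exists>k. homeo k \<and> (\<forall>t. - (1 / 4) \<le> t \<and> t \<le> 1 / 8 \<longrightarrow> k t = t / 2)"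
proof -
  define E where "E t = (if t < - (1 / 4) then lin (- (1 / 2)) (- (1 / 4)) (- (1 / 2)) (- (1 / 8)) t
     else if t < 1 / 4 then lin (- (1 / 4)) (1 / 4) (- (1 / 8)) (1 / 8) t else lin (1 / 4) (1 / 2) (1 / 8) (1 / 2) t)" for t
  have "oiso E (- (1 / 2)) (1 / 2) (- (1 / 2)) (1 / 2)"
    unfolding E_def by (rule oiso_glue[OF oiso_linear oiso_glue[OF oiso_linear oiso_linear]]) auto
  then have "homeo (periodic_ext (- (1 / 2)) E)" by (intro homeo_periodic_ext) simp
  moreover have "periodic_ext (- (1 / 2)) E t = t / 2" if "- (1 / 4) \<le> t" "t \<le> 1 / 8" for t
    using periodic_ext_eq[of "- (1 / 2)" t E 0] that by (simp add: E_def field_simps)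
  ultimately show ?thesis by blast
qed

text \<open>Modulo 1 the arc (1/8, 1) goes into (0, 1/16), part of the fixed arc. The image (1,
  17/16) lies in the interval of the hypothesis, so all further iterates stay in it.\<close>

lemma homeo_displacing:
  "\<exists>\<sigma>. homeo \<sigma> \<and> (\<forall>t. 1 / 8 < t \<and> t < 17 / 16 \<longrightarrow> 1 < \<sigma> t \<and> \<sigma> t < 17 / 16)"
proof -
  define E where "E t = (if t < 1 / 8 then lin (1 / 16) (1 / 8) (1 / 16) 1 t else lin (1 / 8) (17 / 16) 1 (17 / 16) t)" for t
  have "oiso E (1 / 16) (17 / 16) (1 / 16) (17 / 16)"
    unfolding E_def by (rule oiso_glue[OF oiso_linear oiso_linear]) auto
  then have h: "homeo (periodic_ext (1 / 16) E)" (is "homeo ?s") by (intro homeo_periodic_ext) simp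
  have "?s (1 / 8) = 1" "?s (1 / 16 + of_int 1) = 17 / 16"
    using periodic_ext_eq[of "1 / 16" "1 / 8" E 0] periodic_ext_eq[of "1 / 16" "1 / 16" E 1] by (simp_all add: E_def)
  then have "1 < ?s t \<and> ?s t < 17 / 16" if "1 / 8 < t" "t < 17 / 16" for t
    using homeo_less[OF h, of "1 / 8" t] homeo_less[OF h, of t "17 / 16"] that by simp
  with h show ?thesis by blast
qed

text \<open>The conjugate \<open>\<sigma>\<^sup>-\<^sup>j \<beta> \<sigma>\<^sup>j\<close> acts on the support of \<open>f\<close> as \<open>c\<^sub>j\<close>; what it does elsewhere is
  invisible to \<open>f\<close>. Thus two maps suffice to conjugate \<open>f\<close> to all members of a sequence.\<close>
lemma universal_conjugators:
  assumes f: "push f" and P: "\<And>j. push (P j)"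
  shows "\<exists>\<sigma> \<beta>. homeo \<sigma> \<and> homeo \<beta> \<and>
    (\<forall>j t. P j (inv (\<sigma> ^^ j) (\<beta> ((\<sigma> ^^ j) t))) = inv (\<sigma> ^^ j) (\<beta> ((\<sigma> ^^ j) (f t))))"
proof -
  obtain \<sigma> where \<sigma>: "homeo \<sigma>" "\<And>t. 1 / 8 < t \<Longrightarrow> t < 17 / 16 \<Longrightarrow> 1 < \<sigma> t \<and> \<sigma> t < 17 / 16"
    using homeo_displacing by blast
  have "\<exists>c. homeo c \<and> (\<forall>t. c (f t) = P j (c t)) \<and> (\<forall>t. frac t \<le> 1 / 8 \<longrightarrow> c t = t)" for j
    using push_conjugate[OF f P[of j]] by metis
  then obtain c where c: "\<And>j. homeo (c j)" "\<And>j t. c j (f t) = P j (c j t)"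
      "\<And>j t. frac t \<le> 1 / 8 \<Longrightarrow> c j t = t" by metis
  define S :: "real set" where "S = {t. 1 / 8 < frac t}"
  define I where "I j = \<sigma> ^^ j" for j
  have I: "homeo (I j)" for j unfolding I_def by (rule homeo_funpow[OF \<sigma>(1)])
  have disp: "I (Suc d) t \<notin> S" if "t \<in> S" for d t
  proof -
    define x where "x = frac t"
    have x: "1 / 8 < x" "x < 1" "t = x + of_int \<lfloor>t\<rfloor>"
      using that frac_lt_1[of t] by (simp_all add: x_def S_def) (simp add: frac_def)
    have "1 < (\<sigma> ^^ Suc d) x \<and> (\<sigma> ^^ Suc d) x < 17 / 16"
      by (induction d) (use \<sigma>(2) x in auto)
    then have b: "1 < I (Suc d) x" "I (Suc d) x < 17 / 16" by (simp_all add: I_def del: funpow.simps)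
    have "I (Suc d) t = I (Suc d) x + of_int \<lfloor>t\<rfloor>" using homeo_add_int[OF I] x(3) by metis
    then have "\<lfloor>I (Suc d) t\<rfloor> = 1 + \<lfloor>t\<rfloor>" using b by linarith
    then have "frac (I (Suc d) t) = I (Suc d) x - 1" using \<open>I (Suc d) t = _\<close> by (simp add: frac_def)
    then show ?thesis using b by (simp add: S_def)
  qed
  \<comment> \<open>The j-th conjugator is carried out on \<open>SS j\<close>, the image of the
    support under \<sigma>^j.\<close>
  define F where "F j = I j \<circ> c j \<circ> inv (I j)" for j
  define SS where "SS j = {t. inv (I j) t \<in> S}" for j
  obtain \<beta> where \<beta>: "homeo \<beta>" "\<And>j t. t \<in> SS j \<Longrightarrow> \<beta> t = F j t"
  proof (rule disjoint_union_homeo[of F SS])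
    show "homeo (F j)" for j unfolding F_def by (intro homeo_comp homeo_inv I c)
    show "F j t = t" if "t \<notin> SS j" for j t
      using that c(3)[of "inv (I j) t" j] I by (auto simp: F_def SS_def S_def not_less)
    have S_shift: "t + 1 \<in> S \<longleftrightarrow> t \<in> S" for t by (simp add: S_def frac_def)
    show "t + 1 \<in> SS j \<longleftrightarrow> t \<in> SS j" for j t
      using S_shift homeo_add1[OF homeo_inv[OF I]] by (simp add: SS_def)
    \<comment> \<open>A common point would yield a point of S that a positive iterate of \<sigma>
      returns to S.\<close>
    have less: False if ij: "t \<in> SS i" "t \<in> SS j" "i < j" for i j t
    proof -
      obtain d where d: "j = Suc d + i" using less_imp_Suc_add[OF ij(3)] by (auto simp: add.commute)
      have "I j s = I i (I (Suc d) s)" for s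
        unfolding I_def d by (subst add.commute, subst funpow_add) simp
      then have "inv (I i) t = I (Suc d) (inv (I j) t)" using I homeo_inv1[OF I, of j t] homeo_inv2[OF I, of i] by metis
      then show False using disp[of "inv (I j) t" d] ij by (simp add: SS_def)
    qed
    show "i = j" if "t \<in> SS i" "t \<in> SS j" for i j t
      using less that by (metis linorder_neqE_nat)
  qed (use that in blast)
  define A where "A j t = inv (I j) (\<beta> (I j t))" for j t
  have A_S: "A j t = c j t" if "t \<in> S" for j t
  proof -
    have "I j t \<in> SS j" using that I by (simp add: SS_def)
    then show ?thesis using \<beta>(2) I by (simp add: A_def F_def)
  qed
  have A_inj: "A j s = A j t \<Longrightarrow> s = t" for j s t
    unfolding A_def using I homeo_inv[OF I] \<beta>(1) by simp
  have c_S: "c j t \<in> S" if "t \<in> S" for j t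
  proof (rule ccontr)
    assume "c j t \<notin> S"
    then have "c j (c j t) = c j t" using c(3) by (simp add: S_def)
    then have "c j t = t" using c(1) by simp
    then show False using \<open>c j t \<notin> S\<close> that by simp
  qed
  have f_fix: "f t = t" "P j t = t" if "t \<notin> S" for j t
    using that f P[of j] by (auto simp: push_def S_def)
  have "P j (A j t) = A j (f t)" for j t
  proof (cases "t \<in> S")
    case True
    have "f t \<in> S"
    proof (rule ccontr)
      assume "f t \<notin> S"
      then have "f (f t) = f t" by (rule f_fix)
      then have "f t = t" using homeo_eq[OF homeo_push[OF f]] by blast
      then show False using \<open>f t \<notin> S\<close> True by simp
    qed
    then show ?thesis using A_S True c(2) by simp
  next
    case False
    \<comment> \<open>\<open>c j\<close> maps S onto itself and \<open>A j\<close> agrees with it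
      there, so by injectivity \<open>A j\<close> keeps the complement, on which \<open>P j\<close>
      and f are the identity.\<close>
    have "A j t \<notin> S"
    proof
      assume *: "A j t \<in> S"
      define r where "r = inv (c j) (A j t)"
      have r: "c j r = A j t" unfolding r_def using c(1) by simp
      have "r \<in> S"
      proof (rule ccontr)
        assume "r \<notin> S"
        then have "c j r = r" using c(3) by (simp add: S_def)
        then show False using r * \<open>r \<notin> S\<close> by simp
      qed
      then have "A j r = A j t" using A_S r by simp
      then show False using A_inj \<open>r \<in> S\<close> False by blast
    qed
    then show ?thesis using f_fix False by simp
  qed
  then show ?thesis unfolding A_def I_def using \<sigma>(1) \<beta>(1) by blast
qed

section \<open>A group with prescribed stable commutator length\<close>

text \<open>The generators \<open>g\<close>, \<open>k\<close>, \<open>r\<close>, \<open>\<sigma>\<close>, \<open>\<beta>\<close>, \<open>f\<close>, \<open>a\<close> have the letters 0, 2, 4, 6, 8, 10, 12. In the action,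
  \<open>r\<close> moves the arc fixed by \<open>f\<close> to a nearby one, and \<open>k\<^sup>i\<close> shrinks the two arcs until they fit
  into the gap required by \<open>translation_split\<close>.\<close>
definition conj_word :: "nat \<Rightarrow> nat list" where
  "conj_word j = winv (wpow [6] j) @ [8] @ wpow [6] j"

definition left_word :: "nat \<Rightarrow> nat list" where
  "left_word i = wpow [2] i @ [4] @ conj_word (2 * i + 1)"

definition right_word :: "nat \<Rightarrow> nat list" where
  "right_word i = wpow [2] i @ conj_word (2 * i)"

definition root_word :: "nat \<Rightarrow> nat list" where
  "root_word i = (left_word i @ [10] @ winv (left_word i)) @ (right_word i @ [10] @ winv (right_word i))"

definition square_rel :: "nat list" where
  "square_rel = ([12] @ [10] @ winv [12]) @ winv [10, 10]"

text \<open>The relation \<open>h\<^bsup>2a+1\<^esup> = g\<^sup>b\<close>, where \<open>h\<close> acts as the translation by \<open>2\<alpha>b/(2a+1)\<close>. The exponent is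
  \<open>2a+1\<close> rather than \<open>2a\<close> because \<open>\<alpha> < a/b\<close> alone gives no computable bound on the gap \<open>1 - \<alpha>b/a\<close>.\<close>
definition root_rel :: "nat \<Rightarrow> nat \<Rightarrow> nat list" where
  "root_rel a b = wpow (root_word (pr a b)) (2 * a + 1) @ winv (wpow [0] b)"

definition relators :: "real \<Rightarrow> nat list set" where
  "relators \<alpha> = {square_rel} \<union> {root_rel a b | a b. ratio_above \<alpha> a b}"

lemma conj_word_words [simp]: "conj_word j \<in> words 7"
  by (simp add: conj_word_def)

lemma side_words [simp]: "left_word i \<in> words 7" "right_word i \<in> words 7" "root_word i \<in> words 7"
  by (simp_all add: left_word_def right_word_def root_word_def inv_letter_def)

lemma rec_pres_relators:
  assumes "\<alpha> \<ge> 0" "right_computable \<alpha>" shows "rec_pres 7 (relators \<alpha>)"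
proof -
  have "relators \<alpha> \<subseteq> words 7"
    by (auto simp: relators_def square_rel_def root_rel_def inv_letter_def)
  moreover have "x \<in> list_code ` relators \<alpha> \<longleftrightarrow> x = list_code square_rel \<or>
      (\<exists>a b. ratio_above \<alpha> a b \<and> x = list_code (root_rel a b))" for x
    by (auto simp: relators_def)
  moreover have "semidecidable (\<lambda>x. x = list_code square_rel \<or> (\<exists>a b. ratio_above \<alpha> a b \<and> x = list_code (root_rel a b)))"
    unfolding root_rel_def root_word_def left_word_def right_word_def conj_word_def
    by (intro semidecidable_ratio_above[OF assms] semidecidable_intros computable_intros)
  ultimately show ?thesis by (simp add: rec_pres_def re_set_iff)
qed

lemma prod_comms_root_word:
  "prod_comms 7 (relators \<alpha>) (wpow (root_word i) m) (m div 2 + 2)"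
proof -
  have "peq (relators \<alpha>) (([12] @ [10] @ winv [12]) @ winv [10, 10]) []"
    using peq.rel[of square_rel "relators \<alpha>" "[]" "[]"] by (simp add: relators_def square_rel_def)
  then have "peq (relators \<alpha>) ((([12] @ [10] @ winv [12]) @ winv [10, 10]) @ [10, 10]) ([] @ [10, 10])"
    by (rule peq_append[OF _ peq.refl])
  then have "peq (relators \<alpha>) (([12] @ [10] @ winv [12]) @ winv [10, 10] @ [10, 10]) [10, 10]" by simp
  then have "peq (relators \<alpha>) ([12] @ [10] @ winv [12]) [10, 10]"
    using peq_cancel(2)[of "relators \<alpha>" "[12] @ [10] @ winv [12]" "[10, 10]" "[]"]
    by (simp del: winv_simps) (meson peq.sym peq.trans)
  then have "prod_comms 7 (relators \<alpha>) (wpow [10] m) 1" for m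
    using prod_comms_wpow_square[of "[12]" 7 "[10]"] by simp
  then show ?thesis unfolding root_word_def
    by (intro prod_comms_wpow_append prod_comms_wpow_conj) simp_all
qed

lemma root_rel_peq:
  assumes "ratio_above \<alpha> a b"
  shows "peq (relators \<alpha>) (wpow [0] b) (wpow (root_word (pr a b)) (2 * a + 1))"
proof -
  let ?R = "relators \<alpha>" and ?h = "wpow (root_word (pr a b)) (2 * a + 1)" and ?g = "wpow [0] b"
  have "peq ?R (?h @ winv ?g) []"
    using peq.rel[of "root_rel a b" ?R "[]" "[]"] assms by (auto simp: relators_def root_rel_def)
  then have "peq ?R ((?h @ winv ?g) @ ?g) ([] @ ?g)" by (rule peq_append[OF _ peq.refl])
  moreover have "peq ?R ((?h @ winv ?g) @ ?g) ?h" using peq_cancel(2)[of ?R ?h ?g "[]"] by simp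
  ultimately show ?thesis using peq.sym peq.trans by (metis append_Nil)
qed

lemma prod_comms_generator:
  assumes "ratio_above \<alpha> a b"
  shows "prod_comms 7 (relators \<alpha>) (wpow [0] (b * m)) ((2 * a + 1) * m div 2 + 2)"
proof -
  have "peq (relators \<alpha>) (wpow [0] (b * m)) (wpow (root_word (pr a b)) ((2 * a + 1) * m))"
    using peq_wpow[OF root_rel_peq[OF assms], of m] by (simp only: wpow_mult)
  then show ?thesis by (rule prod_comms_peq[OF prod_comms_root_word])
qed

lemma relators_action:
  assumes "\<alpha> > 0"
  shows "\<exists>\<rho>. (\<forall>i. homeo (\<rho> i)) \<and> (\<forall>r\<in>relators \<alpha>. word_map \<rho> r = id) \<and>
    word_map \<rho> [0] = (\<lambda>t. t + 2 * \<alpha>)"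
proof -
  obtain f where f: "push f" by (rule push_exists)
  obtain k where k: "homeo k" "\<And>t. - (1 / 4) \<le> t \<Longrightarrow> t \<le> 1 / 8 \<Longrightarrow> k t = t / 2"
    using homeo_contraction by blast
  have kpow: "- (1 / 4) \<le> t \<Longrightarrow> t \<le> 1 / 8 \<Longrightarrow> (k ^^ i) t = t / 2 ^ i" for t i
  proof (induction i)
    case (Suc i)
    have "- (1 / 4) \<le> t / 2 ^ i \<and> t / 2 ^ i \<le> 1 / 8"
    proof -
      have "\<bar>t / 2 ^ i\<bar> \<le> \<bar>t\<bar>" by (simp add: divide_le_eq mult_le_cancel_left1)
      moreover have "0 \<le> t \<longleftrightarrow> 0 \<le> t / 2 ^ i" by (simp add: pos_le_divide_eq)
      ultimately show ?thesis using Suc.prems by linarith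
    qed
    then show ?case using Suc k(2)[of "t / 2 ^ i"] by simp
  qed simp
  have hk: "homeo (k ^^ i)" for i by (rule homeo_funpow[OF k(1)])
  \<comment> \<open>Takes the fixed arc [0, 1/8] of f to [-1/4, -1/8], which k^i shrinks to
    [-2 \<eta>, -\<eta>].\<close>
  define r where "r = (\<lambda>t :: real. t + - (1 / 4))"
  have hr: "homeo r" unfolding r_def by (rule homeo_translation)
  \<comment> \<open>Chosen so that 2a+1 translations by s make b translations by 2 \<alpha>, as the
    relation for (a,b) demands.\<close>
  define s where "s a b = 2 * \<alpha> * real b / (2 * real a + 1)" for a b
  have "\<exists>P1 P2. push P1 \<and> push P2 \<and> (ratio_above \<alpha> a b \<longrightarrow>
      (\<forall>t. (k ^^ pr a b) (r (P1 (inv r (P2 (inv (k ^^ pr a b) t))))) = t + s a b))" for a b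
  proof (cases "ratio_above \<alpha> a b")
    case True
    define i where "i = pr a b"
    \<comment> \<open>The index i of the pair doubles as the exponent of k. Since a \<le> i, the gap
      1 - s is at least 1/(2a+1), hence at least half of 1/2^i, whereas 3 \<eta> is only 3/8 of
      it.\<close>
    define \<eta> :: real where "\<eta> = 1 / 8 / 2 ^ i"
    have b: "0 < real b" and lt: "2 * \<alpha> * real b < 2 * real a" using True by (auto simp: ratio_above_def field_simps)
    have pos: "0 < s a b" using assms b by (simp add: s_def)
    have "s a b \<le> 2 * real a / (2 * real a + 1)" unfolding s_def using lt by (intro divide_right_mono) auto
    also have "\<dots> = 1 - 1 / (2 * real a + 1)" by (simp add: field_simps)
    finally have gap: "1 / (2 * real a + 1) \<le> 1 - s a b" by simp
    have "2 * real a + 1 \<le> 2 * 2 ^ a"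
    proof -
      have "Suc a \<le> 2 ^ a" by (simp add: Suc_leI)
      then have "real (Suc a) \<le> 2 ^ a" by (metis of_nat_le_iff of_nat_numeral of_nat_power)
      then show ?thesis by simp
    qed
    also have "(2 :: real) * 2 ^ a \<le> 2 * 2 ^ i"
      unfolding i_def using le_prod_encode_1[of a b] by simp
    finally have "2 * real a + 1 \<le> 2 * 2 ^ i" .
    then have "1 / (2 * 2 ^ i) \<le> 1 / (2 * real a + 1)" by (intro divide_left_mono) auto
    moreover have "3 * \<eta> < 1 / (2 * 2 ^ i)" by (simp add: \<eta>_def field_simps)
    ultimately have \<eta>: "3 * \<eta> < 1 - s a b" using gap by linarith
    have "0 < \<eta>" by (simp add: \<eta>_def)
    from translation_split[OF pos this \<eta>] obtain f1 f2 where F: "homeo f1" "homeo f2"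
      "\<forall>t. f1 (f2 t) = t + s a b" "\<forall>t. t \<le> f1 t" "\<forall>t. t \<le> f2 t"
      "\<forall>t. f2 t = t \<longleftrightarrow> (\<exists>m::int. of_int m \<le> t \<and> t \<le> \<eta> + of_int m)"
      "\<forall>t. f1 t = t \<longleftrightarrow> (\<exists>m::int. of_int m - 2 * \<eta> \<le> t \<and> t \<le> of_int m - \<eta>)"
      by blast
    have "push (inv (k ^^ i) \<circ> f2 \<circ> (k ^^ i))"
      by (rule push_scale) (use hk F kpow[of 0 i] kpow[of "1 / 8" i] in \<open>simp_all add: \<eta>_def\<close>)
    moreover have "push (inv ((k ^^ i) \<circ> r) \<circ> f1 \<circ> ((k ^^ i) \<circ> r))"
    proof (rule push_scale)
      show "homeo ((k ^^ i) \<circ> r)" by (intro homeo_comp hk hr)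
      have ends: "((k ^^ i) \<circ> r) 0 = - 2 * \<eta>" "((k ^^ i) \<circ> r) (1 / 8) = - \<eta>"
        using kpow[of "- (1 / 4)" i] kpow[of "- (1 / 8)" i] by (simp_all add: r_def \<eta>_def)
      have shift: "- 2 * \<eta> + x = x - 2 * \<eta>" "- \<eta> + x = x - \<eta>" for x by simp_all
      show "f1 t = t \<longleftrightarrow> (\<exists>m::int. ((k ^^ i) \<circ> r) 0 + of_int m \<le> t \<and> t \<le> ((k ^^ i) \<circ> r) (1 / 8) + of_int m)" for t
        unfolding ends shift using F(7) by blast
    qed (use F in auto)
    moreover have "inv ((k ^^ i) \<circ> r) = inv r \<circ> inv (k ^^ i)" by (intro o_inv_distrib homeo_bij hk hr)
    then have "(k ^^ i) (r ((inv ((k ^^ i) \<circ> r) \<circ> f1 \<circ> ((k ^^ i) \<circ> r)) (inv r ((inv (k ^^ i) \<circ> f2 \<circ> (k ^^ i)) (inv (k ^^ i) t))))) = t + s a b" for t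
      using hk hr F(3) by simp
    ultimately show ?thesis unfolding i_def by blast
  next
    case False
    \<comment> \<open>Without a relation to satisfy, any push keeps the sequence total.\<close>
    then show ?thesis using f by blast
  qed
  then obtain P1 P2 where P: "\<And>a b. push (P1 a b)" "\<And>a b. push (P2 a b)"
    "\<And>a b t. ratio_above \<alpha> a b \<Longrightarrow> (k ^^ pr a b) (r (P1 a b (inv r (P2 a b (inv (k ^^ pr a b) t))))) = t + s a b"
    by metis
  \<comment> \<open>Even indices hold the right factors and odd ones the left factors, as in
    \<open>right_word\<close> and \<open>left_word\<close>.\<close>
  define P where "P j = (if even j then P2 else P1) (pf (j div 2)) (ps (j div 2))" for j
  have push_P: "push (P j)" for j by (simp add: P_def P)
  obtain \<sigma> \<beta> where \<sigma>: "homeo \<sigma>" "homeo \<beta>"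
    "\<forall>j t. P j (inv (\<sigma> ^^ j) (\<beta> ((\<sigma> ^^ j) t))) = inv (\<sigma> ^^ j) (\<beta> ((\<sigma> ^^ j) (f t)))"
    using universal_conjugators[where P = P, OF f push_P] by blast
  \<comment> \<open>The square moves exactly the points that f moves, so f is conjugate to it; the
    conjugator realises \<open>square_rel\<close>.\<close>
  have "push (f \<circ> f)"
  proof -
    have "f (f t) = t \<longleftrightarrow> f t = t" "t \<le> f (f t)" for t
      using f unfolding push_def by (metis order_antisym order_trans)+
    then show ?thesis using f homeo_comp unfolding push_def by simp
  qed
  then obtain a where a: "homeo a" "\<And>t. a (f t) = f (f (a t))"
    using push_conjugate[OF f] by (metis comp_apply)
  \<comment> \<open>Letters outside the alphabet act by \<open>id\<close>: \<open>peq\<close> may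
    pass through them, so they need an action too.\<close>
  define \<rho> where "\<rho> i = (if i = 0 then (\<lambda>t. t + 2 * \<alpha>) else if i = 1 then k else if i = 2 then r
    else if i = 3 then \<sigma> else if i = 4 then \<beta> else if i = 5 then f else if i = 6 then a else id)" for i :: nat
  have h: "homeo (\<rho> i)" for i
    by (simp add: \<rho>_def k hr \<sigma> a homeo_push[OF f] homeo_translation)
  note eval = word_map_append[OF h] word_map_winv[OF h] word_map_wpow[OF h]
  have letters: "letter_map \<rho> 0 = (\<lambda>t. t + 2 * \<alpha>)" "letter_map \<rho> 2 = k" "letter_map \<rho> 4 = r" "letter_map \<rho> 6 = \<sigma>"
    "letter_map \<rho> 8 = \<beta>" "letter_map \<rho> 10 = f" "letter_map \<rho> 12 = a"
    by (simp_all add: letter_map_def \<rho>_def)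
  then have gens: "word_map \<rho> [0] = (\<lambda>t. t + 2 * \<alpha>)" "word_map \<rho> [10] = f" "word_map \<rho> [12] = a"
    by simp_all
  have conj: "P j (word_map \<rho> (conj_word j) t) = word_map \<rho> (conj_word j) (f t)" for j t
    using \<sigma>(3) by (simp add: conj_word_def eval letters)
  have conj': "word_map \<rho> (conj_word j) (f (inv (word_map \<rho> (conj_word j)) t)) = P j t" for j t
    using homeo_inv1[OF homeo_word_map[OF h]] by (simp flip: conj)
  have side: "inv (F \<circ> G) t = inv G (inv F t)" if "homeo F" "homeo G" for F G :: "real \<Rightarrow> real" and t
    using o_inv_distrib[of F G] that homeo_bij by simp
  have root: "word_map \<rho> (root_word (pr x y)) = (\<lambda>t. t + s x y)" if "ratio_above \<alpha> x y" for x y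
  proof
    fix t
    let ?i = "pr x y"
    have L: "word_map \<rho> (left_word ?i @ [10] @ winv (left_word ?i)) t = (k ^^ ?i) (r (P1 x y (inv r (inv (k ^^ ?i) t))))" for t
    proof -
      have "word_map \<rho> (left_word ?i) = ((k ^^ ?i) \<circ> r) \<circ> word_map \<rho> (conj_word (2 * ?i + 1))"
        by (simp add: left_word_def eval letters comp_assoc)
      then show ?thesis
        using conj'[of "2 * ?i + 1"] by (simp add: eval letters side homeo_comp hk hr h P_def)
    qed
    have R: "word_map \<rho> (right_word ?i @ [10] @ winv (right_word ?i)) t = (k ^^ ?i) (P2 x y (inv (k ^^ ?i) t))" for t
    proof -
      have "word_map \<rho> (right_word ?i) = (k ^^ ?i) \<circ> word_map \<rho> (conj_word (2 * ?i))"
        by (simp add: right_word_def eval letters)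
      then show ?thesis using conj'[of "2 * ?i"] by (simp add: eval letters side hk h P_def)
    qed
    have "word_map \<rho> (root_word ?i) t = (k ^^ ?i) (r (P1 x y (inv r (P2 x y (inv (k ^^ ?i) t)))))"
      unfolding root_word_def eval(1)[where u = "left_word ?i @ [10] @ winv (left_word ?i)"] comp_apply L R
      using hk by simp
    then show "word_map \<rho> (root_word ?i) t = t + s x y" using P(3)[OF that] by simp
  qed
  have trans_pow: "((\<lambda>t. t + c) ^^ n) = (\<lambda>t. t + real n * c)" for c n
    by (induction n) (auto simp: algebra_simps fun_eq_iff)
  have "word_map \<rho> u = id" if u: "u \<in> relators \<alpha>" for u
  proof -
    consider "u = square_rel" | x y where "ratio_above \<alpha> x y" "u = root_rel x y"
      using u by (auto simp: relators_def)
    then show ?thesis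
    proof cases
      case 1
      have hf: "homeo f" by (rule homeo_push[OF f])
      have "word_map \<rho> ([12] @ [10] @ winv [12]) = f \<circ> f"
      proof
        fix t
        have "a (f (inv a t)) = f (f t)" using a by simp
        then show "word_map \<rho> ([12] @ [10] @ winv [12]) t = (f \<circ> f) t"
          unfolding eval gens by simp
      qed
      moreover have "word_map \<rho> (winv ([10] @ [10])) = inv (f \<circ> f)" unfolding eval gens ..
      moreover have "(f \<circ> f) \<circ> inv (f \<circ> f) = id" using homeo_inv1[OF homeo_comp[OF hf hf]] by auto
      ultimately show ?thesis unfolding 1 square_rel_def eval(1)[where u = "[12] @ [10] @ winv [12]"] by simp
    next
      case 2
      have "word_map \<rho> (wpow (root_word (pr x y)) (2 * x + 1)) = (\<lambda>t. t + real (2 * x + 1) * s x y)"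
        unfolding eval root[OF 2(1)] trans_pow ..
      also have "real (2 * x + 1) * s x y = real y * (2 * \<alpha>)"
      proof -
        have "2 * real x + 1 \<noteq> 0" using of_nat_0_le_iff[of x] by linarith
        moreover have "c * (d / c) = d" if "c \<noteq> 0" for c d :: real using that by simp
        ultimately have "(2 * real x + 1) * s x y = 2 * \<alpha> * real y" unfolding s_def by blast
        moreover have "real (2 * x + 1) = 2 * real x + 1" by simp
        ultimately show ?thesis by (simp only: mult_ac)
      qed
      also have "(\<lambda>t. t + real y * (2 * \<alpha>)) = word_map \<rho> (wpow [0] y)" unfolding eval gens trans_pow ..
      finally have "word_map \<rho> u = word_map \<rho> (wpow [0] y) \<circ> inv (word_map \<rho> (wpow [0] y))"
        unfolding 2(2) root_rel_def eval(1,2) by simp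
      also have "\<dots> = id" using homeo_inv1[OF homeo_word_map[OF h]] by (simp only: fun_eq_iff comp_apply id_apply) blast
      finally show ?thesis .
    qed
  qed
  then show ?thesis using h gens(1) by blast
qed

lemma scl_relators:
  assumes "\<alpha> > 0" shows "scl 7 (relators \<alpha>) [0] = ereal \<alpha>"
proof -
  let ?R = "ratios 7 (relators \<alpha>) [0]"
  obtain \<rho> where \<rho>: "\<And>i. homeo (\<rho> i)" "\<And>r. r \<in> relators \<alpha> \<Longrightarrow> word_map \<rho> r = id"
    "word_map \<rho> [0] = (\<lambda>t. t + 2 * \<alpha>)" using relators_action[OF assms] by metis
  have low: "\<alpha> \<le> q" if "q \<in> ?R" for q
    using that ratio_lower_bound[OF \<rho>] by (auto simp: ratios_def)
  \<comment> \<open>Scaling the pair by M dilutes both surpluses, the odd exponent and the two extra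
    commutators; with m = 4 they add up to exactly 4 commutators.\<close>
  have up: "real a / real b + 1 / real (M * b) \<in> ?R" if ab: "ratio_above \<alpha> a b" "0 < M" for a b M
  proof -
    have "ratio_above \<alpha> (M * a) (M * b)" using ab by (simp add: ratio_above_def)
    from prod_comms_generator[OF this, of 4]
    have "prod_comms 7 (relators \<alpha>) (wpow [0] (M * b * 4)) (4 * (M * a + 1))"
    proof -
      have "(2 * (M * a) + 1) * 4 div 2 + 2 = 4 * (M * a + 1)" by simp
      then show ?thesis using \<open>prod_comms 7 _ _ ((2 * (M * a) + 1) * 4 div 2 + 2)\<close> by (simp only:)
    qed
    moreover have "real a / real b + 1 / real (M * b) = real (4 * (M * a + 1)) / real (M * b * 4)"
      using ab by (simp add: ratio_above_def field_simps)
    moreover have "1 \<le> M * b * 4" using ab by (simp add: ratio_above_def)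
    ultimately show ?thesis unfolding ratios_def by blast
  qed
  obtain a b where ab: "ratio_above \<alpha> a b" using ratio_above_dense[of \<alpha> "\<alpha> + 1"] assms by fastforce
  then have "?R \<noteq> {}" using up[of a b 1] by auto
  then have "\<exists>N\<ge>1. in_comm_sub 7 (relators \<alpha>) (wpow [0] N)" by (auto simp: ratios_def in_comm_sub_def)
  then have "scl 7 (relators \<alpha>) [0] = ereal (Inf ?R)" by (rule scl_eq_Inf)
  moreover have "Inf ?R = \<alpha>"
  proof (rule antisym)
    show "\<alpha> \<le> Inf ?R" using low \<open>?R \<noteq> {}\<close> by (intro cInf_greatest)
    show "Inf ?R \<le> \<alpha>"
    proof (rule ccontr)
      assume "\<not> Inf ?R \<le> \<alpha>"
      then obtain a b where ab: "ratio_above \<alpha> a b" "real a / real b < Inf ?R"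
        using ratio_above_dense[of \<alpha> "Inf ?R"] assms by (metis less_imp_le not_le)
      define e where "e = Inf ?R - real a / real b"
      have "0 < e" using ab by (simp add: e_def)
      then obtain M where M: "0 < M" "1 / real M < e"
        by (metis of_nat_0_less_iff real_arch_inverse inverse_eq_divide neq0_conv)
      have b: "1 \<le> real b" using ab by (simp add: ratio_above_def)
      have "1 / real (M * b) \<le> 1 / real M" using b M by (simp add: divide_simps)
      then have "real a / real b + 1 / real (M * b) < Inf ?R" using M unfolding e_def by linarith
      moreover have "Inf ?R \<le> real a / real b + 1 / real (M * b)"
        by (rule cInf_lower[OF up[OF ab(1) M(1)] bdd_below_ratios])
      ultimately show False by simp
    qed
  qed
  ultimately show ?thesis by simp
qed

lemma SCL_rp_eq: "SCL_rp = {\<alpha>. \<alpha> \<ge> 0 \<and> right_computable \<alpha>}"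
proof (intro equalityI subsetI)
  fix s assume "s \<in> SCL_rp"
  then obtain n R g where "rec_pres n R" "scl n R g = ereal s" unfolding SCL_rp_def by blast
  then show "s \<in> {\<alpha>. \<alpha> \<ge> 0 \<and> right_computable \<alpha>}" using ratio_above_scl_iff(1) scl_right_computable by blast
next
  fix \<alpha> assume *: "\<alpha> \<in> {\<alpha>. \<alpha> \<ge> 0 \<and> right_computable \<alpha>}"
  show "\<alpha> \<in> SCL_rp"
  proof (cases "\<alpha> = 0")
    case True
    then show ?thesis using trivial_group_scl by simp
  next
    case False
    then have "rec_pres 7 (relators \<alpha>) \<and> [0] \<in> words 7 \<and> scl 7 (relators \<alpha>) [0] = ereal \<alpha>"
      using * rec_pres_relators scl_relators by (simp add: words_def)
    then show ?thesis unfolding SCL_rp_def by blast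
  qed
qed

theorem theorem1p1:
  shows "SCL_rp = {\<alpha>. \<alpha> \<ge> 0 \<and> right_computable \<alpha>}
    \<and> (\<forall>\<alpha>. \<alpha> \<ge> 0 \<and> computable_real \<alpha> \<longrightarrow> \<alpha> \<in> SCL_rp)
    \<and> (\<forall>\<alpha>::real. \<alpha> \<ge> 0 \<and> algebraic \<alpha> \<longrightarrow> \<alpha> \<in> SCL_rp)
    \<and> (\<forall>\<alpha>\<in>SCL_rp. \<forall>\<beta>\<in>SCL_rp. \<alpha> + \<beta> \<in> SCL_rp)
    \<and> (\<exists>\<alpha>\<in>SCL_rp. \<exists>\<beta>\<in>SCL_rp. \<alpha> - \<beta> > 0 \<and> \<alpha> - \<beta> \<notin> SCL_rp)"
proof -
  obtain \<alpha> \<beta> where "\<alpha> \<ge> 0" "\<beta> \<ge> 0" "right_computable \<alpha>" "right_computable \<beta>"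
    "\<alpha> - \<beta> > 0" "\<not> right_computable (\<alpha> - \<beta>)"
    by (rule right_computable_not_closed_diff)
  then have "\<exists>\<alpha>\<in>SCL_rp. \<exists>\<beta>\<in>SCL_rp. \<alpha> - \<beta> > 0 \<and> \<alpha> - \<beta> \<notin> SCL_rp"
    unfolding SCL_rp_eq by blast
  then show ?thesis
    unfolding SCL_rp_eq
    using computable_imp_right_computable algebraic_imp_right_computable right_computable_add by auto
qed

end
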